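(* Let $(H\to\mathbb{C}\times M,\nabla)$ and $(\widetilde H\to\mathbb{C}\times M,\widetilde\nabla)$ be two holomorphic $(T)$-structures of rank $r$ over the same manifold $M$. Let $t^0\in M$, and let $\underline{v}$ and $\underline{\widetilde v}$ be bases of $\mathcal{O}(H)_{(0,t^0)}$ and $\mathcal{O}(\widetilde H)_{(0,t^0)}$. Let $T\in GL_r(\mathcal{O}_{M,t^0}[[z]])$ define a formal isomorphism between the (formalized with respect to $z$) germs at $(0,t^0)$ of the first and the second $(T)$-structure which maps $\underline{v}\cdot T$ to $\underline{\widetilde v}$, and suppose that $T|_{t=t^0}\in GL_r(\mathbb{C}\{z\})$. Then $T$ is holomorphic, i.e. $T\in GL_r(\mathcal{O}_{\mathbb{C}\times M,(0,t^0)})$, and the germs at $(0,t^0)$ of the two $(T)$-structures are holomorphically isomorphic.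
   Context: $M$ is a complex manifold, $z$ the coordinate on $\mathbb{C}$. A $(T)$-structure $(H\to\mathbb{C}\times M,\nabla)$ is a holomorphic vector bundle $H\to\mathbb{C}\times M$ with a map $\nabla:\mathcal{O}(H)\to\frac1z\mathcal{O}_{\mathbb{C}\times M}\cdot\Omega^1_M\otimes\mathcal{O}(H)$ which satisfies the Leibniz rule for holomorphic vector fields $X$ on $M$, and $\nabla_X\nabla_Y-\nabla_Y\nabla_X=\nabla_{[X,Y]}$ for holomorphic vector fields $X,Y$ on $M$ (there is no derivative in the $z$-direction). With local coordinates $t=(t_1,\dots,t_n)$ on $M$ near $t^0$, $\partial_i=\partial/\partial t_i$, write $\nabla\underline{v}=\underline{v}\cdot\sum_{i=1}^nz^{-1}A_i\,dt_i$ and $\widetilde\nabla\underline{\widetilde v}=\underline{\widetilde v}\cdot\sum_{i=1}^nz^{-1}\widetilde A_i\,dt_i$ with holomorphic matrices $A_i,\widetilde A_i$ in $M_{r\times r}(\mathcal{O}_{\mathbb{C}\times M,(0,t^0)})$. That $T$ defines a formal isomorphism which maps $\underline{v}\cdot T$ to $\underline{\widetilde v}$ means that the formal power series identities $0=z\partial_iT+A_iT-T\widetilde A_i$ hold for all $i\in\{1,\dots,n\}$. *)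

theory Defs
  imports "HOL-Complex_Analysis.Complex_Analysis"
begin

section \<open>Complex vector spaces and holomorphic maps of several variables\<close>

class complex_vector = real_vector +
  fixes scaleC :: "complex \<Rightarrow> 'a \<Rightarrow> 'a"
  assumes scaleC_add_right: "scaleC c (x + y) = scaleC c x + scaleC c y"
    and scaleC_add_left: "scaleC (c + d) x = scaleC c x + scaleC d x"
    and scaleC_scaleC: "scaleC c (scaleC d x) = scaleC (c * d) x"
    and scaleC_of_real: "scaleC (complex_of_real r) x = scaleR r x"

class complex_normed_vector = complex_vector + real_normed_vector +
  assumes norm_scaleC: "norm (scaleC c x) = norm c * norm x"

instantiation complex :: complex_normed_vector
begin
definition scaleC_complex_def: "scaleC = ((*) :: complex \<Rightarrow> complex \<Rightarrow> complex)"
instance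
  by standard (auto simp: scaleC_complex_def algebra_simps norm_mult scaleR_conv_of_real)
end

instantiation prod :: (complex_vector, complex_vector) complex_vector
begin
definition scaleC_prod_def: "scaleC c p = (scaleC c (fst p), scaleC c (snd p))"
instance
  by standard
    (auto simp: scaleC_prod_def prod_eq_iff scaleC_add_right scaleC_add_left scaleC_scaleC
      scaleC_of_real)
end

instance prod :: (complex_normed_vector, complex_normed_vector) complex_normed_vector
proof
  fix c :: complex and p :: "'a \<times> 'b"
  have "(norm (scaleC c p))\<^sup>2 = (norm c * norm p)\<^sup>2"
    by (simp add: scaleC_prod_def norm_prod_def norm_scaleC power_mult_distrib algebra_simps)
  then show "norm (scaleC c p) = norm c * norm p"
    by (simp add: power2_eq_iff_nonneg)
qed

instantiation vec :: (complex_vector, finite) complex_vector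
begin
definition scaleC_vec_def: "scaleC c x = (\<chi> i. scaleC c (x $ i))"
instance
  by standard
    (auto simp: scaleC_vec_def vec_eq_iff scaleC_add_right scaleC_add_left scaleC_scaleC
      scaleC_of_real)
end

instance vec :: (complex_normed_vector, finite) complex_normed_vector
proof
  fix c :: complex and x :: "'a ^ 'b"
  show "norm (scaleC c x) = norm c * norm x"
    by (simp add: scaleC_vec_def norm_vec_def norm_scaleC L2_set_right_distrib)
qed

definition clinear_on :: "'a::complex_vector set \<Rightarrow> ('a \<Rightarrow> 'b::complex_vector) \<Rightarrow> bool" where
  "clinear_on V f \<longleftrightarrow>
     (\<forall>x\<in>V. \<forall>y\<in>V. f (x + y) = f x + f y) \<and> (\<forall>c. \<forall>x\<in>V. f (scaleC c x) = scaleC c (f x))"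

definition csubspace :: "'a::complex_vector set \<Rightarrow> bool" where
  "csubspace V \<longleftrightarrow> 0 \<in> V \<and> (\<forall>x\<in>V. \<forall>y\<in>V. x + y \<in> V) \<and> (\<forall>c. \<forall>x\<in>V. scaleC c x \<in> V)"

text \<open>Complex Frechet differentiability at every point; only used for open \<open>S\<close>.\<close>

definition cholo_on ::
  "('a::complex_normed_vector \<Rightarrow> 'b::complex_normed_vector) \<Rightarrow> 'a set \<Rightarrow> bool" where
  "cholo_on f S \<longleftrightarrow> (\<forall>x\<in>S. \<exists>L. (f has_derivative L) (at x) \<and> clinear_on UNIV L)"

section \<open>Complex manifolds\<close>

text \<open>A chart \<open>(U, \<phi>)\<close> consists of its domain and a map, whose values outside \<open>U\<close> are irrelevant.
  The atlas need not be maximal.\<close>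

type_synonym ('m, 'e) chart = "'m set \<times> ('m \<Rightarrow> 'e)"

definition complex_manifold ::
  "('m::t2_space, 'e::complex_normed_vector) chart set \<Rightarrow> bool" where
  "complex_manifold \<A> \<longleftrightarrow>
     (\<forall>p. \<exists>(U, \<phi>)\<in>\<A>. p \<in> U) \<and>
     (\<forall>(U, \<phi>)\<in>\<A>. open U \<and> open (\<phi> ` U) \<and> homeomorphism U (\<phi> ` U) \<phi> (inv_into U \<phi>)) \<and>
     (\<forall>(U, \<phi>)\<in>\<A>. \<forall>(V, \<psi>)\<in>\<A>. cholo_on (\<lambda>y. \<psi> (inv_into U \<phi> y)) (\<phi> ` (U \<inter> V)))"

text \<open>The product atlas of \<open>\<complex> \<times> M\<close>.\<close>

definition cyl :: "('m, 'e) chart set \<Rightarrow> (complex \<times> 'm, complex \<times> 'e) chart set" where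
  "cyl \<A> = (\<lambda>(U, \<phi>). (UNIV \<times> U, \<lambda>(z, t). (z, \<phi> t))) ` \<A>"

text \<open>Holomorphic functions on an open subset \<open>W\<close> of a manifold, and near a point.\<close>

definition mholo ::
  "('m, 'e::complex_normed_vector) chart set \<Rightarrow> 'm set \<Rightarrow> ('m \<Rightarrow> 'b::complex_normed_vector) \<Rightarrow> bool"
  where
  "mholo \<A> W f \<longleftrightarrow> (\<forall>(U, \<phi>)\<in>\<A>. cholo_on (\<lambda>y. f (inv_into U \<phi> y)) (\<phi> ` (U \<inter> W)))"

definition holo_germ ::
  "('m::topological_space, 'e::complex_normed_vector) chart set \<Rightarrow> 'm \<Rightarrow>
   ('m \<Rightarrow> 'b::complex_normed_vector) \<Rightarrow> bool" where
  "holo_germ \<A> p f \<longleftrightarrow> (\<exists>W. open W \<and> p \<in> W \<and> mholo \<A> W f)"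

subsection \<open>Tangent vectors and vector fields\<close>

text \<open>A tangent vector at \<open>p\<close> is a directional derivative at \<open>p\<close>, acting on the functions that are
  holomorphic near \<open>p\<close>; it is normalised to be \<open>0\<close> on all other functions, so that
  equality of tangent vectors is equality of functionals.\<close>

type_synonym 'm tvec = "('m \<Rightarrow> complex) \<Rightarrow> complex"

definition dirderiv ::
  "('m::topological_space, 'e::complex_normed_vector) chart set \<Rightarrow> ('m, 'e) chart \<Rightarrow> 'm \<Rightarrow> 'e \<Rightarrow> 'm tvec"
  where
  "dirderiv \<A> c p v = (\<lambda>f. if holo_germ \<A> p f
     then frechet_derivative (\<lambda>y. f (inv_into (fst c) (snd c) y)) (at (snd c p)) v else 0)"

definition tangent_space ::
  "('m::topological_space, 'e::complex_normed_vector) chart set \<Rightarrow> 'm \<Rightarrow> 'm tvec set" where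
  "tangent_space \<A> p = {dirderiv \<A> c p v | c v. c \<in> \<A> \<and> p \<in> fst c}"

text \<open>Locally a holomorphic vector field is \<open>\<Sum>\<^sub>i a\<^sub>i \<partial>\<^sub>i\<close> with holomorphic \<open>a\<close>.\<close>

definition holo_vector_field ::
  "('m::topological_space, 'e::complex_normed_vector) chart set \<Rightarrow> 'm set \<Rightarrow> ('m \<Rightarrow> 'm tvec) \<Rightarrow> bool"
  where
  "holo_vector_field \<A> U X \<longleftrightarrow>
     (\<forall>p\<in>U. \<exists>c\<in>\<A>. p \<in> fst c \<and>
        (\<exists>a. mholo \<A> (U \<inter> fst c) a \<and> (\<forall>q\<in>U \<inter> fst c. X q = dirderiv \<A> c q (a q))))"

definition coord_field ::
  "('m::topological_space, complex ^ 'n) chart set \<Rightarrow> ('m, complex ^ 'n) chart \<Rightarrow> 'n \<Rightarrow> 'm \<Rightarrow> 'm tvec"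
  where
  "coord_field \<A> c i = (\<lambda>p. dirderiv \<A> c p (axis i 1))"

definition lie_bracket ::
  "('m::topological_space, 'e::complex_normed_vector) chart set \<Rightarrow>
   ('m \<Rightarrow> 'm tvec) \<Rightarrow> ('m \<Rightarrow> 'm tvec) \<Rightarrow> 'm \<Rightarrow> 'm tvec" where
  "lie_bracket \<A> X Y = (\<lambda>p f. if holo_germ \<A> p f
     then X p (\<lambda>q. Y q f) - Y p (\<lambda>q. X q f) else 0)"

section \<open>Holomorphic vector bundles\<close>

text \<open>A family of complex vector spaces, given as subspaces \<open>fibre H x\<close> of an auxiliary complex
  vector space \<open>'v\<close> (whose further structure plays no role, so that this is no restriction),
  together with local trivialisations \<open>(W, \<psi>)\<close>, where \<open>\<psi> x\<close> is a linear isomorphism from the fibre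
  over \<open>x \<in> W\<close> to \<open>\<complex>\<^sup>r\<close>. The holomorphic structure of the total space is the one induced by the
  trivialisations. The rank is \<open>CARD('r)\<close>.\<close>

record ('b, 'v, 'r::finite) vector_bundle =
  fibre :: "'b \<Rightarrow> 'v set"
  trivs :: "('b set \<times> ('b \<Rightarrow> 'v \<Rightarrow> complex ^ 'r)) set"

definition holo_vector_bundle ::
  "('b::topological_space, 'e::complex_normed_vector) chart set \<Rightarrow>
   ('b, 'v::complex_vector, 'r::finite) vector_bundle \<Rightarrow> bool" where
  "holo_vector_bundle \<B> H \<longleftrightarrow>
     (\<forall>x. csubspace (fibre H x)) \<and>
     (\<forall>x. \<exists>(W, \<psi>)\<in>trivs H. x \<in> W) \<and>
     (\<forall>(W, \<psi>)\<in>trivs H. open W \<and>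
        (\<forall>x\<in>W. bij_betw (\<psi> x) (fibre H x) UNIV \<and> clinear_on (fibre H x) (\<psi> x))) \<and>
     (\<forall>(W, \<psi>)\<in>trivs H. \<forall>(W', \<psi>')\<in>trivs H. \<exists>g :: 'b \<Rightarrow> complex ^ 'r ^ 'r.
        mholo \<B> (W \<inter> W') g \<and> (\<forall>x\<in>W \<inter> W'. \<forall>h\<in>fibre H x. \<psi>' x h = g x *v \<psi> x h))"

text \<open>\<open>s \<in> \<O>(H)(W)\<close> for open \<open>W\<close>, and germs of holomorphic sections at a point.\<close>

definition holo_section ::
  "('b::topological_space, 'e::complex_normed_vector) chart set \<Rightarrow>
   ('b, 'v::complex_vector, 'r::finite) vector_bundle \<Rightarrow> 'b set \<Rightarrow> ('b \<Rightarrow> 'v) \<Rightarrow> bool" where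
  "holo_section \<B> H W s \<longleftrightarrow>
     (\<forall>x\<in>W. s x \<in> fibre H x) \<and> (\<forall>(W', \<psi>)\<in>trivs H. mholo \<B> (W \<inter> W') (\<lambda>x. \<psi> x (s x)))"

definition section_germ ::
  "('b::topological_space, 'e::complex_normed_vector) chart set \<Rightarrow>
   ('b, 'v::complex_vector, 'r::finite) vector_bundle \<Rightarrow> 'b \<Rightarrow> ('b \<Rightarrow> 'v) \<Rightarrow> bool" where
  "section_germ \<B> H p s \<longleftrightarrow> (\<exists>W. open W \<and> p \<in> W \<and> holo_section \<B> H W s)"

text \<open>\<open>v\<close> is a basis of the \<open>\<O>\<^sub>p\<close>-module \<open>\<O>(H)\<^sub>p\<close>.\<close>

definition stalk_basis ::
  "('b::topological_space, 'e::complex_normed_vector) chart set \<Rightarrow>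
   ('b, 'v::complex_vector, 'r::finite) vector_bundle \<Rightarrow> 'b \<Rightarrow> ('r \<Rightarrow> 'b \<Rightarrow> 'v) \<Rightarrow> bool" where
  "stalk_basis \<B> H p v \<longleftrightarrow>
     (\<forall>j. section_germ \<B> H p (v j)) \<and>
     (\<forall>s. section_germ \<B> H p s \<longrightarrow>
        (\<exists>f :: 'r \<Rightarrow> 'b \<Rightarrow> complex. (\<forall>j. holo_germ \<B> p (f j)) \<and>
           (\<forall>\<^sub>F x in nhds p. s x = (\<Sum>j\<in>UNIV. scaleC (f j x) (v j x))))) \<and>
     (\<forall>f :: 'r \<Rightarrow> 'b \<Rightarrow> complex. (\<forall>j. holo_germ \<B> p (f j)) \<and>
        (\<forall>\<^sub>F x in nhds p. (\<Sum>j\<in>UNIV. scaleC (f j x) (v j x)) = 0) \<longrightarrow>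
        (\<forall>j. \<forall>\<^sub>F x in nhds p. f j x = 0))"

section \<open>(T)-structures\<close>

text \<open>The \<open>H\<close>-valued 1-form \<open>nabla s\<close> in the \<open>M\<close>-directions is encoded by its values: \<open>nabla s (z, t) D\<close> is
  the value at \<open>(z, t)\<close>, \<open>z \<noteq> 0\<close>, on \<open>D \<in> T\<^sub>t M\<close>. At \<open>z = 0\<close>, where there may be a pole, the values
  are meaningless and nothing is said about them.\<close>

type_synonym ('m, 'v) T_conn = "(complex \<times> 'm \<Rightarrow> 'v) \<Rightarrow> complex \<times> 'm \<Rightarrow> 'm tvec \<Rightarrow> 'v"

definition cov ::
  "('m, 'v) T_conn \<Rightarrow> ('m \<Rightarrow> 'm tvec) \<Rightarrow> (complex \<times> 'm \<Rightarrow> 'v) \<Rightarrow> complex \<times> 'm \<Rightarrow> 'v" where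
  "cov nabla X s = (\<lambda>x. nabla s x (X (snd x)))"

locale T_structure =
  fixes \<A> :: "('m::t2_space, complex ^ 'n) chart set"
    and H :: "(complex \<times> 'm, 'v::complex_vector, 'r::finite) vector_bundle"
    and nabla :: "('m, 'v) T_conn"
  assumes manifold: "complex_manifold \<A>"
    and vbundle: "holo_vector_bundle (cyl \<A>) H"
    \<comment> \<open>\<open>nabla\<close> is a morphism of sheaves of abelian groups\<close>
    and locality: "\<lbrakk>open W; holo_section (cyl \<A>) H W s; holo_section (cyl \<A>) H W s';
          \<And>x. x \<in> W \<Longrightarrow> s x = s' x; (z, t) \<in> W; z \<noteq> 0; D \<in> tangent_space \<A> t\<rbrakk>
        \<Longrightarrow> nabla s (z, t) D = nabla s' (z, t) D"
    and additive: "\<lbrakk>open W; holo_section (cyl \<A>) H W s; holo_section (cyl \<A>) H W s';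
          (z, t) \<in> W; z \<noteq> 0; D \<in> tangent_space \<A> t\<rbrakk>
        \<Longrightarrow> nabla (\<lambda>x. s x + s' x) (z, t) D = nabla s (z, t) D + nabla s' (z, t) D"
    \<comment> \<open>with values in \<open>z\<^sup>-\<^sup>1 \<O> \<Omega>\<^sup>1\<^sub>M \<otimes> \<O>(H)\<close>\<close>
    and in_fibre: "\<lbrakk>open W; holo_section (cyl \<A>) H W s; (z, t) \<in> W; z \<noteq> 0;
          D \<in> tangent_space \<A> t\<rbrakk> \<Longrightarrow> nabla s (z, t) D \<in> fibre H (z, t)"
    and form_add: "\<lbrakk>open W; holo_section (cyl \<A>) H W s; (z, t) \<in> W; z \<noteq> 0;
          D \<in> tangent_space \<A> t; D' \<in> tangent_space \<A> t\<rbrakk>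
        \<Longrightarrow> nabla s (z, t) (\<lambda>f. D f + D' f) = nabla s (z, t) D + nabla s (z, t) D'"
    and form_scale: "\<lbrakk>open W; holo_section (cyl \<A>) H W s; (z, t) \<in> W; z \<noteq> 0;
          D \<in> tangent_space \<A> t\<rbrakk>
        \<Longrightarrow> nabla s (z, t) (\<lambda>f. c * D f) = scaleC c (nabla s (z, t) D)"
    and pole: "\<lbrakk>open U; holo_vector_field \<A> U X; open W; W \<subseteq> UNIV \<times> U;
          holo_section (cyl \<A>) H W s\<rbrakk>
        \<Longrightarrow> \<exists>s'. holo_section (cyl \<A>) H W s' \<and>
              (\<forall>(z, t)\<in>W. z \<noteq> 0 \<longrightarrow> s' (z, t) = scaleC z (cov nabla X s (z, t)))"
    and leibniz: "\<lbrakk>open U; holo_vector_field \<A> U X; open W; W \<subseteq> UNIV \<times> U;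
          holo_section (cyl \<A>) H W s; mholo (cyl \<A>) W f; (z, t) \<in> W; z \<noteq> 0\<rbrakk>
        \<Longrightarrow> cov nabla X (\<lambda>x. scaleC (f x) (s x)) (z, t) =
              scaleC (X t (\<lambda>\<tau>. f (z, \<tau>))) (s (z, t)) + scaleC (f (z, t)) (cov nabla X s (z, t))"
    and flat: "\<lbrakk>open U; holo_vector_field \<A> U X; holo_vector_field \<A> U Y; open W; W \<subseteq> UNIV \<times> U;
          holo_section (cyl \<A>) H W s; (z, t) \<in> W; z \<noteq> 0\<rbrakk>
        \<Longrightarrow> cov nabla X (cov nabla Y s) (z, t) - cov nabla Y (cov nabla X s) (z, t) =
              cov nabla (lie_bracket \<A> X Y) s (z, t)"

text \<open>\<open>nabla v = v \<cdot> \<Sum>\<^sub>i z\<^sup>-\<^sup>1 A\<^sub>i dt\<^sub>i\<close> near \<open>(0, t\<^sub>0)\<close> in the coordinates \<open>c\<close>, where \<open>v\<close> is a row of sections.\<close>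

definition connection_matrices ::
  "('m::t2_space, complex ^ 'n) chart set \<Rightarrow> ('m, 'v::complex_vector) T_conn \<Rightarrow>
   ('m, complex ^ 'n) chart \<Rightarrow> 'm \<Rightarrow> ('r::finite \<Rightarrow> complex \<times> 'm \<Rightarrow> 'v) \<Rightarrow>
   ('n \<Rightarrow> complex \<times> 'm \<Rightarrow> complex ^ 'r ^ 'r) \<Rightarrow> bool" where
  "connection_matrices \<A> nabla c t\<^sub>0 v A \<longleftrightarrow>
     (\<forall>i. holo_germ (cyl \<A>) (0, t\<^sub>0) (A i)) \<and>
     (\<forall>\<^sub>F (z, t) in nhds (0, t\<^sub>0). z \<noteq> 0 \<longrightarrow> (\<forall>i j.
        cov nabla (coord_field \<A> c i) (v j) (z, t) =
          (\<Sum>k\<in>UNIV. scaleC (inverse z * A i (z, t) $ k $ j) (v k (z, t)))))"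

text \<open>A holomorphic isomorphism of vector bundles over a neighbourhood of \<open>p\<close>, compatible with the
  connections.\<close>

definition T_germs_isomorphic ::
  "('m::t2_space, complex ^ 'n) chart set \<Rightarrow>
   (complex \<times> 'm, 'v::complex_vector, 'r::finite) vector_bundle \<Rightarrow> ('m, 'v) T_conn \<Rightarrow>
   (complex \<times> 'm, 'w::complex_vector, 'r) vector_bundle \<Rightarrow> ('m, 'w) T_conn \<Rightarrow>
   complex \<times> 'm \<Rightarrow> bool" where
  "T_germs_isomorphic \<A> H nabla H' nabla' p \<longleftrightarrow>
     (\<exists>W \<Phi>. open W \<and> p \<in> W \<and>
        (\<forall>x\<in>W. bij_betw (\<Phi> x) (fibre H x) (fibre H' x) \<and> clinear_on (fibre H x) (\<Phi> x)) \<and>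
        (\<forall>V s. open V \<and> V \<subseteq> W \<and> (\<forall>x\<in>V. s x \<in> fibre H x) \<longrightarrow>
           (holo_section (cyl \<A>) H V s \<longleftrightarrow> holo_section (cyl \<A>) H' V (\<lambda>x. \<Phi> x (s x)))) \<and>
        (\<forall>V s z t. open V \<and> V \<subseteq> W \<and> holo_section (cyl \<A>) H V s \<and> (z, t) \<in> V \<and> z \<noteq> 0 \<longrightarrow>
           (\<forall>D\<in>tangent_space \<A> t. \<Phi> (z, t) (nabla s (z, t) D) = nabla' (\<lambda>x. \<Phi> x (s x)) (z, t) D)))"

section \<open>Matrices over rings of formal and convergent power series\<close>

text \<open>Elements of \<open>\<O>\<^bsub>M,p\<^esub>[[z]]\<close> are represented by functions into \<open>complex fps\<close> whose coefficients are
  holomorphic near \<open>p\<close>. The neighbourhood may depend on the coefficient; accordingly two such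
  functions represent the same element iff each coefficient agrees near \<open>p\<close>.\<close>

definition formal_matrix ::
  "('m::topological_space, 'e::complex_normed_vector) chart set \<Rightarrow> 'm \<Rightarrow>
   ('m \<Rightarrow> complex fps ^ 'r ^ 'r) \<Rightarrow> bool" where
  "formal_matrix \<A> p T \<longleftrightarrow> (\<forall>a b k. holo_germ \<A> p (\<lambda>t. fps_nth (T t $ a $ b) k))"

definition formal_eq ::
  "'m::topological_space \<Rightarrow> ('m \<Rightarrow> complex fps ^ 'r ^ 'r) \<Rightarrow> ('m \<Rightarrow> complex fps ^ 'r ^ 'r) \<Rightarrow> bool"
  where
  "formal_eq p S T \<longleftrightarrow>
     (\<forall>a b k. \<forall>\<^sub>F t in nhds p. fps_nth (S t $ a $ b) k = fps_nth (T t $ a $ b) k)"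

definition formal_GL ::
  "('m::topological_space, 'e::complex_normed_vector) chart set \<Rightarrow> 'm \<Rightarrow>
   ('m \<Rightarrow> complex fps ^ 'r ^ 'r) \<Rightarrow> bool" where
  "formal_GL \<A> p T \<longleftrightarrow> formal_matrix \<A> p T \<and>
     (\<exists>S. formal_matrix \<A> p S \<and>
        formal_eq p (\<lambda>t. T t ** S t) (\<lambda>_. mat 1) \<and> formal_eq p (\<lambda>t. S t ** T t) (\<lambda>_. mat 1))"

text \<open>\<open>GL\<^sub>r(\<complex>{z})\<close>\<close>

definition convergent_GL :: "complex fps ^ 'r ^ 'r \<Rightarrow> bool" where
  "convergent_GL P \<longleftrightarrow> (\<forall>a b. fps_conv_radius (P $ a $ b) > 0) \<and>
     (\<exists>Q. (\<forall>a b. fps_conv_radius (Q $ a $ b) > 0) \<and> P ** Q = mat 1 \<and> Q ** P = mat 1)"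

text \<open>\<open>GL\<^sub>r(\<O>\<^bsub>B,p\<^esub>)\<close>\<close>

definition holo_GL ::
  "('b::topological_space, 'e::complex_normed_vector) chart set \<Rightarrow> 'b \<Rightarrow>
   ('b \<Rightarrow> complex ^ 'r ^ 'r) \<Rightarrow> bool" where
  "holo_GL \<B> p F \<longleftrightarrow> holo_germ \<B> p F \<and>
     (\<exists>G. holo_germ \<B> p G \<and> (\<forall>\<^sub>F x in nhds p. F x ** G x = mat 1 \<and> G x ** F x = mat 1))"

text \<open>The image in \<open>M\<^bsub>r\<times>r\<^esub>(\<O>\<^bsub>M,t\<^esub>[[z]])\<close> of a holomorphic matrix near \<open>(0, t)\<close>.\<close>

definition formalize :: "(complex \<times> 'm \<Rightarrow> complex ^ 'r ^ 'r) \<Rightarrow> 'm \<Rightarrow> complex fps ^ 'r ^ 'r" where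
  "formalize F = (\<lambda>t. \<chi> a b. fps_expansion (\<lambda>z. F (z, t) $ a $ b) 0)"

text \<open>\<open>z \<cdot> X(T)\<close>, where \<open>X\<close> acts coefficientwise.\<close>

definition z_deriv ::
  "('m \<Rightarrow> 'm tvec) \<Rightarrow> ('m \<Rightarrow> complex fps ^ 'r ^ 'r) \<Rightarrow> 'm \<Rightarrow> complex fps ^ 'r ^ 'r" where
  "z_deriv X T = (\<lambda>t. \<chi> a b. fps_X * Abs_fps (\<lambda>k. X t (\<lambda>\<tau>. fps_nth (T \<tau> $ a $ b) k)))"

definition defines_formal_isomorphism ::
  "('m::topological_space, complex ^ 'n) chart set \<Rightarrow> ('m, complex ^ 'n) chart \<Rightarrow> 'm \<Rightarrow>
   ('n \<Rightarrow> complex \<times> 'm \<Rightarrow> complex ^ 'r ^ 'r) \<Rightarrow> ('n \<Rightarrow> complex \<times> 'm \<Rightarrow> complex ^ 'r ^ 'r) \<Rightarrow>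
   ('m \<Rightarrow> complex fps ^ 'r ^ 'r) \<Rightarrow> bool" where
  "defines_formal_isomorphism \<A> c t\<^sub>0 A A' T \<longleftrightarrow>
     (\<forall>i. formal_eq t\<^sub>0 (\<lambda>_. 0)
        (\<lambda>t. z_deriv (coord_field \<A> c i) T t + formalize (A i) t ** T t - T t ** formalize (A' i) t))"

end

theory Submission
  imports Defs
begin

text \<open>In local coordinates \<open>T\<close> is a formal solution of a linear system \<open>z \<partial>\<^sub>i u + B\<^sub>i u = 0\<close>. Along a line
  \<open>s \<mapsto> t\<^sup>0 + s w\<close> its Taylor coefficients \<open>\<tau>\<^sub>m \<in> \<complex>[[z]]\<close> satisfy
  \<open>z (m + 1) \<tau>\<^bsub>m+1\<^esub> = - \<Sum>\<^sub>l b\<^sub>l \<tau>\<^bsub>m-l\<^esub>\<close>, so they are determined by the convergent series \<open>\<tau>\<^sub>0 = T|\<^bsub>t=t0\<^esub>\<close>.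
  Since all \<open>\<tau>\<^sub>m\<close> are known to be power series in \<open>z\<close>, dividing by \<open>z\<close> costs only a constant factor in the
  estimate of their coefficients, and for small \<open>w\<close> this gives \<open>|\<tau>\<^bsub>m,k\<^esub>| \<le> C 2\<^bsup>-m\<^esup> \<epsilon>\<^bsup>-k\<^esup>\<close>: the coefficients
  of \<open>T\<close> extend to a common ball, and \<open>T\<close> converges there. The matrix \<open>T\<^bsup>-1\<^esup>\<close> then is the isomorphism of
  the (T)-structures in the given bases.\<close>

text \<open>The domain of the coefficient of \<open>z^k\<close> may shrink as \<open>k\<close>
  grows, so a common domain has to be constructed before convergence in \<open>z\<close> makes
  sense. Lines do this: contracted with \<open>w\<close>, the equations in all coordinate directions
  become one ordinary equation in \<open>s\<close>, and Taylor coefficients at \<open>s = 0\<close>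
  do not see the size of the domains. The obstacle is the factor \<open>z\<close>. The coefficient
  of \<open>z^k\<close> in the next Taylor coefficient comes from that of \<open>z^(k+1)\<close> on
  the right-hand side, so every step in \<open>m\<close> costs a factor
  \<open>1 / \<epsilon>\<close>, and this loss would accumulate. But the line coefficients
  \<open>b\<close> carry a factor of size \<open>norm w\<close>, so a short direction pays for every
  step. Convergence at the base point is needed to start the recursion with a bound of the same
  shape. The differential equation must then be carried over to the sum of the series, because
  compatibility of the isomorphism with the connections is a statement about functions, not about
  formal series.\<close>

no_notation fps_nth (infixl "$" 75)

section \<open>Holomorphic maps of several variables\<close>

lemma clinear_onD:
  assumes "clinear_on UNIV L"
  shows "L (x + y) = L x + L y" "L (scaleC c x) = scaleC c (L x)"
  using assms by (auto simp: clinear_on_def)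

lemma cholo_on_subset: "cholo_on f S \<Longrightarrow> T \<subseteq> S \<Longrightarrow> cholo_on f T"
  by (auto simp: cholo_on_def)

lemma cholo_on_UnionI: "(\<And>x. x \<in> S \<Longrightarrow> \<exists>T. x \<in> T \<and> cholo_on f T) \<Longrightarrow> cholo_on f S"
  by (metis cholo_on_def)

lemma cholo_on_transform:
  assumes "cholo_on f S" "open S" "\<And>x. x \<in> S \<Longrightarrow> f x = g x"
  shows "cholo_on g S"
  unfolding cholo_on_def
proof
  fix x assume x: "x \<in> S"
  then obtain L where L: "(f has_derivative L) (at x)" "clinear_on UNIV L"
    using assms(1) by (auto simp: cholo_on_def)
  have "(g has_derivative L) (at x)"
    by (rule has_derivative_transform_within_open[OF L(1) assms(2) x assms(3)])
  with L(2) show "\<exists>L. (g has_derivative L) (at x) \<and> clinear_on UNIV L" by blast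
qed

section \<open>Closure properties of complex differentiable maps\<close>

lemma cholo_on_bounded_linear:
  assumes "bounded_linear f" "clinear_on UNIV f"
  shows "cholo_on f S"
  using assms bounded_linear_imp_has_derivative unfolding cholo_on_def by blast

lemma cholo_on_const: "cholo_on (\<lambda>_. c) S"
  unfolding cholo_on_def
proof
  have "scaleC a (0::'b) = 0" for a
    using scaleC_add_right[of a 0 "0::'b"] by simp
  then show "\<exists>L. ((\<lambda>_. c) has_derivative L) (at x) \<and> clinear_on UNIV L" for x :: 'a
    by (intro exI[of _ "\<lambda>_. 0"]) (simp add: clinear_on_def)
qed

lemma cholo_on_ident: "cholo_on (\<lambda>x. x) S"
  by (rule cholo_on_bounded_linear) (auto simp: clinear_on_def bounded_linear_ident)

lemma cholo_on_fst: "cholo_on fst S"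
  by (rule cholo_on_bounded_linear) (auto simp: clinear_on_def scaleC_prod_def bounded_linear_fst)

lemma cholo_on_snd: "cholo_on snd S"
  by (rule cholo_on_bounded_linear) (auto simp: clinear_on_def scaleC_prod_def bounded_linear_snd)

lemma cholo_on_nth: "cholo_on (\<lambda>x. x $ i) S"
  by (rule cholo_on_bounded_linear) (auto simp: clinear_on_def scaleC_vec_def bounded_linear_vec_nth)

lemma cholo_on_compose:
  assumes "cholo_on f S" "cholo_on g T" "\<And>x. x \<in> S \<Longrightarrow> f x \<in> T"
  shows "cholo_on (\<lambda>x. g (f x)) S"
  unfolding cholo_on_def
proof
  fix x assume "x \<in> S"
  then obtain L K where L: "(f has_derivative L) (at x)" "clinear_on UNIV L"
    and K: "(g has_derivative K) (at (f x))" "clinear_on UNIV K"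
    using assms unfolding cholo_on_def by metis
  have "((\<lambda>x. g (f x)) has_derivative (\<lambda>h. K (L h))) (at x)"
    using has_derivative_compose[OF L(1) K(1)] .
  moreover have "clinear_on UNIV (\<lambda>h. K (L h))"
    using L(2) K(2) by (simp add: clinear_on_def)
  ultimately show "\<exists>L. ((\<lambda>x. g (f x)) has_derivative L) (at x) \<and> clinear_on UNIV L" by blast
qed

lemma cholo_on_Pair:
  assumes "cholo_on f S" "cholo_on g S"
  shows "cholo_on (\<lambda>x. (f x, g x)) S"
  unfolding cholo_on_def
proof
  fix x assume "x \<in> S"
  then obtain L K where L: "(f has_derivative L) (at x)" "clinear_on UNIV L"
    and K: "(g has_derivative K) (at x)" "clinear_on UNIV K"
    using assms unfolding cholo_on_def by metis
  have "((\<lambda>x. (f x, g x)) has_derivative (\<lambda>h. (L h, K h))) (at x)"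
    using has_derivative_Pair[OF L(1) K(1)] .
  moreover have "clinear_on UNIV (\<lambda>h. (L h, K h))"
    using L(2) K(2) by (simp add: clinear_on_def scaleC_prod_def)
  ultimately show "\<exists>L. ((\<lambda>x. (f x, g x)) has_derivative L) (at x) \<and> clinear_on UNIV L" by blast
qed

lemma cholo_on_add:
  assumes "cholo_on f S" "cholo_on g S"
  shows "cholo_on (\<lambda>x. f x + g x) S"
  unfolding cholo_on_def
proof
  fix x assume "x \<in> S"
  then obtain L K where L: "(f has_derivative L) (at x)" "clinear_on UNIV L"
    and K: "(g has_derivative K) (at x)" "clinear_on UNIV K"
    using assms unfolding cholo_on_def by metis
  have "clinear_on UNIV (\<lambda>h. L h + K h)"
    using L(2) K(2) by (simp add: clinear_on_def scaleC_add_right)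
  then show "\<exists>L. ((\<lambda>x. f x + g x) has_derivative L) (at x) \<and> clinear_on UNIV L"
    using has_derivative_add[OF L(1) K(1)] by blast
qed

lemma cholo_on_sum:
  assumes "\<And>i. i \<in> I \<Longrightarrow> cholo_on (f i) S"
  shows "cholo_on (\<lambda>x. \<Sum>i\<in>I. f i x) S"
  using assms by (induction I rule: infinite_finite_induct) (auto intro!: cholo_on_const cholo_on_add)

lemma cholo_on_mult:
  fixes f g :: "'a::complex_normed_vector \<Rightarrow> complex"
  assumes "cholo_on f S" "cholo_on g S"
  shows "cholo_on (\<lambda>x. f x * g x) S"
  unfolding cholo_on_def
proof
  fix x assume "x \<in> S"
  then obtain L K where L: "(f has_derivative L) (at x)" "clinear_on UNIV L"
    and K: "(g has_derivative K) (at x)" "clinear_on UNIV K"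
    using assms unfolding cholo_on_def by metis
  have "clinear_on UNIV (\<lambda>h. f x * K h + L h * g x)"
    using L(2) K(2) by (simp add: clinear_on_def scaleC_complex_def algebra_simps)
  then show "\<exists>L. ((\<lambda>x. f x * g x) has_derivative L) (at x) \<and> clinear_on UNIV L"
    using has_derivative_mult[OF L(1) K(1)] by blast
qed

lemma cholo_on_minus:
  fixes f :: "'a::complex_normed_vector \<Rightarrow> complex"
  shows "cholo_on f S \<Longrightarrow> cholo_on (\<lambda>x. - f x) S"
  using cholo_on_mult[of "\<lambda>_. -1" S f] by (simp add: cholo_on_const)

lemma cholo_on_diff:
  fixes f g :: "'a::complex_normed_vector \<Rightarrow> complex"
  shows "cholo_on f S \<Longrightarrow> cholo_on g S \<Longrightarrow> cholo_on (\<lambda>x. f x - g x) S"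
  using cholo_on_add[of f S "\<lambda>x. - g x"] cholo_on_minus[of g S] by simp

lemma cholo_on_prod:
  fixes f :: "'i \<Rightarrow> 'a::complex_normed_vector \<Rightarrow> complex"
  assumes "\<And>i. i \<in> I \<Longrightarrow> cholo_on (f i) S"
  shows "cholo_on (\<lambda>x. \<Prod>i\<in>I. f i x) S"
  using assms by (induction I rule: infinite_finite_induct) (auto intro!: cholo_on_const cholo_on_mult)

lemma scaleC_1 [simp]: "scaleC 1 (x::'a::complex_vector) = x"
  using scaleC_of_real[of 1 x] by simp

lemma clinear_on_complex:
  fixes L :: "complex \<Rightarrow> complex"
  assumes "clinear_on UNIV L"
  shows "L = (*) (L 1)"
proof
  fix h show "L h = L 1 * h"
    using clinear_onD(2)[OF assms, of h 1] by (simp add: scaleC_complex_def mult.commute)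
qed

text \<open>A complex linear map of the plane is multiplication by its value at \<open>1\<close>.
  This gives access to one-variable function theory, to which the results in several variables are
  reduced along complex lines.\<close>

lemma cholo_on_iff_holomorphic_on:
  fixes f :: "complex \<Rightarrow> complex"
  assumes "open S"
  shows "cholo_on f S \<longleftrightarrow> f holomorphic_on S"
proof -
  have "(\<exists>L. (f has_derivative L) (at x) \<and> clinear_on UNIV L) \<longleftrightarrow> f field_differentiable (at x)" for x
  proof -
    have "clinear_on UNIV ((*) c)" for c :: complex
      by (simp add: clinear_on_def scaleC_complex_def algebra_simps)
    note lin = this
    show ?thesis
    proof
      assume "\<exists>L. (f has_derivative L) (at x) \<and> clinear_on UNIV L"
      then obtain L where L: "(f has_derivative L) (at x)" "clinear_on UNIV L" by blast
      then have "(f has_field_derivative L 1) (at x)"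
        using clinear_on_complex[OF L(2)] by (simp add: has_field_derivative_def)
      then show "f field_differentiable (at x)" by (auto simp: field_differentiable_def)
    next
      assume "f field_differentiable (at x)"
      then obtain d where d: "(f has_derivative (*) d) (at x)"
        unfolding field_differentiable_def has_field_derivative_def by (rule exE)
      show "\<exists>L. (f has_derivative L) (at x) \<and> clinear_on UNIV L"
        by (rule exI, rule conjI, rule d, rule lin)
    qed
  qed
  then have "cholo_on f S \<longleftrightarrow> (\<forall>x\<in>S. f field_differentiable (at x))"
    unfolding cholo_on_def by (rule ball_cong[OF refl])
  also have "\<dots> \<longleftrightarrow> (\<forall>x\<in>S. f field_differentiable (at x within S))"
    using at_within_open[OF _ assms] by (intro ball_cong refl) metis
  finally show ?thesis by (simp only: holomorphic_on_def)
qed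

lemma cholo_on_inverse:
  fixes f :: "'a::complex_normed_vector \<Rightarrow> complex"
  assumes "cholo_on f S" "\<And>x. x \<in> S \<Longrightarrow> f x \<noteq> 0"
  shows "cholo_on (\<lambda>x. inverse (f x)) S"
proof (rule cholo_on_compose[OF assms(1)])
  show "cholo_on inverse (- {0::complex})"
    by (subst cholo_on_iff_holomorphic_on) (auto intro!: holomorphic_intros)
qed (use assms(2) in auto)

lemma cholo_on_power:
  fixes f :: "'a::complex_normed_vector \<Rightarrow> complex"
  shows "cholo_on f S \<Longrightarrow> cholo_on (\<lambda>x. f x ^ n) S"
  by (induction n) (auto intro!: cholo_on_const cholo_on_mult)

text \<open>The vector is the finite sum of its entries, embedded by the bounded maps
  \<open>axis i\<close>. The entries may lie in any normed space, so matrices are covered as vectors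
  of rows.\<close>

lemma has_derivative_vec_componentwise:
  fixes f :: "'a::real_normed_vector \<Rightarrow> 'b::real_normed_vector ^ 'n"
  assumes "\<And>i. ((\<lambda>x. f x $ i) has_derivative (\<lambda>h. f' h $ i)) F"
  shows "(f has_derivative f') F"
proof -
  have bl: "bounded_linear (axis i :: 'b \<Rightarrow> 'b ^ 'n)" for i
  proof (rule bounded_linear_intro[where K = 1])
    show "norm (axis i x :: 'b ^ 'n) \<le> norm x * 1" for x
    proof -
      have "norm (axis i x :: 'b ^ 'n) \<le> (\<Sum>j\<in>UNIV. norm ((axis i x :: 'b ^ 'n) $ j))"
        unfolding norm_vec_def by (rule L2_set_le_sum) auto
      also have "\<dots> = (\<Sum>j\<in>UNIV. if j = i then norm x else 0)"
        by (intro sum.cong) (auto simp: axis_def)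
      finally show ?thesis by simp
    qed
  next
    show "axis i (x + y) = (axis i x + axis i y :: 'b ^ 'n)" for x y
      by (simp add: axis_def vec_eq_iff)
    show "axis i (r *\<^sub>R x) = (r *\<^sub>R axis i x :: 'b ^ 'n)" for r x
      by (simp add: axis_def vec_eq_iff)
  qed
  have "((\<lambda>x. \<Sum>i\<in>UNIV. axis i (f x $ i)) has_derivative (\<lambda>h. \<Sum>i\<in>UNIV. axis i (f' h $ i))) F"
  proof (rule has_derivative_sum)
    show "((\<lambda>x. axis i (f x $ i)) has_derivative (\<lambda>h. axis i (f' h $ i))) F" for i
      by (rule bounded_linear.has_derivative[OF bl assms])
  qed
  moreover have "(\<Sum>i\<in>UNIV. axis i (x $ i)) = x" for x :: "'b ^ 'n"
  proof (unfold vec_eq_iff, rule allI)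
    fix j
    have "(\<Sum>i\<in>UNIV. axis i (x $ i)) $ j = (\<Sum>i\<in>UNIV. if j = i then x $ i else 0)"
      unfolding sum_component by (intro sum.cong) (auto simp: axis_def)
    then show "(\<Sum>i\<in>UNIV. axis i (x $ i)) $ j = x $ j" by simp
  qed
  ultimately show ?thesis by simp
qed

lemma cholo_on_vec_iff:
  fixes f :: "'a::complex_normed_vector \<Rightarrow> 'b::complex_normed_vector ^ 'n"
  shows "cholo_on f S \<longleftrightarrow> (\<forall>i. cholo_on (\<lambda>x. f x $ i) S)"
proof
  show "\<forall>i. cholo_on (\<lambda>x. f x $ i) S" if "cholo_on f S"
  proof
    show "cholo_on (\<lambda>x. f x $ i) S" for i
      by (rule cholo_on_compose[OF that cholo_on_nth]) (rule UNIV_I)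
  qed
next
  assume *: "\<forall>i. cholo_on (\<lambda>x. f x $ i) S"
  show "cholo_on f S"
    unfolding cholo_on_def
  proof
    fix x assume "x \<in> S"
    then have "\<exists>L. ((\<lambda>x. f x $ i) has_derivative L) (at x) \<and> clinear_on UNIV L" for i
      using * unfolding cholo_on_def by blast
    then obtain L where L: "\<And>i. ((\<lambda>x. f x $ i) has_derivative L i) (at x) \<and> clinear_on UNIV (L i)"
      by metis
    have "(f has_derivative (\<lambda>h. \<chi> i. L i h)) (at x)"
      by (rule has_derivative_vec_componentwise) (simp add: L)
    moreover have "clinear_on UNIV (\<lambda>h. \<chi> i. L i h)"
      using L by (simp add: clinear_on_def vec_eq_iff scaleC_vec_def)
    ultimately show "\<exists>L. (f has_derivative L) (at x) \<and> clinear_on UNIV L" by blast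
  qed
qed

lemma cholo_on_imp_continuous_on: "cholo_on f S \<Longrightarrow> continuous_on S f"
  unfolding cholo_on_def
  by (intro continuous_at_imp_continuous_on ballI) (auto dest: has_derivative_continuous)

lemma cholo_on_frechet:
  assumes "cholo_on f S" "x \<in> S"
  shows "(f has_derivative frechet_derivative f (at x)) (at x)"
    and "clinear_on UNIV (frechet_derivative f (at x))"
proof -
  obtain L where L: "(f has_derivative L) (at x)" "clinear_on UNIV L"
    using assms by (auto simp: cholo_on_def)
  have "frechet_derivative f (at x) = L"
    using frechet_derivative_at[OF L(1)] by simp
  with L show "(f has_derivative frechet_derivative f (at x)) (at x)"
    "clinear_on UNIV (frechet_derivative f (at x))" by auto
qed

section \<open>Complex lines and derivatives along them\<close>

lemma bounded_linear_scaleC_left: "bounded_linear (\<lambda>s. scaleC s (w::'a::complex_normed_vector))"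
  by (rule bounded_linear_intro[where K = "norm w"])
    (auto simp: scaleC_add_left norm_scaleC scaleR_conv_of_real scaleC_of_real simp flip: scaleC_scaleC)

lemma cholo_on_line: "cholo_on (\<lambda>s. x + scaleC s (w::'a::complex_normed_vector)) S"
  by (intro cholo_on_add cholo_on_const cholo_on_bounded_linear bounded_linear_scaleC_left)
    (auto simp: clinear_on_def scaleC_add_left scaleC_scaleC scaleC_complex_def)

lemma open_line_vimage:
  assumes "open S"
  shows "open {s. x + scaleC s (w::'a::complex_normed_vector) \<in> S}"
proof -
  have "continuous_on UNIV (\<lambda>s. x + scaleC s w)"
    by (rule cholo_on_imp_continuous_on[OF cholo_on_line])
  from open_vimage[OF assms this] show ?thesis by (simp add: vimage_def)
qed

lemma holomorphic_on_line:
  fixes f :: "'a::complex_normed_vector \<Rightarrow> complex"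
  assumes "cholo_on f S" "open S" "\<And>s. s \<in> D \<Longrightarrow> x + scaleC s w \<in> S"
  shows "(\<lambda>s. f (x + scaleC s w)) holomorphic_on D"
proof -
  have "cholo_on (\<lambda>s. f (x + scaleC s w)) {s. x + scaleC s w \<in> S}"
    by (rule cholo_on_compose[OF cholo_on_line assms(1)]) auto
  then have "(\<lambda>s. f (x + scaleC s w)) holomorphic_on {s. x + scaleC s w \<in> S}"
    using cholo_on_iff_holomorphic_on[OF open_line_vimage[OF assms(2)]] by blast
  then show ?thesis by (rule holomorphic_on_subset) (use assms(3) in auto)
qed

lemma scaleC_0_left [simp]: "scaleC 0 (x::'a::complex_vector) = 0"
  using scaleC_of_real[of 0 x] by simp

lemma scaleC_0_right [simp]: "scaleC c (0::'a::complex_vector) = 0"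
  using scaleC_add_right[of c 0 "0::'a"] by simp

lemma csubspace_sum:
  assumes "csubspace V" "\<And>i. i \<in> I \<Longrightarrow> x i \<in> V"
  shows "(\<Sum>i\<in>I. scaleC (a i) (x i)) \<in> V"
  using assms(2) by (induction I rule: infinite_finite_induct) (use assms(1) in \<open>auto simp: csubspace_def\<close>)

lemma clinear_on_sum:
  assumes V: "csubspace V" and L: "clinear_on V L" and x: "\<And>i. i \<in> I \<Longrightarrow> x i \<in> V"
  shows "L (\<Sum>i\<in>I. scaleC (a i) (x i)) = (\<Sum>i\<in>I. scaleC (a i) (L (x i)))"
proof -
  have add: "L (y + y') = L y + L y'" and sc: "L (scaleC b y) = scaleC b (L y)" if "y \<in> V" "y' \<in> V" for y y' b
    using L that by (auto simp: clinear_on_def)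
  have zero: "L 0 = 0" using sc[of 0 0 0] V by (simp add: csubspace_def)
  show ?thesis
    using x
  proof (induction I rule: infinite_finite_induct)
    case (insert i I)
    have "scaleC (a i) (x i) \<in> V" using insert.prems V by (simp add: csubspace_def)
    moreover have "(\<Sum>i\<in>I. scaleC (a i) (x i)) \<in> V" by (rule csubspace_sum[OF V]) (use insert.prems in auto)
    ultimately show ?case using insert by (simp add: add sc)
  qed (simp_all add: zero)
qed

lemma csubspace_UNIV: "csubspace UNIV"
  by (simp add: csubspace_def)

lemma line_has_field_derivative:
  fixes f :: "'a::complex_normed_vector \<Rightarrow> complex"
  assumes "(f has_derivative L) (at (x + scaleC s w))" "clinear_on UNIV L"
  shows "((\<lambda>s. f (x + scaleC s w)) has_field_derivative L w) (at s)"
proof -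
  have "((\<lambda>s. x + scaleC s w) has_derivative (\<lambda>s. scaleC s w)) (at s)"
    using has_derivative_add[OF has_derivative_const[of x]
        bounded_linear_imp_has_derivative[OF bounded_linear_scaleC_left[of w]]]
    by simp
  from has_derivative_compose[OF this assms(1)]
  have "((\<lambda>s. f (x + scaleC s w)) has_derivative (\<lambda>s. L (scaleC s w))) (at s)" .
  moreover have "(\<lambda>s. L (scaleC s w)) = (*) (L w)"
    using clinear_onD(2)[OF assms(2)] by (auto simp: scaleC_complex_def mult.commute)
  ultimately show ?thesis by (simp add: has_field_derivative_def)
qed

lemma deriv_line_eq_frechet:
  fixes f :: "'a::complex_normed_vector \<Rightarrow> complex"
  assumes "cholo_on f S" "x \<in> S"
  shows "deriv (\<lambda>s. f (x + scaleC s w)) 0 = frechet_derivative f (at x) w"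
  by (rule DERIV_imp_deriv, rule line_has_field_derivative)
    (use cholo_on_frechet[OF assms] in auto)

text \<open>Cauchy's estimate on a disc of the line. Holomorphy is assumed along this line only,
  because in \<open>cholo_on_uniform_limit\<close> it is applied to \<open>f n - g\<close> before
  \<open>g\<close> is known to be complex differentiable.\<close>

lemma norm_deriv_line_le:
  fixes f :: "'a::complex_normed_vector \<Rightarrow> complex"
  assumes f: "(\<lambda>s. f (x + scaleC s w)) holomorphic_on {s. x + scaleC s w \<in> ball x r}"
    and r: "r > 0" and B: "\<And>y. y \<in> ball x r \<Longrightarrow> norm (f y) \<le> B"
  shows "norm (deriv (\<lambda>s. f (x + scaleC s w)) 0) \<le> 2 * B / r * norm w"
proof (cases "w = 0")
  case True
  then show ?thesis by simp
next
  case False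
  \<comment> \<open>The factor \<open>2\<close> keeps the closed disc inside the open ball and
    reappears in the bound \<open>2 * B / r\<close>.\<close>
  define d where "d = r / (2 * norm w)"
  have d: "d > 0" using r False by (simp add: d_def)
  have mem: "x + scaleC s w \<in> ball x r" if "norm s \<le> d" for s
  proof -
    have "norm s * norm w \<le> d * norm w" using that by (intro mult_right_mono) auto
    also have "\<dots> < r" using r False by (simp add: d_def)
    finally show ?thesis by (simp add: dist_norm norm_scaleC)
  qed
  have hol: "(\<lambda>s. f (x + scaleC s w)) holomorphic_on cball 0 d"
    by (rule holomorphic_on_subset[OF f]) (use mem in auto)
  have "norm ((deriv ^^ 1) (\<lambda>s. f (x + scaleC s w)) 0) \<le> fact 1 * B / d ^ 1"
  proof (rule Cauchy_inequality)
    show "(\<lambda>s. f (x + scaleC s w)) holomorphic_on ball 0 d"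
      using hol by (rule holomorphic_on_subset) auto
    show "continuous_on (cball 0 d) (\<lambda>s. f (x + scaleC s w))"
      using hol by (rule holomorphic_on_imp_continuous_on)
    show "cmod (f (x + scaleC s w)) \<le> B" if "cmod (0 - s) = d" for s
      using that by (intro B mem) auto
  qed (rule d)
  then show ?thesis using r False by (simp add: d_def field_simps)
qed

text \<open>The Weierstrass theorem, by slices: \<open>g\<close> is holomorphic on every line,
  Cauchy's estimate makes the derivatives along lines converge uniformly relative to
  \<open>norm h\<close>, and the theorem on differentiating sequences yields a Frechet derivative.
  Complex linearity survives the pointwise limit.\<close>

lemma cholo_on_uniform_limit:
  fixes f :: "nat \<Rightarrow> 'a::complex_normed_vector \<Rightarrow> complex"
  assumes S: "open S" and f: "\<And>n. cholo_on (f n) S" and lim: "uniform_limit S f g sequentially"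
  shows "cholo_on g S"
  unfolding cholo_on_def
proof
  fix x assume "x \<in> S"
  then obtain \<rho> where \<rho>: "\<rho> > 0" "ball x \<rho> \<subseteq> S"
    using S openE by blast
  \<comment> \<open>Half the radius, so that the ball of radius \<open>r\<close> around any point of
    \<open>ball x r\<close> stays in \<open>S\<close>.\<close>
  define r where "r = \<rho> / 2"
  have r: "r > 0" using \<rho> by (simp add: r_def)
  have sub: "z \<in> S" if "y \<in> ball x r" "z \<in> ball y r" for y z
  proof -
    have "dist x z \<le> dist x y + dist y z" by (rule dist_triangle)
    also have "\<dots> < \<rho>" using that by (simp add: r_def)
    finally show ?thesis using \<rho>(2) by auto
  qed
  define f' where "f' = (\<lambda>n y. frechet_derivative (f n) (at y))"
  \<comment> \<open>The candidate for the derivative of \<open>g\<close>, defined slice by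
    slice.\<close>
  define g' where "g' = (\<lambda>y h. deriv (\<lambda>s. g (y + scaleC s h)) 0)"
  have f_hol: "(\<lambda>s. f n (y + scaleC s h)) holomorphic_on {s. y + scaleC s h \<in> ball y r}"
    if "y \<in> ball x r" for n y h
    by (rule holomorphic_on_line[OF f S]) (use sub[OF that] in blast)
  have g_hol: "(\<lambda>s. g (y + scaleC s h)) holomorphic_on {s. y + scaleC s h \<in> ball y r}" (is "_ holomorphic_on ?D")
    if y: "y \<in> ball x r" for y h
  proof (rule holomorphic_uniform_sequence[OF open_line_vimage f_hol[OF y]])
    fix s assume "s \<in> ?D"
    then obtain d where d: "d > 0" "cball s d \<subseteq> ?D"
      using open_contains_cball[of ?D] open_line_vimage[of "ball y r" y h] by auto
    have "uniform_limit (cball s d) (\<lambda>n s. f n (y + scaleC s h)) (\<lambda>s. g (y + scaleC s h)) sequentially"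
    proof (rule uniform_limitI)
      fix e :: real assume "e > 0"
      have *: "y + scaleC t h \<in> S" if "t \<in> cball s d" for t
        using d(2) that sub[OF y] by blast
      show "\<forall>\<^sub>F n in sequentially. \<forall>t\<in>cball s d. dist (f n (y + scaleC t h)) (g (y + scaleC t h)) < e"
        using uniform_limitD[OF lim \<open>e > 0\<close>] by eventually_elim (use * in blast)
    qed
    with d show "\<exists>d>0. cball s d \<subseteq> ?D \<and>
        uniform_limit (cball s d) (\<lambda>n s. f n (y + scaleC s h)) (\<lambda>s. g (y + scaleC s h)) sequentially"
      by blast
  qed simp
  have nle: "\<forall>\<^sub>F n in sequentially. \<forall>y\<in>ball x r. \<forall>h. norm (f' n y h - g' y h) \<le> e * norm h"
    if e: "e > 0" for e
  proof -
    \<comment> \<open>With \<open>B = e * r / 2\<close> the bound \<open>2 * B / r\<close> of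
      \<open>norm_deriv_line_le\<close> is exactly \<open>e\<close>.\<close>
    have "e * r / 2 > 0" using e r by simp
    from uniform_limitD[OF lim this] show ?thesis
    proof eventually_elim
      case (elim n)
      show ?case
      proof (intro ballI allI)
        fix y h assume y: "y \<in> ball x r"
        have 0: "0 \<in> {s. y + scaleC s h \<in> ball y r}" and op: "open {s. y + scaleC s h \<in> ball y r}"
          using r open_line_vimage[OF open_ball] by auto
        have "y \<in> S" using sub[OF y, of y] r by simp
        have "norm (deriv (\<lambda>s. f n (y + scaleC s h) - g (y + scaleC s h)) 0)
            \<le> 2 * (e * r / 2) / r * norm h"
        proof (rule norm_deriv_line_le[of "\<lambda>y. f n y - g y"])
          show "(\<lambda>s. f n (y + scaleC s h) - g (y + scaleC s h))
              holomorphic_on {s. y + scaleC s h \<in> ball y r}"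
            by (intro holomorphic_intros f_hol g_hol y)
          show "cmod (f n z - g z) \<le> e * r / 2" if "z \<in> ball y r" for z
            using elim sub[OF y that] by (simp add: dist_norm less_imp_le)
        qed (rule r)
        also have "deriv (\<lambda>s. f n (y + scaleC s h) - g (y + scaleC s h)) 0
            = deriv (\<lambda>s. f n (y + scaleC s h)) 0 - g' y h"
          unfolding g'_def
          by (rule deriv_diff)
            (use holomorphic_on_imp_differentiable_at[OF f_hol[OF y] op 0]
              holomorphic_on_imp_differentiable_at[OF g_hol[OF y] op 0] in auto)
        also have "deriv (\<lambda>s. f n (y + scaleC s h)) 0 = f' n y h"
          unfolding f'_def by (rule deriv_line_eq_frechet[OF f \<open>y \<in> S\<close>])
        finally show "norm (f' n y h - g' y h) \<le> e * norm h" using r by simp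
      qed
    qed
  qed
  have derf: "(f n has_derivative f' n y) (at y within ball x r)" if "y \<in> ball x r" for n y
    unfolding f'_def
    by (rule has_derivative_at_withinI, rule cholo_on_frechet[OF f sub[OF that]]) (use r in simp)
  have x: "x \<in> ball x r" using r by simp
  have lim_pt: "(\<lambda>n. f n y) \<longlonglongrightarrow> g y" if "y \<in> S" for y
    using tendsto_uniform_limitI[OF lim that] .
  \<comment> \<open>The theorem produces a limit function of its own, which \<open>Gg\<close>
    identifies with \<open>g\<close>.\<close>
  have "\<exists>G. \<forall>y\<in>ball x r. (\<lambda>n. f n y) \<longlonglongrightarrow> G y \<and> (G has_derivative g' y) (at y within ball x r)"
    by (rule has_derivative_sequence[OF convex_ball derf nle x lim_pt[OF \<open>x \<in> S\<close>]])
  then obtain G where G: "\<And>y. y \<in> ball x r \<Longrightarrow> (\<lambda>n. f n y) \<longlonglongrightarrow> G y"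
    "\<And>y. y \<in> ball x r \<Longrightarrow> (G has_derivative g' y) (at y within ball x r)" by blast
  have Gg: "G y = g y" if "y \<in> ball x r" for y
    using LIMSEQ_unique[OF G(1)[OF that] lim_pt] sub[OF that, of y] r by simp
  have "(G has_derivative g' x) (at x)"
    using G(2)[OF x] at_within_open[OF x open_ball] by simp
  from has_derivative_transform_within_open[OF this open_ball x Gg]
  have gder: "(g has_derivative g' x) (at x)" .
  have f'lim: "(\<lambda>n. f' n x h) \<longlonglongrightarrow> g' x h" for h
  proof (rule tendstoI)
    fix e :: real assume "e > 0"
    \<comment> \<open>Adding \<open>1\<close> covers the case \<open>h = 0\<close>.\<close>
    then have "e / (norm h + 1) > 0" by (simp add: add_nonneg_pos)
    from nle[OF this] show "\<forall>\<^sub>F n in sequentially. dist (f' n x h) (g' x h) < e"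
    proof eventually_elim
      case (elim n)
      have "dist (f' n x h) (g' x h) \<le> e / (norm h + 1) * norm h"
        using elim x by (simp add: dist_norm)
      also have "\<dots> = e * (norm h / (norm h + 1))" by simp
      also have "\<dots> < e * 1"
      proof (rule mult_strict_left_mono[OF _ \<open>e > 0\<close>])
        have "norm h + 1 > 0" using norm_ge_zero[of h] by linarith
        then show "norm h / (norm h + 1) < 1" by (simp add: pos_divide_less_eq)
      qed
      finally show ?case by simp
    qed
  qed
  have "g' x (scaleC c h) = scaleC c (g' x h)" for c h
  proof (rule LIMSEQ_unique[OF f'lim])
    have "f' n x (scaleC c h) = c * f' n x h" for n
      using clinear_onD(2)[OF cholo_on_frechet(2)[OF f \<open>x \<in> S\<close>]]
      by (simp add: f'_def scaleC_complex_def)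
    then show "(\<lambda>n. f' n x (scaleC c h)) \<longlonglongrightarrow> scaleC c (g' x h)"
      by (simp add: scaleC_complex_def tendsto_mult_left f'lim)
  qed
  moreover have "g' x (h + k) = g' x h + g' x k" for h k
    using linear_add[OF has_derivative_linear[OF gder]] .
  ultimately have "clinear_on UNIV (g' x)" unfolding clinear_on_def by simp
  with gder show "\<exists>L. (g has_derivative L) (at x) \<and> clinear_on UNIV L" by (intro exI conjI)
qed

lemma cholo_on_suminf:
  fixes f :: "nat \<Rightarrow> 'a::complex_normed_vector \<Rightarrow> complex"
  assumes "open S" "\<And>n. cholo_on (f n) S" "\<And>n x. x \<in> S \<Longrightarrow> norm (f n x) \<le> M n" "summable M"
  shows "cholo_on (\<lambda>x. \<Sum>n. f n x) S"
proof (rule cholo_on_uniform_limit[OF assms(1)])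
  show "uniform_limit S (\<lambda>n x. \<Sum>i<n. f i x) (\<lambda>x. \<Sum>n. f n x) sequentially"
    by (rule Weierstrass_m_test[OF assms(3,4)])
  show "cholo_on (\<lambda>x. \<Sum>i<n. f i x) S" for n
    by (rule cholo_on_sum) (rule assms(2))
qed

text \<open>The remainder in Taylor's formula of order one. Cauchy's estimate for the second
  derivative on discs of radius \<open>d / 4\<close> gives \<open>2! * B / (d / 4)^2\<close>, which
  is where \<open>32\<close> comes from.\<close>

lemma difference_quotient_error:
  fixes u :: "complex \<Rightarrow> complex"
  assumes hol: "u holomorphic_on ball 0 d" and B: "\<And>s. s \<in> ball 0 d \<Longrightarrow> norm (u s) \<le> B"
    and h: "norm h < d / 4" "h \<noteq> 0"
  shows "norm ((u h - u 0) / h - deriv u 0) \<le> 32 * B / d\<^sup>2 * norm h"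
proof -
  have d: "d > 0" using h norm_ge_zero[of h] by linarith
  have sub: "cball s (d / 4) \<subseteq> ball 0 d" if "s \<in> ball 0 (d / 2)" for s :: complex
  proof
    fix z assume "z \<in> cball s (d / 4)"
    then have "norm z \<le> norm s + d / 4"
      using norm_triangle_sub[of z s] by (simp add: dist_norm norm_minus_commute)
    with that d show "z \<in> ball 0 d" by simp
  qed
  define U where "U = (\<lambda>i. (deriv ^^ i) u)"
  have bound: "norm (U (Suc 1) s) \<le> 32 * B / d\<^sup>2" if s: "s \<in> ball 0 (d / 2)" for s
  proof -
    have "norm ((deriv ^^ 2) u s) \<le> fact 2 * B / (d / 4) ^ 2"
    proof (rule Cauchy_inequality)
      have "u holomorphic_on cball s (d / 4)" using hol sub[OF s] by (rule holomorphic_on_subset)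
      then show "continuous_on (cball s (d / 4)) u" "u holomorphic_on ball s (d / 4)"
        by (auto intro: holomorphic_on_imp_continuous_on holomorphic_on_subset)
      show "norm (u z) \<le> B" if "cmod (s - z) = d / 4" for z
        by (rule B) (use sub[OF s] that in \<open>auto simp: dist_norm\<close>)
    qed (use d in simp)
    then show ?thesis using d by (simp add: U_def numeral_2_eq_2 power2_eq_square field_simps)
  qed
  have der: "(U i has_field_derivative U (Suc i) s) (at s within ball 0 (d / 2))"
    if "s \<in> ball 0 (d / 2)" for i s
  proof -
    have "U i holomorphic_on ball 0 d"
      unfolding U_def by (rule holomorphic_higher_deriv[OF hol open_ball])
    moreover have "s \<in> ball 0 d" using that d by simp
    ultimately have "(U i has_field_derivative deriv (U i) s) (at s)"
      by (rule holomorphic_derivI[OF _ open_ball])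
    then show ?thesis by (simp add: U_def has_field_derivative_at_within)
  qed
  have "norm (U 0 h - (\<Sum>i\<le>1. U i 0 * (h - 0) ^ i / fact i)) \<le> 32 * B / d\<^sup>2 * norm (h - 0) ^ Suc 1 / fact 1"
    by (rule complex_Taylor[OF convex_ball der bound]) (use h d in auto)
  then have *: "norm (u h - u 0 - deriv u 0 * h) \<le> 32 * B / d\<^sup>2 * (norm h)\<^sup>2"
    by (simp add: U_def numeral_2_eq_2 algebra_simps)
  have "(u h - u 0) / h - deriv u 0 = (u h - u 0 - deriv u 0 * h) / h"
    using h by (simp add: field_simps)
  then have "norm ((u h - u 0) / h - deriv u 0) = norm (u h - u 0 - deriv u 0 * h) / norm h"
    by (simp add: norm_divide)
  also have "\<dots> \<le> 32 * B / d\<^sup>2 * (norm h)\<^sup>2 / norm h"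
    using * by (rule divide_right_mono) simp
  finally show ?thesis using h by (simp add: power2_eq_square)
qed

text \<open>The difference quotients of \<open>f\<close> in the direction \<open>v\<close> converge locally uniformly.\<close>

lemma cholo_on_deriv_line:
  fixes f :: "'a::complex_normed_vector \<Rightarrow> complex"
  assumes S: "open S" and f: "cholo_on f S"
  shows "cholo_on (\<lambda>x. deriv (\<lambda>s. f (x + scaleC s v)) 0) S"
proof (cases "v = 0")
  case True
  then show ?thesis by (simp add: cholo_on_const)
next
  case v: False
  show ?thesis
  proof (rule cholo_on_UnionI)
    fix x assume x: "x \<in> S"
    have "isCont f x"
      using cholo_on_imp_continuous_on[OF f] S x continuous_on_eq_continuous_at by blast
    then have "\<forall>\<^sub>F y in nhds x. dist (f y) (f x) < 1"
      by (simp add: isCont_def tendsto_at_iff_tendsto_nhds tendstoD)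
    with eventually_nhds_in_open[OF S x] have "\<forall>\<^sub>F y in nhds x. y \<in> S \<and> dist (f y) (f x) < 1"
      by (rule eventually_conj)
    then obtain \<rho> where \<rho>: "\<rho> > 0" "\<And>y. dist y x < \<rho> \<Longrightarrow> y \<in> S \<and> dist (f y) (f x) < 1"
      unfolding eventually_nhds_metric by blast
    define B where "B = norm (f x) + 1"
    have B: "norm (f y) \<le> B" if "dist y x < \<rho>" for y
    proof -
      have "norm (f y) \<le> norm (f x) + norm (f y - f x)" by (rule norm_triangle_sub)
      with \<rho>(2)[OF that] show ?thesis by (simp add: B_def dist_norm)
    qed
    \<comment> \<open>Moving a point of \<open>ball x r\<close> by less than \<open>r\<close> stays
      in the ball of radius \<open>\<rho>\<close>, where \<open>f\<close> is bounded by
      \<open>B\<close>; \<open>d\<close> is the corresponding bound for the parameter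
      \<open>s\<close>.\<close>
    define r where "r = \<rho> / 2"
    define d where "d = r / norm v"
    have r: "r > 0" and d: "d > 0" using \<rho>(1) v by (auto simp: r_def d_def)
    have near: "dist (y + scaleC s v) x < \<rho>" if "y \<in> ball x r" "norm s < d" for y s
    proof -
      have "norm s * norm v < d * norm v"
        using that(2) v by (intro mult_strict_right_mono) auto
      then have "norm (scaleC s v) < r" using v by (simp add: norm_scaleC d_def)
      moreover have "norm (y - x) < r" using that(1) by (simp add: dist_norm norm_minus_commute)
      moreover have "dist (y + scaleC s v) x \<le> norm (y - x) + norm (scaleC s v)"
        using norm_triangle_ineq[of "y - x" "scaleC s v"] by (simp add: dist_norm algebra_simps)
      ultimately show ?thesis by (simp add: r_def)
    qed
    \<comment> \<open>Increments tending to \<open>0\<close> that are nonzero and shorter than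
      \<open>d / 4\<close>, as \<open>difference_quotient_error\<close> demands.\<close>
    define h where "h = (\<lambda>n. complex_of_real (d / 8 / real (Suc n)))"
    have norm_h: "norm (h n) = d / 8 / real (Suc n)" for n
      unfolding h_def norm_of_real using d by (simp del: of_nat_Suc)
    have h: "norm (h n) < d / 4" "h n \<noteq> 0" for n
    proof -
      have "d / 8 / real (Suc n) \<le> d / 8" using d by (simp add: field_simps)
      then show "norm (h n) < d / 4" using d unfolding norm_h by linarith
      show "h n \<noteq> 0" using d by (simp add: h_def del: of_nat_Suc)
    qed
    define q where "q = (\<lambda>n y. (f (y + scaleC (h n) v) - f y) * inverse (h n))"
    have "cholo_on (\<lambda>x. deriv (\<lambda>s. f (x + scaleC s v)) 0) (ball x r)"
    proof (rule cholo_on_uniform_limit[OF open_ball])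
      show "cholo_on (q n) (ball x r)" for n
        unfolding q_def
      proof (intro cholo_on_mult cholo_on_diff cholo_on_const)
        have "cholo_on (\<lambda>y. y + scaleC (h n) v) (ball x r)"
          by (intro cholo_on_add cholo_on_ident cholo_on_const)
        then show "cholo_on (\<lambda>y. f (y + scaleC (h n) v)) (ball x r)"
          by (rule cholo_on_compose[OF _ f]) (use near[of _ "h n"] h[of n] \<rho>(2) d in auto)
        show "cholo_on f (ball x r)"
          by (rule cholo_on_subset[OF f]) (use near[of _ 0] \<rho>(2) d in auto)
      qed
      have err: "norm (q n y - deriv (\<lambda>s. f (y + scaleC s v)) 0) \<le> 32 * B / d\<^sup>2 * norm (h n)"
        if y: "y \<in> ball x r" for n y
      proof -
        have "(\<lambda>s. f (y + scaleC s v)) holomorphic_on ball 0 d"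
          by (rule holomorphic_on_line[OF f S]) (use near[OF y] \<rho>(2) in auto)
        from difference_quotient_error[OF this B h] show ?thesis
          using near[OF y] by (simp add: q_def divide_inverse)
      qed
      show "uniform_limit (ball x r) q (\<lambda>x. deriv (\<lambda>s. f (x + scaleC s v)) 0) sequentially"
      proof (rule uniform_limitI)
        fix e :: real assume "e > 0"
        have "(\<lambda>n. d / 8 / real (Suc n)) \<longlonglongrightarrow> 0"
          by (rule LIMSEQ_Suc[OF lim_const_over_n])
        then have "(\<lambda>n. 32 * B / d\<^sup>2 * (d / 8 / real (Suc n))) \<longlonglongrightarrow> 0"
          by (rule tendsto_mult_right_zero)
        then have "(\<lambda>n. 32 * B / d\<^sup>2 * norm (h n)) \<longlonglongrightarrow> 0" unfolding norm_h .
        from order_tendstoD(2)[OF this \<open>e > 0\<close>]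
        show "\<forall>\<^sub>F n in sequentially. \<forall>y\<in>ball x r.
            dist (q n y) (deriv (\<lambda>s. f (y + scaleC s v)) 0) < e"
        proof eventually_elim
          case (elim n)
          show ?case
          proof
            fix y assume "y \<in> ball x r"
            from le_less_trans[OF err[OF this] elim]
            show "dist (q n y) (deriv (\<lambda>s. f (y + scaleC s v)) 0) < e"
              unfolding dist_norm .
          qed
        qed
      qed
    qed
    with r show "\<exists>T. x \<in> T \<and> cholo_on (\<lambda>x. deriv (\<lambda>s. f (x + scaleC s v)) 0) T"
      by (intro exI[of _ "ball x r"]) simp
  qed
qed

text \<open>Differentiation in \<open>z\<close> is differentiation in the direction
  \<open>(1, 0)\<close>; \<open>shift\<close> moves the base point of the one-variable derivative
  from \<open>0\<close> to \<open>fst x\<close>.\<close>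

lemma cholo_on_higher_deriv_fst:
  fixes g :: "complex \<times> 'a::complex_normed_vector \<Rightarrow> complex"
  assumes S: "open S" and g: "cholo_on g S"
  shows "cholo_on (\<lambda>x. (deriv ^^ m) (\<lambda>z. g (z, snd x)) (fst x)) S"
proof (induction m)
  case 0
  then show ?case using g by simp
next
  case (Suc m)
  have shift: "deriv (\<lambda>s. u (a + s)) 0 = deriv u a" for u :: "complex \<Rightarrow> complex" and a
    unfolding deriv_def using DERIV_shift[of u _ 0 a] by (simp add: add.commute)
  show ?case
    using cholo_on_deriv_line[OF S Suc, of "(1, 0)"]
    by (simp add: scaleC_prod_def scaleC_complex_def shift)
qed

text \<open>The identity theorem on the line through \<open>y0\<close> and \<open>y\<close>: the
  preimage of the ball is a disc, hence connected, and it contains the parameters \<open>0\<close>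
  and \<open>1\<close> of both points.\<close>

lemma cholo_on_ball_eq_0:
  fixes f :: "'a::complex_normed_vector \<Rightarrow> complex"
  assumes f: "cholo_on f (ball y0 \<delta>)" and 0: "\<forall>\<^sub>F y in nhds y0. f y = 0" and y: "y \<in> ball y0 \<delta>"
  shows "f y = 0"
proof (cases "y = y0")
  case True
  then show ?thesis using eventually_nhds_x_imp_x[OF 0] by simp
next
  case False
  define w where "w = y - y0"
  define D where "D = {s. y0 + scaleC s w \<in> ball y0 \<delta>}"
  have w: "w \<noteq> 0" using False by (simp add: w_def)
  have D: "D = ball 0 (\<delta> / norm w)"
    using w by (auto simp: D_def dist_norm norm_scaleC field_simps)
  obtain U where U: "open U" "y0 \<in> U" "\<And>y. y \<in> U \<Longrightarrow> f y = 0"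
    using 0 unfolding eventually_nhds by blast
  define D' where "D' = D \<inter> {s. y0 + scaleC s w \<in> U}"
  have \<delta>: "\<delta> > 0" using y by (metis ball_eq_empty empty_iff not_le)
  have "f (y0 + scaleC 1 w) = 0"
  proof (rule analytic_continuation_open[of D' D "\<lambda>s. f (y0 + scaleC s w)" "\<lambda>_. 0"])
    show "open D'" unfolding D'_def using open_line_vimage[OF U(1)] by (auto simp: D)
    show "open D" "connected D" by (auto simp: D)
    have "0 \<in> D'" using U(2) \<delta> by (simp add: D'_def D_def)
    then show "D' \<noteq> {}" by blast
    show "(\<lambda>s. f (y0 + scaleC s w)) holomorphic_on D"
      by (rule holomorphic_on_line[OF f open_ball]) (simp add: D_def)
    show "1 \<in> D" using y by (simp add: D_def w_def)
  qed (auto simp: D'_def U(3))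
  then show ?thesis by (simp add: w_def)
qed

section \<open>Convergence of formal solutions\<close>

definition zcoeff :: "(complex \<times> 'a \<Rightarrow> complex) \<Rightarrow> nat \<Rightarrow> 'a \<Rightarrow> complex" where
  "zcoeff f k y = fps_nth (fps_expansion (\<lambda>z. f (z, y)) 0) k"

text \<open>A one-variable derivative, so that \<open>cholo_on_deriv_line\<close> and the termwise
  differentiation of series apply directly.\<close>

definition axis_deriv :: "'n::finite \<Rightarrow> (complex ^ 'n \<Rightarrow> complex) \<Rightarrow> complex ^ 'n \<Rightarrow> complex" where
  "axis_deriv i f y = deriv (\<lambda>s. f (y + scaleC s (axis i 1))) 0"

text \<open>The coefficient of \<open>z\<^sup>k\<close> in \<open>z \<partial>\<^sub>i u\<^sub>p + \<Sum>\<^sub>q B\<^bsub>i,p,q\<^esub> u\<^sub>q\<close>, where \<open>u\<^sub>p = \<Sum>\<^sub>k u k p z\<^sup>k\<close>.\<close>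

definition system_coeff ::
  "('n::finite \<Rightarrow> 'q::finite \<Rightarrow> 'q \<Rightarrow> complex \<times> (complex ^ 'n) \<Rightarrow> complex) \<Rightarrow>
   (nat \<Rightarrow> 'q \<Rightarrow> complex ^ 'n \<Rightarrow> complex) \<Rightarrow> 'n \<Rightarrow> 'q \<Rightarrow> nat \<Rightarrow> complex ^ 'n \<Rightarrow> complex" where
  "system_coeff B u i p k y =
     (case k of 0 \<Rightarrow> 0 | Suc k' \<Rightarrow> axis_deriv i (u k' p) y) +
     (\<Sum>j\<le>k. \<Sum>q\<in>UNIV. zcoeff (B i p q) j y * u (k - j) q y)"

section \<open>Taylor coefficients and the majorant estimate\<close>

lemma norm_fps_expansion_le:
  assumes hol: "u holomorphic_on ball 0 R" and r: "0 < r" "r < R"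
    and B: "\<And>s. s \<in> ball 0 R \<Longrightarrow> norm (u s) \<le> B"
  shows "norm (fps_nth (fps_expansion u 0) m) \<le> B / r ^ m"
proof -
  have "norm ((deriv ^^ m) u 0) \<le> fact m * B / r ^ m"
  proof (rule Cauchy_inequality)
    have "u holomorphic_on cball 0 r" using hol by (rule holomorphic_on_subset) (use r in auto)
    then show "continuous_on (cball 0 r) u" "u holomorphic_on ball 0 r"
      by (auto intro: holomorphic_on_imp_continuous_on holomorphic_on_subset)
    show "norm (u s) \<le> B" if "cmod (0 - s) = r" for s
      by (rule B) (use r that in simp)
  qed (rule r)
  then show ?thesis by (simp add: fps_expansion_def norm_divide field_simps)
qed

lemma holomorphic_on_fst_line:
  fixes f :: "complex \<times> 'a::complex_normed_vector \<Rightarrow> complex"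
  assumes "cholo_on f (D \<times> S)" "open D" "open S" "y \<in> S"
  shows "(\<lambda>z. f (z, y)) holomorphic_on D"
  using holomorphic_on_line[OF assms(1), of D "(0, y)" "(1, 0)"] assms
  by (simp add: open_Times scaleC_prod_def scaleC_complex_def)

text \<open>The coefficient is the \<open>k\<close>-th derivative in \<open>z\<close>, divided by
  \<open>k!\<close> and restricted to \<open>z = 0\<close>. The domain need not be a product: later
  \<open>z\<close> also stands for the parameter of a line, whose range varies with the
  direction.\<close>

lemma cholo_on_zcoeff_open:
  fixes f :: "complex \<times> 'a::complex_normed_vector \<Rightarrow> complex"
  assumes G: "open G" and f: "cholo_on f G" and S: "\<And>y. y \<in> S \<Longrightarrow> (0, y) \<in> G"
  shows "cholo_on (zcoeff f k) S"
proof -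
  have "cholo_on (\<lambda>y. (deriv ^^ k) (\<lambda>z. f (z, snd (0::complex, y))) (fst (0::complex, y))) S"
    by (rule cholo_on_compose[OF _ cholo_on_higher_deriv_fst[OF G f]])
      (use S in \<open>auto intro!: cholo_on_Pair cholo_on_const cholo_on_ident\<close>)
  then have "cholo_on (\<lambda>y. (deriv ^^ k) (\<lambda>z. f (z, y)) 0 * inverse (fact k)) S"
    by (intro cholo_on_mult cholo_on_const) simp
  then show ?thesis by (simp add: zcoeff_def[abs_def] fps_expansion_def divide_inverse)
qed

lemma cholo_on_zcoeff:
  fixes f :: "complex \<times> 'a::complex_normed_vector \<Rightarrow> complex"
  assumes f: "cholo_on f (D \<times> S)" and D: "open D" "0 \<in> D" and S: "open S"
  shows "cholo_on (zcoeff f k) S"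
  by (rule cholo_on_zcoeff_open[OF open_Times[OF D(1) S] f]) (use D in simp)

text \<open>Cauchy's estimate is taken at radius \<open>\<epsilon> / 2\<close>, since nothing is
  assumed on the boundary circle.\<close>

lemma norm_zcoeff_le:
  fixes f :: "complex \<times> 'a::complex_normed_vector \<Rightarrow> complex"
  assumes f: "cholo_on f (ball 0 \<epsilon> \<times> S)" and S: "open S" "y \<in> S" and \<epsilon>: "\<epsilon> > 0"
    and M: "\<And>z. z \<in> ball 0 \<epsilon> \<Longrightarrow> norm (f (z, y)) \<le> M"
  shows "norm (zcoeff f k y) \<le> M * (2 / \<epsilon>) ^ k"
proof -
  have "norm (zcoeff f k y) \<le> M / (\<epsilon> / 2) ^ k"
    unfolding zcoeff_def
    by (rule norm_fps_expansion_le[OF holomorphic_on_fst_line[OF f open_ball S]]) (use \<epsilon> M in auto)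
  then show ?thesis by (simp add: field_simps)
qed

lemma zcoeff_sums:
  fixes f :: "complex \<times> 'a::complex_normed_vector \<Rightarrow> complex"
  assumes f: "cholo_on f (ball 0 \<epsilon> \<times> S)" and S: "open S" "y \<in> S" and z: "z \<in> ball 0 \<epsilon>"
  shows "(\<lambda>k. zcoeff f k y * z ^ k) sums f (z, y)"
  using holomorphic_power_series[OF holomorphic_on_fst_line[OF f open_ball S] z]
  by (simp add: zcoeff_def fps_expansion_def)

lemma sum_half_power_le: "(\<Sum>j\<le>n. (1 / 2) ^ j) \<le> (2::real)"
proof -
  have "(\<Sum>j\<le>n. (1 / 2) ^ j) = 2 - (1 / 2 :: real) ^ n"
    by (induction n) auto
  then show ?thesis by simp
qed

text \<open>The powers of \<open>\<epsilon>\<close> in \<open>b\<close> and \<open>\<tau>\<close> differ by a factor \<open>2\<close>, so the convolution over \<open>j\<close> is a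
  geometric sum and the estimate loses only the factor \<open>1 / \<epsilon>\<close>, which the smallness of \<open>K\<close> absorbs.\<close>

lemma recursion_bound:
  fixes \<tau> :: "nat \<Rightarrow> nat \<Rightarrow> 'q::finite \<Rightarrow> complex" and b :: "nat \<Rightarrow> nat \<Rightarrow> 'q \<Rightarrow> 'q \<Rightarrow> complex"
  assumes rec: "\<And>m k p. of_nat (Suc m) * \<tau> (Suc m) k p =
      - (\<Sum>j\<le>Suc k. \<Sum>q\<in>UNIV. \<Sum>l\<le>m. b l j p q * \<tau> (m - l) (Suc k - j) q)"
    and b: "\<And>l j p q. norm (b l j p q) \<le> K * (1 / 4) ^ l * (1 / (2 * \<epsilon>)) ^ j"
    and 0: "\<And>k p. norm (\<tau> 0 k p) \<le> C * (1 / \<epsilon>) ^ k"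
    and pos: "\<epsilon> > 0" "K \<ge> 0" "C \<ge> 0"
    and small: "8 * real CARD('q) * K \<le> \<epsilon>"
  shows "norm (\<tau> m k p) \<le> C * (1 / 2) ^ m * (1 / \<epsilon>) ^ k"
proof (induction m arbitrary: k p rule: less_induct)
  case (less m)
  show ?case
  proof (cases m)
    case 0
    then show ?thesis using assms(3) by simp
  next
    case (Suc m')
    define N where "N = real CARD('q)"
    define e where "e = 1 / \<epsilon>"
    have e: "e > 0" using pos by (simp add: e_def)
    \<comment> \<open>One of the two factors \<open>(1 / 2) ^ l\<close> in
      \<open>(1 / 4) ^ l\<close> completes \<open>(1 / 2) ^ (m' - l)\<close> to
      \<open>(1 / 2) ^ m'\<close>; the other makes the sum over \<open>l\<close> geometric. In the
      same way \<open>(e / 2) ^ j\<close> completes the power of \<open>e\<close> and leaves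
      \<open>(1 / 2) ^ j\<close>.\<close>
    have conv: "norm (b l j p q * \<tau> (m' - l) (Suc k - j) q)
        \<le> K * C * (1 / 2) ^ m' * e ^ Suc k * (1 / 2) ^ l * (1 / 2) ^ j"
      if "l \<le> m'" "j \<le> Suc k" for l j q
    proof -
      have "norm (\<tau> (m' - l) (Suc k - j) q) \<le> C * (1 / 2) ^ (m' - l) * e ^ (Suc k - j)"
        using less[of "m' - l"] Suc by (simp add: e_def)
      moreover have "norm (b l j p q) \<le> K * (1 / 4) ^ l * (e / 2) ^ j"
        using b[of l j p q] by (simp add: e_def mult.commute)
      ultimately have "norm (b l j p q * \<tau> (m' - l) (Suc k - j) q)
          \<le> (K * (1 / 4) ^ l * (e / 2) ^ j) * (C * (1 / 2) ^ (m' - l) * e ^ (Suc k - j))"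
        unfolding norm_mult using pos e by (intro mult_mono) auto
      also have "(1 / 4 :: real) ^ l = (1 / 2) ^ l * (1 / 2) ^ l"
        by (simp flip: power_mult_distrib)
      also have "(K * ((1 / 2) ^ l * (1 / 2) ^ l) * (e / 2) ^ j) * (C * (1 / 2) ^ (m' - l) * e ^ (Suc k - j))
          = K * C * ((1 / 2) ^ l * (1 / 2) ^ (m' - l)) * (e ^ j * e ^ (Suc k - j)) * (1 / 2) ^ l * (1 / 2) ^ j"
        using power_mult_distrib[of e "1 / 2" j] by (simp add: mult_ac power_one_over)
      also have "(1 / 2 :: real) ^ l * (1 / 2) ^ (m' - l) = (1 / 2) ^ m'"
        using that by (simp flip: power_add)
      also have "e ^ j * e ^ (Suc k - j) = e ^ Suc k"
        using that by (simp flip: power_add del: power_Suc)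
      finally show ?thesis .
    qed
    define G where "G = K * C * (1 / 2) ^ m' * e ^ Suc k"
    have G: "G \<ge> 0" using pos e by (simp add: G_def)
    have "norm (\<tau> m k p) \<le> norm (of_nat (Suc m') * \<tau> m k p)"
      unfolding norm_mult norm_of_nat by (simp add: mult_le_cancel_right1)
    also have "\<dots> \<le> (\<Sum>j\<le>Suc k. \<Sum>q\<in>(UNIV::'q set). \<Sum>l\<le>m'. G * (1 / 2) ^ l * (1 / 2) ^ j)"
      unfolding Suc rec norm_minus_cancel G_def using conv
      by (intro sum_norm_le) auto
    also have "\<dots> = G * N * (\<Sum>j\<le>Suc k. (1 / 2) ^ j) * (\<Sum>l\<le>m'. (1 / 2) ^ l)"
      by (simp add: sum_distrib_left sum_distrib_right N_def algebra_simps del: sum.atMost_Suc)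
    also have "\<dots> \<le> G * N * 2 * 2"
      using G by (intro mult_mono mult_left_mono sum_half_power_le mult_nonneg_nonneg sum_nonneg)
        (auto simp: N_def)
    \<comment> \<open>\<open>G\<close> contains \<open>(1 / 2) ^ (m - 1)\<close> and
      \<open>e ^ (k + 1)\<close>. Passing to \<open>m\<close> and \<open>k\<close> costs
      \<open>2\<close> and \<open>e\<close>; with the factor \<open>4\<close> from the two geometric
      sums this is \<open>8 * N * K * e\<close>, at most \<open>1\<close> by the smallness of
      \<open>K\<close>.\<close>
    also have "\<dots> = (8 * N * K * e) * (C * (1 / 2) ^ m * e ^ k)"
      by (simp add: G_def Suc)
    also have "\<dots> \<le> 1 * (C * (1 / 2) ^ m * e ^ k)"
      using small pos e by (intro mult_right_mono) (auto simp: N_def e_def field_simps)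
    finally show ?thesis by (simp add: e_def)
  qed
qed

section \<open>Restriction of the system to lines through the base point\<close>

lemma scaleC_vec_axis: "(w :: complex ^ 'n) = (\<Sum>i\<in>UNIV. scaleC (w $ i) (axis i 1))"
  by (simp add: vec_eq_iff scaleC_vec_def scaleC_complex_def axis_def if_distrib cong: if_cong)

lemma axis_deriv_eq_frechet:
  assumes "cholo_on f S" "y \<in> S"
  shows "axis_deriv i f y = frechet_derivative f (at y) (axis i 1)"
  unfolding axis_deriv_def by (rule deriv_line_eq_frechet[OF assms])

lemma line_has_derivative_axis:
  fixes f :: "complex ^ 'n \<Rightarrow> complex"
  assumes f: "cholo_on f S" and y: "y + scaleC s w \<in> S"
  shows "((\<lambda>s. f (y + scaleC s w)) has_field_derivative
      (\<Sum>i\<in>UNIV. w $ i * axis_deriv i f (y + scaleC s w))) (at s)"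
proof -
  define L where "L = frechet_derivative f (at (y + scaleC s w))"
  have L: "clinear_on UNIV L" unfolding L_def by (rule cholo_on_frechet[OF f y])
  have "L w = L (\<Sum>i\<in>UNIV. scaleC (w $ i) (axis i 1))" using scaleC_vec_axis[of w] by simp
  also have "\<dots> = (\<Sum>i\<in>UNIV. w $ i * axis_deriv i f (y + scaleC s w))"
    unfolding clinear_on_sum[OF csubspace_UNIV L UNIV_I]
    by (simp add: axis_deriv_eq_frechet[OF f y] L_def scaleC_complex_def)
  finally have "L w = (\<Sum>i\<in>UNIV. w $ i * axis_deriv i f (y + scaleC s w))" .
  moreover have "((\<lambda>s. f (y + scaleC s w)) has_field_derivative L w) (at s)"
    unfolding L_def by (rule line_has_field_derivative) (rule cholo_on_frechet[OF f y])+
  ultimately show ?thesis by simp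
qed

lemma eventually_line:
  assumes "eventually P (nhds (y::'a::complex_normed_vector))"
  shows "\<forall>\<^sub>F s in nhds 0. P (y + scaleC s w)"
proof -
  obtain U where U: "open U" "y \<in> U" "\<And>x. x \<in> U \<Longrightarrow> P x"
    using assms unfolding eventually_nhds by blast
  have "\<forall>\<^sub>F s in nhds 0. s \<in> {s. y + scaleC s w \<in> U}"
    by (rule eventually_nhds_in_open[OF open_line_vimage[OF U(1)]]) (simp add: U)
  then show ?thesis by eventually_elim (simp add: U(3))
qed

text \<open>Contracting the equations with the components of \<open>w\<close> gives an ordinary
  system for the restrictions \<open>f k p\<close> to the line, whose power series in
  \<open>s\<close> obey the recursion of \<open>recursion_bound\<close>. The equations may hold on
  neighbourhoods that depend on \<open>k\<close>, but an identity of Taylor series at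
  \<open>s = 0\<close> is insensitive to that.\<close>

lemma line_coefficients_bound:
  fixes B :: "'n::finite \<Rightarrow> 'q::finite \<Rightarrow> 'q \<Rightarrow> complex \<times> (complex ^ 'n) \<Rightarrow> complex"
    and u :: "nat \<Rightarrow> 'q \<Rightarrow> complex ^ 'n \<Rightarrow> complex"
  assumes pos: "e0 > 0" "r0 > 0" "\<epsilon> > 0" "4 * \<epsilon> \<le> e0"
    and B: "\<And>i p q. cholo_on (B i p q) (ball 0 e0 \<times> ball y0 r0)"
    and M: "\<And>i p q x. x \<in> ball 0 e0 \<times> ball y0 r0 \<Longrightarrow> norm (B i p q x) \<le> M"
    and u: "\<And>k p. \<exists>U. open U \<and> y0 \<in> U \<and> cholo_on (u k p) U"
    and eq: "\<And>i p k. \<forall>\<^sub>F y in nhds y0. system_coeff B u i p k y = 0"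
    and C: "\<And>k p. norm (u k p y0) \<le> C * (1 / \<epsilon>) ^ k"
    and w: "8 * norm w \<le> r0" "8 * real CARD('q) * (real CARD('n) * norm w * M) \<le> \<epsilon>"
  shows "norm (fps_nth (fps_expansion (\<lambda>s. u k p (y0 + scaleC s w)) 0) m) \<le> C * (1 / 2) ^ m * (1 / \<epsilon>) ^ k"
proof -
  define f where "f = (\<lambda>k p s. u k p (y0 + scaleC s w))"
  define F where "F = (\<lambda>k p. fps_expansion (f k p) 0)"
  \<comment> \<open>The \<open>j\<close>-th \<open>z\<close>-coefficient of the system matrix along
    the line, contracted with \<open>w\<close>. This is the source of the factor
    \<open>norm w\<close> in \<open>K\<close>.\<close>
  define \<beta> where "\<beta> = (\<lambda>j p q s. \<Sum>i\<in>UNIV. w $ i * zcoeff (B i p q) j (y0 + scaleC s w))"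
  define Bf where "Bf = (\<lambda>j p q. fps_expansion (\<beta> j p q) 0)"
  define K where "K = real CARD('n) * norm w * M"
  have "norm (B undefined undefined undefined (0, y0)) \<le> M" by (rule M) (use pos in simp)
  then have M0: "M \<ge> 0" using norm_ge_zero order_trans by blast
  have C0: "C \<ge> 0" using C[of 0 undefined] norm_ge_zero order_trans by (metis mult.right_neutral power_0)
  \<comment> \<open>Radius \<open>8\<close> in \<open>s\<close> leaves room for Cauchy's estimate at
    radius \<open>4\<close>, which produces the decay \<open>(1 / 4) ^ l\<close> required by
    \<open>recursion_bound\<close>.\<close>
  have in_ball: "y0 + scaleC s w \<in> ball y0 r0" if "s \<in> ball 0 8" for s
  proof (cases "w = 0")
    case False
    have "norm s * norm w < 8 * norm w" using that False by (intro mult_strict_right_mono) auto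
    then show ?thesis using w by (simp add: dist_norm norm_scaleC)
  qed (use pos in simp)
  have f_exp: "f k p has_fps_expansion F k p" for k p
  proof -
    obtain U where U: "open U" "y0 \<in> U" "cholo_on (u k p) U" using u by blast
    have "f k p holomorphic_on {s. y0 + scaleC s w \<in> U}"
      unfolding f_def by (rule holomorphic_on_line[OF U(3,1)]) simp
    then show ?thesis
      unfolding F_def by (rule has_fps_expansion_fps_expansion[OF open_line_vimage[OF U(1)], rotated]) (simp add: U)
  qed
  have \<beta>_hol: "\<beta> j p q holomorphic_on ball 0 8" for j p q
    unfolding \<beta>_def
    by (intro holomorphic_intros holomorphic_on_line[OF cholo_on_zcoeff[OF B] open_ball] in_ball)
      (use pos in auto)
  have \<beta>_exp: "\<beta> j p q has_fps_expansion Bf j p q" for j p q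
    unfolding Bf_def by (rule has_fps_expansion_fps_expansion[OF open_ball _ \<beta>_hol]) simp
  have \<beta>_bound: "norm (\<beta> j p q s) \<le> K * (2 / e0) ^ j" if s: "s \<in> ball 0 8" for j p q s
  proof -
    have "norm (w $ i * zcoeff (B i p q) j (y0 + scaleC s w)) \<le> norm w * (M * (2 / e0) ^ j)" for i
      unfolding norm_mult
      by (intro mult_mono Finite_Cartesian_Product.norm_nth_le norm_zcoeff_le[OF B open_ball in_ball[OF s]])
        (use pos in_ball[OF s] in \<open>auto intro!: M\<close>)
    then have "norm (\<beta> j p q s) \<le> (\<Sum>i\<in>(UNIV::'n set). norm w * (M * (2 / e0) ^ j))"
      unfolding \<beta>_def by (intro sum_norm_le)
    then show ?thesis by (simp add: K_def algebra_simps)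
  qed
  have K0: "K \<ge> 0" using M0 by (simp add: K_def)
  have Bf_bound: "norm (fps_nth (Bf j p q) l) \<le> K * (1 / 4) ^ l * (1 / (2 * \<epsilon>)) ^ j" for j p q l
  proof -
    have "norm (fps_nth (Bf j p q) l) \<le> K * (2 / e0) ^ j / 4 ^ l"
      unfolding Bf_def by (rule norm_fps_expansion_le[OF \<beta>_hol]) (use \<beta>_bound in auto)
    also have "\<dots> = K * (1 / 4) ^ l * (2 / e0) ^ j" by (simp add: power_one_over field_simps)
    \<comment> \<open>This amounts to \<open>2 / e0 \<le> 1 / (2 * \<epsilon>)\<close>, the reason
      for requiring \<open>4 * \<epsilon> \<le> e0\<close>.\<close>
    also have "\<dots> \<le> K * (1 / 4) ^ l * (1 / (2 * \<epsilon>)) ^ j"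
      using pos K0 by (intro mult_left_mono power_mono) (auto simp: field_simps)
    finally show ?thesis .
  qed
  \<comment> \<open>The equation of index \<open>Suc k\<close> is the right one, because the factor
    \<open>z\<close> moves the derivative of \<open>u k\<close> to that index.\<close>
  have ode: "\<forall>\<^sub>F s in nhds 0. deriv (f k p) s
      + (\<Sum>j\<le>Suc k. \<Sum>q\<in>UNIV. \<beta> j p q s * f (Suc k - j) q s) = 0" for k p
  proof -
    obtain U where U: "open U" "y0 \<in> U" "cholo_on (u k p) U" using u by blast
    have "\<forall>\<^sub>F y in nhds y0. \<forall>i. system_coeff B u i p (Suc k) y = 0"
      using eq by (intro eventually_all_finite)
    from eventually_line[OF this, of w] eventually_line[OF eventually_nhds_in_open[OF U(1,2)], of w]
    show ?thesis
    proof eventually_elim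
      case (elim s)
      have d: "deriv (f k p) s = (\<Sum>i\<in>UNIV. w $ i * axis_deriv i (u k p) (y0 + scaleC s w))"
        unfolding f_def by (rule DERIV_imp_deriv[OF line_has_derivative_axis[OF U(3) elim(2)]])
      have "(\<Sum>j\<le>Suc k. \<Sum>q\<in>UNIV. \<beta> j p q s * f (Suc k - j) q s)
          = (\<Sum>j\<le>Suc k. \<Sum>q\<in>UNIV. \<Sum>i\<in>UNIV. w $ i * (zcoeff (B i p q) j (y0 + scaleC s w)
              * u (Suc k - j) q (y0 + scaleC s w)))"
        by (simp only: \<beta>_def f_def sum_distrib_right mult.assoc)
      also have "\<dots> = (\<Sum>j\<le>Suc k. \<Sum>i\<in>UNIV. \<Sum>q\<in>UNIV. w $ i * (zcoeff (B i p q) j (y0 + scaleC s w)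
              * u (Suc k - j) q (y0 + scaleC s w)))"
        by (rule sum.cong[OF refl], rule sum.swap)
      also have "\<dots> = (\<Sum>i\<in>UNIV. \<Sum>j\<le>Suc k. \<Sum>q\<in>UNIV. w $ i * (zcoeff (B i p q) j (y0 + scaleC s w)
              * u (Suc k - j) q (y0 + scaleC s w)))"
        by (rule sum.swap)
      finally have "deriv (f k p) s + (\<Sum>j\<le>Suc k. \<Sum>q\<in>UNIV. \<beta> j p q s * f (Suc k - j) q s)
          = (\<Sum>i\<in>UNIV. w $ i * system_coeff B u i p (Suc k) (y0 + scaleC s w))"
        by (simp only: d system_coeff_def nat.case distrib_left sum.distrib sum_distrib_left)
      then show ?case using elim(1) by simp
    qed
  qed
  have fps_eq: "fps_deriv (F k p) + (\<Sum>j\<le>Suc k. \<Sum>q\<in>UNIV. Bf j p q * F (Suc k - j) q) = 0" for k p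
  proof (rule fps_expansion_unique_complex)
    show "(\<lambda>s. deriv (f k p) s + (\<Sum>j\<le>Suc k. \<Sum>q\<in>UNIV. \<beta> j p q s * f (Suc k - j) q s))
        has_fps_expansion fps_deriv (F k p) + (\<Sum>j\<le>Suc k. \<Sum>q\<in>UNIV. Bf j p q * F (Suc k - j) q)"
      by (intro has_fps_expansion_add has_fps_expansion_deriv has_fps_expansion_sum
          has_fps_expansion_mult f_exp \<beta>_exp)
    show "(\<lambda>s. deriv (f k p) s + (\<Sum>j\<le>Suc k. \<Sum>q\<in>UNIV. \<beta> j p q s * f (Suc k - j) q s))
        has_fps_expansion 0"
      unfolding has_fps_expansion_0_iff by (rule ode)
  qed
  have "norm (fps_nth (F k p) m) \<le> C * (1 / 2) ^ m * (1 / \<epsilon>) ^ k"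
  proof (rule recursion_bound[where \<tau> = "\<lambda>m k p. fps_nth (F k p) m" and b = "\<lambda>l j p q. fps_nth (Bf j p q) l"])
    show "of_nat (Suc m) * fps_nth (F k p) (Suc m) = - (\<Sum>j\<le>Suc k. \<Sum>q\<in>UNIV. \<Sum>l\<le>m.
        fps_nth (Bf j p q) l * fps_nth (F (Suc k - j) q) (m - l))" for m k p
    proof -
      have "fps_nth (fps_deriv (F k p) + (\<Sum>j\<le>Suc k. \<Sum>q\<in>UNIV. Bf j p q * F (Suc k - j) q)) m = 0"
        by (simp only: fps_eq fps_zero_nth)
      then have "of_nat (Suc m) * fps_nth (F k p) (Suc m) + (\<Sum>j\<le>Suc k. \<Sum>q\<in>UNIV. \<Sum>l\<le>m.
        fps_nth (Bf j p q) l * fps_nth (F (Suc k - j) q) (m - l)) = 0"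
        by (simp only: fps_add_nth fps_deriv_nth fps_sum_nth fps_mult_nth atLeast0AtMost Suc_eq_plus1)
      then show ?thesis by (simp only: eq_neg_iff_add_eq_0)
    qed
    show "norm (fps_nth (F k p) 0) \<le> C * (1 / \<epsilon>) ^ k" for k p
      using C[of k p] by (simp add: F_def f_def fps_expansion_def)
  qed (use Bf_bound pos K0 C0 w in \<open>auto simp: K_def\<close>)
  then show ?thesis by (simp add: F_def f_def)
qed

text \<open>Joint holomorphy in parameter and direction makes the Taylor coefficients along lines
  depend holomorphically on the direction.\<close>

lemma cholo_on_scaleC_pair: "cholo_on (\<lambda>x. y + scaleC (fst x) (snd x :: complex ^ 'n)) S"
proof -
  have "cholo_on (\<lambda>x. fst x * (snd x $ i)) S" for i :: 'n and S :: "(complex \<times> (complex ^ 'n)) set"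
    by (intro cholo_on_mult cholo_on_fst cholo_on_compose[OF cholo_on_snd cholo_on_nth]) (rule UNIV_I)
  then have "cholo_on (\<lambda>x. scaleC (fst x) (snd x :: complex ^ 'n)) S"
    unfolding cholo_on_vec_iff by (simp add: scaleC_vec_def scaleC_complex_def)
  then show ?thesis by (intro cholo_on_add cholo_on_const)
qed

text \<open>The Taylor coefficient \<open>c k p m w\<close> is the homogeneous part of degree
  \<open>m\<close> of \<open>u k p\<close> at \<open>y0\<close>, so summing over \<open>m\<close>
  extends \<open>u k p\<close>. The estimate along lines is uniform for short \<open>w\<close>,
  hence one radius serves all \<open>k\<close>; the factor \<open>2\<close> in the bound is the sum
  of the powers of \<open>1 / 2\<close>.\<close>

lemma formal_solution_extends:
  fixes B :: "'n::finite \<Rightarrow> 'q::finite \<Rightarrow> 'q \<Rightarrow> complex \<times> (complex ^ 'n) \<Rightarrow> complex"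
    and u :: "nat \<Rightarrow> 'q \<Rightarrow> complex ^ 'n \<Rightarrow> complex"
  assumes pos: "e0 > 0" "r0 > 0" "\<epsilon> > 0" "4 * \<epsilon> \<le> e0"
    and B: "\<And>i p q. cholo_on (B i p q) (ball 0 e0 \<times> ball y0 r0)"
    and M: "\<And>i p q x. x \<in> ball 0 e0 \<times> ball y0 r0 \<Longrightarrow> norm (B i p q x) \<le> M"
    and u: "\<And>k p. \<exists>U. open U \<and> y0 \<in> U \<and> cholo_on (u k p) U"
    and eq: "\<And>i p k. \<forall>\<^sub>F y in nhds y0. system_coeff B u i p k y = 0"
    and C: "\<And>k p. norm (u k p y0) \<le> C * (1 / \<epsilon>) ^ k"
  obtains \<delta> U where "\<delta> > 0" "\<delta> \<le> r0" "\<And>k p. cholo_on (U k p) (ball y0 \<delta>)"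
    "\<And>k p. \<forall>\<^sub>F y in nhds y0. U k p y = u k p y"
    "\<And>k p y. y \<in> ball y0 \<delta> \<Longrightarrow> norm (U k p y) \<le> 2 * C * (1 / \<epsilon>) ^ k"
proof -
  have "norm (B undefined undefined undefined (0, y0)) \<le> M" by (rule M) (use pos in simp)
  then have M0: "M \<ge> 0" using norm_ge_zero order_trans by blast
  \<comment> \<open>Chosen so that \<open>N * norm w \<le> \<epsilon>\<close> implies the smallness
    condition along the line; \<open>M + 1\<close> in place of \<open>M\<close> makes
    \<open>N\<close> positive.\<close>
  define N where "N = 8 * real CARD('q) * real CARD('n) * (M + 1)"
  have N: "N > 0" using M0 by (simp add: N_def)
  define \<delta> where "\<delta> = min (r0 / 8) (\<epsilon> / N)"
  have \<delta>: "\<delta> > 0" "\<delta> \<le> r0" using pos N by (auto simp: \<delta>_def)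
  define c where "c = (\<lambda>k p m w. fps_nth (fps_expansion (\<lambda>s. u k p (y0 + scaleC s w)) 0) m)"
  define U where "U = (\<lambda>k p y. \<Sum>m. c k p m (y - y0))"
  have c_bound: "norm (c k p m w) \<le> C * (1 / \<epsilon>) ^ k * (1 / 2) ^ m" if "norm w < \<delta>" for k p m w
  proof -
    have "8 * real CARD('q) * (real CARD('n) * norm w * M) \<le> 8 * real CARD('q) * (real CARD('n) * norm w * (M + 1))"
      by (intro mult_left_mono) auto
    also have "\<dots> = N * norm w" by (simp add: N_def)
    also have "\<dots> \<le> N * (\<epsilon> / N)" using that N by (intro mult_left_mono) (auto simp: \<delta>_def)
    also have "\<dots> = \<epsilon>" using N by simp
    finally have "norm (c k p m w) \<le> C * (1 / 2) ^ m * (1 / \<epsilon>) ^ k"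
      unfolding c_def using that
      by (intro line_coefficients_bound[OF pos B M u eq C]) (auto simp: \<delta>_def)
    then show ?thesis by (simp add: mult_ac)
  qed
  \<comment> \<open>The line parameter takes the role of \<open>z\<close> in \<open>zcoeff\<close>.
    At parameter \<open>0\<close> every direction gives the point \<open>y0\<close>, so holomorphy
    holds on any set of directions.\<close>
  have c_cholo: "cholo_on (c k p m) S" for k p m S
  proof -
    obtain V where V: "open V" "y0 \<in> V" "cholo_on (u k p) V" using u by blast
    define G where "G = {x. y0 + scaleC (fst x) (snd x) \<in> V}"
    have "open G"
      using open_vimage[OF V(1) cholo_on_imp_continuous_on[OF cholo_on_scaleC_pair[of y0 UNIV]]]
      by (simp add: G_def vimage_def)
    moreover have "cholo_on (\<lambda>x. u k p (y0 + scaleC (fst x) (snd x))) G"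
      by (rule cholo_on_compose[OF cholo_on_scaleC_pair V(3)]) (simp add: G_def)
    ultimately have "cholo_on (zcoeff (\<lambda>x. u k p (y0 + scaleC (fst x) (snd x))) m) S"
      by (rule cholo_on_zcoeff_open) (simp add: G_def V)
    then show ?thesis by (simp add: zcoeff_def[abs_def] c_def)
  qed
  have sum: "(\<lambda>m. K * (1 / 2 :: real) ^ m) sums (2 * K)" for K
    using sums_mult[OF geometric_sums[of "1 / 2 :: real"], of K] by (simp add: mult.commute)
  show thesis
  proof (rule that[OF \<delta>])
    have shift: "cholo_on (\<lambda>y. y - y0) (ball y0 \<delta>)"
      using cholo_on_add[OF cholo_on_ident cholo_on_const[of "- y0"]] by simp
    show "cholo_on (U k p) (ball y0 \<delta>)" for k p
      unfolding U_def
    proof (rule cholo_on_suminf[OF open_ball])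
      show "cholo_on (\<lambda>y. c k p m (y - y0)) (ball y0 \<delta>)" for m
        by (rule cholo_on_compose[OF shift c_cholo[of k p m UNIV]]) simp
      show "norm (c k p m (y - y0)) \<le> C * (1 / \<epsilon>) ^ k * (1 / 2) ^ m" if "y \<in> ball y0 \<delta>" for m y
        by (rule c_bound) (use that in \<open>simp add: dist_norm norm_minus_commute\<close>)
      show "summable (\<lambda>m. C * (1 / \<epsilon>) ^ k * (1 / 2) ^ m)" using sum by (rule sums_summable)
    qed
    show "norm (U k p y) \<le> 2 * C * (1 / \<epsilon>) ^ k" if "y \<in> ball y0 \<delta>" for k p y
    proof -
      have b: "norm (c k p m (y - y0)) \<le> C * (1 / \<epsilon>) ^ k * (1 / 2) ^ m" for m
        by (rule c_bound) (use that in \<open>simp add: dist_norm norm_minus_commute\<close>)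
      have "norm (U k p y) \<le> (\<Sum>m. C * (1 / \<epsilon>) ^ k * (1 / 2) ^ m)"
        unfolding U_def by (rule norm_suminf_le[OF b sums_summable[OF sum]])
      also have "\<dots> = 2 * C * (1 / \<epsilon>) ^ k" using sums_unique[OF sum[of "C * (1 / \<epsilon>) ^ k"]] by (simp add: mult_ac)
      finally show ?thesis .
    qed
    show "\<forall>\<^sub>F y in nhds y0. U k p y = u k p y" for k p
    proof -
      obtain V where V: "open V" "y0 \<in> V" "cholo_on (u k p) V" using u by blast
      then obtain \<eta> where \<eta>: "\<eta> > 0" "ball y0 \<eta> \<subseteq> V" using openE by blast
      \<comment> \<open>With half of \<open>\<eta>\<close> the line stays in \<open>V\<close> for
        all \<open>s\<close> in the disc of radius \<open>2\<close>, so the Taylor series in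
        \<open>s\<close> converges at \<open>s = 1\<close>.\<close>
      have "\<forall>\<^sub>F y in nhds y0. y \<in> ball y0 (\<eta> / 2)"
        by (rule eventually_nhds_in_open) (use \<eta> in auto)
      then show ?thesis
      proof eventually_elim
        case (elim y)
        define w where "w = y - y0"
        have w: "norm w < \<eta> / 2" using elim by (simp add: w_def dist_norm norm_minus_commute)
        have "(\<lambda>s. u k p (y0 + scaleC s w)) holomorphic_on ball 0 2"
        proof (rule holomorphic_on_line[OF V(3,1)])
          fix s :: complex assume "s \<in> ball 0 2"
          then have "norm s * norm w \<le> 2 * norm w" by (intro mult_right_mono) auto
          then have "y0 + scaleC s w \<in> ball y0 \<eta>" using w by (simp add: dist_norm norm_scaleC)
          then show "y0 + scaleC s w \<in> V" using \<eta> by blast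
        qed
        from holomorphic_power_series[OF this, of 1]
        have "(\<lambda>m. c k p m w) sums u k p (y0 + w)"
          by (simp add: c_def fps_expansion_def)
        then show ?case unfolding U_def w_def by (simp add: sums_iff)
      qed
    qed
  qed
qed

section \<open>Summation of the series in \<open>z\<close>\<close>

lemma axis_deriv_cong_ev:
  assumes "\<forall>\<^sub>F x in nhds y. f x = g x"
  shows "axis_deriv i f y = axis_deriv i g y"
  unfolding axis_deriv_def by (rule deriv_cong_ev[OF eventually_line[OF assms] refl])

lemma system_coeff_eventually_eq:
  assumes "\<And>k p. \<forall>\<^sub>F y in nhds y0. U k p y = u k p y"
  shows "\<forall>\<^sub>F y in nhds y0. system_coeff B U i p k y = system_coeff B u i p k y"
proof -
  have 1: "\<forall>\<^sub>F y in nhds y0. \<forall>j\<in>{..k}. \<forall>q. U j q y = u j q y"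
    by (intro eventually_ball_finite ballI eventually_all_finite assms) simp
  \<comment> \<open>A derivative at \<open>y\<close> requires agreement on a neighbourhood of
    \<open>y\<close>, hence the nested quantifier.\<close>
  have "\<forall>\<^sub>F y in nhds y0. \<forall>j\<in>{..k}. \<forall>\<^sub>F x in nhds y. U j p x = u j p x"
    using assms by (intro eventually_ball_finite ballI) (auto simp: eventually_eventually)
  with 1 show ?thesis
  proof eventually_elim
    case (elim y)
    have "axis_deriv i (U j p) y = axis_deriv i (u j p) y" if "j \<le> k" for j
      using elim(2) that by (intro axis_deriv_cong_ev) auto
    moreover have "(\<Sum>j\<le>k. \<Sum>q\<in>UNIV. zcoeff (B i p q) j y * U (k - j) q y)
        = (\<Sum>j\<le>k. \<Sum>q\<in>UNIV. zcoeff (B i p q) j y * u (k - j) q y)"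
      using elim(1) by (intro sum.cong refl) auto
    ultimately show ?case by (auto simp: system_coeff_def split: nat.split)
  qed
qed

text \<open>Finitely many continuous functions are bounded by one constant near a point. The
  recursion estimate needs one \<open>M\<close> and one product domain for all entries of the
  system.\<close>

lemma bounded_near_point:
  fixes B :: "'i::finite \<Rightarrow> complex \<times> 'a::complex_normed_vector \<Rightarrow> complex"
  assumes V: "open V" "(0, y0) \<in> V" and B: "\<And>i. cholo_on (B i) V"
  obtains \<epsilon> \<rho> M where "\<epsilon> > 0" "\<rho> > 0" "ball 0 \<epsilon> \<times> ball y0 \<rho> \<subseteq> V"
    "\<And>i x. x \<in> ball 0 \<epsilon> \<times> ball y0 \<rho> \<Longrightarrow> norm (B i x) \<le> M"
proof -
  define M where "M = (\<Sum>i\<in>UNIV. norm (B i (0, y0)) + 1)"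
  have le: "norm (B i (0, y0)) + 1 \<le> M" for i
    unfolding M_def by (rule member_le_sum) auto
  have "\<forall>\<^sub>F x in nhds (0::complex, y0). dist (B i x) (B i (0, y0)) < 1" for i
  proof -
    have "isCont (B i) (0, y0)"
      using cholo_on_imp_continuous_on[OF B] V continuous_on_eq_continuous_at by blast
    then show ?thesis by (simp add: isCont_def tendsto_at_iff_tendsto_nhds tendstoD)
  qed
  then have "\<forall>\<^sub>F x in nhds (0::complex, y0). \<forall>i. dist (B i x) (B i (0, y0)) < 1"
    by (rule eventually_all_finite)
  from eventually_conj[OF eventually_nhds_in_open[OF V] this]
  obtain W where W: "open W" "(0, y0) \<in> W"
    "\<And>x. x \<in> W \<Longrightarrow> x \<in> V \<and> (\<forall>i. dist (B i x) (B i (0, y0)) < 1)"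
    unfolding eventually_nhds by blast
  obtain P Q where PQ: "open P" "open Q" "(0, y0) \<in> P \<times> Q" "P \<times> Q \<subseteq> W"
    using open_prod_elim[OF W(1,2)] by blast
  obtain \<epsilon> where \<epsilon>: "\<epsilon> > 0" "ball 0 \<epsilon> \<subseteq> P" using openE[OF PQ(1), of 0] PQ(3) by auto
  obtain \<rho> where \<rho>: "\<rho> > 0" "ball y0 \<rho> \<subseteq> Q" using openE[OF PQ(2), of y0] PQ(3) by auto
  have sub: "x \<in> W" if "x \<in> ball 0 \<epsilon> \<times> ball y0 \<rho>" for x
    using that \<epsilon>(2) \<rho>(2) PQ(4) by blast
  show thesis
  proof (rule that[OF \<epsilon>(1) \<rho>(1)])
    show "ball 0 \<epsilon> \<times> ball y0 \<rho> \<subseteq> V" using sub W(3) by blast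
    fix i and x :: "complex \<times> 'a" assume "x \<in> ball 0 \<epsilon> \<times> ball y0 \<rho>"
    then have "dist (B i x) (B i (0, y0)) < 1" using sub W(3) by blast
    then show "norm (B i x) \<le> M"
      using le[of i] norm_triangle_sub[of "B i x" "B i (0, y0)"] by (simp add: dist_norm)
  qed
qed

text \<open>The geometric majorant holds on the whole preimage of the ball in the coordinate line,
  so the one-variable theorem on termwise differentiation applies there.\<close>

lemma series_axis_deriv:
  fixes U :: "nat \<Rightarrow> complex ^ 'n \<Rightarrow> complex"
  assumes U: "\<And>k. cholo_on (U k) (ball y0 \<delta>)" and y: "y \<in> ball y0 \<delta>"
    and bound: "\<And>k y. y \<in> ball y0 \<delta> \<Longrightarrow> norm (U k y * z ^ k) \<le> C * (1 / 2) ^ k"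
  shows "(\<lambda>k. axis_deriv i (U k) y * z ^ k) sums axis_deriv i (\<lambda>y. \<Sum>k. U k y * z ^ k) y"
proof -
  define S where "S = {s. y + scaleC s (axis i 1) \<in> ball y0 \<delta>}"
  define f where "f = (\<lambda>k s. U k (y + scaleC s (axis i 1)) * z ^ k)"
  have S: "open S" "0 \<in> S" using y open_line_vimage[OF open_ball] by (auto simp: S_def)
  have hol: "(\<lambda>s. U k (y + scaleC s (axis i 1))) holomorphic_on S" for k
    by (rule holomorphic_on_line[OF U open_ball]) (simp add: S_def)
  have "norm (U 0 y * z ^ 0) \<le> C * (1 / 2) ^ 0" by (rule bound[OF y])
  then have "norm (U 0 y) \<le> C" by simp
  then have C: "C \<ge> 0" by (rule order_trans[OF norm_ge_zero])
  have "\<exists>g g'. \<forall>s\<in>S. (\<lambda>k. f k s) sums g s \<and>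
      (\<lambda>k. deriv (\<lambda>s. U k (y + scaleC s (axis i 1))) s * z ^ k) sums g' s \<and>
      (g has_field_derivative g' s) (at s)"
  proof (rule series_and_derivative_comparison_complex[OF S(1)])
    show "(f k has_field_derivative deriv (\<lambda>s. U k (y + scaleC s (axis i 1))) s * z ^ k) (at s)"
      if "s \<in> S" for k s
      unfolding f_def by (rule DERIV_cmult_right[OF holomorphic_derivI[OF hol S(1) that]])
    fix s assume "s \<in> S"
    show "\<exists>d h. 0 < d \<and> summable h \<and> range h \<subseteq> \<real>\<^sub>\<ge>\<^sub>0 \<and>
        (\<forall>\<^sub>F n in sequentially. \<forall>t\<in>ball s d \<inter> S. cmod (f n t) \<le> cmod (h n))"
    proof (intro exI conjI)
      show "(0::real) < 1" by simp
      have "summable (\<lambda>n. C * (1 / 2) ^ n)" by (intro summable_mult summable_geometric) simp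
      then show "summable (\<lambda>n. complex_of_real (C * (1 / 2) ^ n))" by (rule summable_of_real)
      show "range (\<lambda>n. complex_of_real (C * (1 / 2) ^ n)) \<subseteq> \<real>\<^sub>\<ge>\<^sub>0"
        using C by (auto simp only: nonneg_Reals_of_real_iff image_subset_iff) simp
      have "cmod (f n t) \<le> cmod (complex_of_real (C * (1 / 2) ^ n))" if t: "t \<in> S" for n t
      proof -
        have "y + scaleC t (axis i 1) \<in> ball y0 \<delta>" using t by (simp only: S_def mem_Collect_eq)
        from bound[OF this, of n] have "cmod (f n t) \<le> C * (1 / 2) ^ n" by (simp only: f_def)
        also have "\<dots> \<le> \<bar>C * (1 / 2) ^ n\<bar>" by (rule abs_ge_self)
        finally show ?thesis by (simp only: norm_of_real)
      qed
      then show "\<forall>\<^sub>F n in sequentially. \<forall>t\<in>ball s 1 \<inter> S.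
          cmod (f n t) \<le> cmod (complex_of_real (C * (1 / 2) ^ n))" by auto
    qed
  qed
  then obtain g g' where G: "\<forall>s\<in>S. (\<lambda>k. f k s) sums g s \<and>
      (\<lambda>k. deriv (\<lambda>s. U k (y + scaleC s (axis i 1))) s * z ^ k) sums g' s \<and>
      (g has_field_derivative g' s) (at s)"
    by (elim exE)
  have g1: "(\<lambda>k. f k s) sums g s" if "s \<in> S" for s
    using bspec[OF G that] by (rule conjunct1)
  note g2 = conjunct1[OF conjunct2[OF bspec[OF G S(2)]]]
  note g3 = conjunct2[OF conjunct2[OF bspec[OF G S(2)]]]
  have "((\<lambda>s. \<Sum>k. f k s) has_field_derivative g' 0) (at 0)"
    by (rule has_field_derivative_transform_within_open[OF g3 S]) (rule sums_unique[OF g1])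
  then have "axis_deriv i (\<lambda>y. \<Sum>k. U k y * z ^ k) y = g' 0"
    unfolding axis_deriv_def f_def by (rule DERIV_imp_deriv)
  with g2 show ?thesis by (simp add: axis_deriv_def)
qed

text \<open>Besides holomorphy the conclusion contains the equation for the sum itself, at every
  point of the product domain. This is what later makes the isomorphism compatible with the
  connections.\<close>

theorem formal_solution_converges:
  fixes B :: "'n::finite \<Rightarrow> 'q::finite \<Rightarrow> 'q \<Rightarrow> complex \<times> (complex ^ 'n) \<Rightarrow> complex"
    and u :: "nat \<Rightarrow> 'q \<Rightarrow> complex ^ 'n \<Rightarrow> complex"
  assumes V: "open V" "(0, y0) \<in> V" and BV: "\<And>i p q. cholo_on (B i p q) V"
    and u: "\<And>k p. \<exists>U. open U \<and> y0 \<in> U \<and> cholo_on (u k p) U"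
    and eq: "\<And>i p k. \<forall>\<^sub>F y in nhds y0. system_coeff B u i p k y = 0"
    and r: "r > 0" and C: "\<And>k p. norm (u k p y0) \<le> C * (1 / r) ^ k"
  obtains \<epsilon> \<delta> F where "\<epsilon> > 0" "\<delta> > 0" "\<And>p. cholo_on (F p) (ball 0 \<epsilon> \<times> ball y0 \<delta>)"
    "\<And>k p. \<forall>\<^sub>F y in nhds y0. zcoeff (F p) k y = u k p y"
    "\<And>i p z y. z \<in> ball 0 \<epsilon> \<Longrightarrow> y \<in> ball y0 \<delta> \<Longrightarrow>
        z * axis_deriv i (\<lambda>y. F p (z, y)) y + (\<Sum>q\<in>UNIV. B i p q (z, y) * F q (z, y)) = 0"
proof -
  have BV': "cholo_on (case t of (i, p, q) \<Rightarrow> B i p q) V" for t :: "'n \<times> 'q \<times> 'q"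
    using BV by (cases t) simp
  obtain e0 r0 M where pos0: "e0 > 0" "r0 > 0" and sub: "ball 0 e0 \<times> ball y0 r0 \<subseteq> V"
    and M': "\<And>t x. x \<in> ball 0 e0 \<times> ball y0 r0 \<Longrightarrow> norm ((case t of (i, p, q) \<Rightarrow> B i p q) x) \<le> M"
    by (rule bounded_near_point[OF V, where B = "\<lambda>t. case t of (i, p, q) \<Rightarrow> B i p q", OF BV']) (rule that)
  have M: "norm (B i p q x) \<le> M" if "x \<in> ball 0 e0 \<times> ball y0 r0" for i p q x
    using M'[OF that, of "(i, p, q)"] by simp
  have B: "cholo_on (B i p q) (ball 0 e0 \<times> ball y0 r0)" for i p q
    by (rule cholo_on_subset[OF BV sub])
  \<comment> \<open>\<open>r\<close> controls the initial data at \<open>y0\<close>, and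
    \<open>e0 / 4\<close> provides the ratio of radii demanded by
    \<open>line_coefficients_bound\<close>.\<close>
  define \<epsilon> where "\<epsilon> = min r (e0 / 4)"
  have pos: "\<epsilon> > 0" "4 * \<epsilon> \<le> e0" "\<epsilon> \<le> r" using r pos0 by (auto simp: \<epsilon>_def)
  have "norm (u 0 undefined y0) \<le> C" using C[of 0] by simp
  then have C0: "C \<ge> 0" using norm_ge_zero order_trans by blast
  have C': "norm (u k p y0) \<le> C * (1 / \<epsilon>) ^ k" for k p
  proof -
    have "(1 / r) ^ k \<le> (1 / \<epsilon>) ^ k" using pos r by (intro power_mono) (auto simp: frac_le)
    then show ?thesis using C[of k p] C0 by (meson mult_left_mono order_trans)
  qed
  obtain \<delta> U where \<delta>: "\<delta> > 0" "\<delta> \<le> r0" and U: "\<And>k p. cholo_on (U k p) (ball y0 \<delta>)"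
    and Uu: "\<And>k p. \<forall>\<^sub>F y in nhds y0. U k p y = u k p y"
    and Ub: "\<And>k p y. y \<in> ball y0 \<delta> \<Longrightarrow> norm (U k p y) \<le> 2 * C * (1 / \<epsilon>) ^ k"
    by (rule formal_solution_extends[OF pos0 pos(1,2) B M u eq C']) (assumption, rule that)
  have sub\<delta>: "ball y0 \<delta> \<subseteq> ball y0 r0" using \<delta> by auto
  have zB: "cholo_on (zcoeff (B i p q) j) (ball y0 \<delta>)" for i p q j
    using cholo_on_subset[OF cholo_on_zcoeff[OF B open_ball _ open_ball] sub\<delta>] pos0 by simp
  \<comment> \<open>Each equation is known only on a neighbourhood of \<open>y0\<close> that may
    depend on \<open>k\<close>. Now that all its terms are holomorphic on one ball, the identity
    theorem spreads it over that ball.\<close>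
  have UE: "system_coeff B U i p k y = 0" if "y \<in> ball y0 \<delta>" for i p k y
  proof (rule cholo_on_ball_eq_0[OF _ _ that])
    have ad: "cholo_on (axis_deriv i (U j p)) (ball y0 \<delta>)" for j
      unfolding axis_deriv_def[abs_def] by (rule cholo_on_deriv_line[OF open_ball U])
    have "cholo_on (\<lambda>y. case k of 0 \<Rightarrow> 0 | Suc k' \<Rightarrow> axis_deriv i (U k' p) y) (ball y0 \<delta>)"
      by (cases k) (simp_all add: cholo_on_const ad)
    then show "cholo_on (system_coeff B U i p k) (ball y0 \<delta>)"
      unfolding system_coeff_def[abs_def]
      by (intro cholo_on_add cholo_on_sum cholo_on_mult zB U)
    show "\<forall>\<^sub>F y in nhds y0. system_coeff B U i p k y = 0"
      using system_coeff_eventually_eq[OF Uu] eq by eventually_elim (rule trans)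
  qed
  define F where "F = (\<lambda>p x. \<Sum>k. U k p (snd x) * fst x ^ k)"
  \<comment> \<open>On the half radius \<open>\<epsilon> / 2\<close> the terms are dominated by a
    geometric series of ratio \<open>1 / 2\<close>, uniformly in \<open>y\<close>.\<close>
  have term_le: "norm (U k p y * z ^ k) \<le> 2 * C * (1 / 2) ^ k" if "z \<in> ball 0 (\<epsilon> / 2)" "y \<in> ball y0 \<delta>" for k p z y
  proof -
    have "norm z ^ k \<le> (\<epsilon> / 2) ^ k" using that by (intro power_mono) auto
    then have "norm (U k p y) * norm z ^ k \<le> (2 * C * (1 / \<epsilon>) ^ k) * (\<epsilon> / 2) ^ k"
      using Ub[OF that(2), of k p] pos C0 by (intro mult_mono) auto
    also have "\<dots> = 2 * C * (1 / \<epsilon> * (\<epsilon> / 2)) ^ k" by (simp only: power_mult_distrib mult.assoc)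
    also have "\<dots> = 2 * C * (1 / 2) ^ k" using pos by simp
    finally show ?thesis by (simp add: norm_mult norm_power)
  qed
  have geo: "summable (\<lambda>k. K * (1 / 2 :: real) ^ k)" for K
    by (intro summable_mult summable_geometric) simp
  have abs_sum: "summable (\<lambda>k. norm (U k p y * z ^ k))" if "z \<in> ball 0 (\<epsilon> / 2)" "y \<in> ball y0 \<delta>" for p z y
    by (rule summable_comparison_test'[OF geo]) (use term_le[OF that] in auto)
  have F_sums: "(\<lambda>k. U k p y * z ^ k) sums F p (z, y)" if "z \<in> ball 0 (\<epsilon> / 2)" "y \<in> ball y0 \<delta>" for p z y
    using summable_sums[OF summable_norm_cancel[OF abs_sum[OF that]]] by (simp add: F_def)
  show thesis
  proof (rule that[of "\<epsilon> / 2" \<delta> F])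
    show "cholo_on (F p) (ball 0 (\<epsilon> / 2) \<times> ball y0 \<delta>)" for p
      unfolding F_def
    proof (rule cholo_on_suminf[OF open_Times[OF open_ball open_ball] _ _ geo])
      show "cholo_on (\<lambda>x. U k p (snd x) * fst x ^ k) (ball 0 (\<epsilon> / 2) \<times> ball y0 \<delta>)" for k
        by (intro cholo_on_mult cholo_on_power cholo_on_fst cholo_on_compose[OF cholo_on_snd U]) auto
      show "norm (U k p (snd x) * fst x ^ k) \<le> 2 * C * (1 / 2) ^ k"
        if "x \<in> ball 0 (\<epsilon> / 2) \<times> ball y0 \<delta>" for k x
        by (rule term_le) (use that in auto)
    qed
    have near: "\<forall>\<^sub>F y in nhds y0. y \<in> ball y0 \<delta>"
      by (rule eventually_nhds_in_open) (use \<delta> in auto)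
    show "\<forall>\<^sub>F y in nhds y0. zcoeff (F p) k y = u k p y" for k p
      using Uu[of k p] near
    proof eventually_elim
      case (elim y)
      then have y: "y \<in> ball y0 \<delta>" using \<delta> by simp
      have "\<forall>\<^sub>F z in nhds 0. z \<in> ball 0 (\<epsilon> / 2)"
        by (rule eventually_nhds_in_open) (use pos in auto)
      then have "(\<lambda>z. F p (z, y)) has_fps_expansion Abs_fps (\<lambda>k. U k p y)"
        by (intro has_fps_expansionI, eventually_elim) (use F_sums[OF _ y] in simp)
      from fps_expansion_eqI[OF this] show ?case using elim by (simp add: zcoeff_def)
    qed
    fix i p and z :: complex and y :: "complex ^ 'n" assume z: "z \<in> ball 0 (\<epsilon> / 2)" and y: "y \<in> ball y0 \<delta>"
    define D where "D = axis_deriv i (\<lambda>y. F p (z, y)) y"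
    have y\<rho>: "y \<in> ball y0 r0" using y sub\<delta> by blast
    have z\<epsilon>: "z \<in> ball 0 e0" using z pos by simp
    have "(\<lambda>k. axis_deriv i (U k p) y * z ^ k) sums D"
      unfolding D_def F_def fst_conv snd_conv
      by (rule series_axis_deriv[OF U y term_le[OF z]])
    from sums_mult[OF this, of z]
    have "(\<lambda>k. (case Suc k of 0 \<Rightarrow> 0 | Suc k' \<Rightarrow> axis_deriv i (U k' p) y) * z ^ Suc k) sums (z * D)"
      by (simp add: mult_ac)
    \<comment> \<open>Multiplication by \<open>z\<close> shifts the index by one; the case
      \<open>0\<close> supplies the missing initial term.\<close>
    then have 1: "(\<lambda>k. (case k of 0 \<Rightarrow> 0 | Suc k' \<Rightarrow> axis_deriv i (U k' p) y) * z ^ k) sums (z * D)"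
      by (subst (asm) sums_Suc_iff) simp
    \<comment> \<open>The Cauchy product of the expansions of \<open>B\<close> and \<open>F\<close>,
      both absolutely convergent at \<open>z\<close>.\<close>
    have 2: "(\<lambda>k. \<Sum>j\<le>k. zcoeff (B i p q) j y * U (k - j) q y * z ^ k) sums (B i p q (z, y) * F q (z, y))" for q
    proof -
      have "norm (zcoeff (B i p q) j y * z ^ j) \<le> M * (1 / 2) ^ j" for j
      proof -
        have zb: "norm (zcoeff (B i p q) j y) \<le> M * (2 / e0) ^ j"
          by (rule norm_zcoeff_le[OF B open_ball y\<rho> pos0(1)]) (use M y\<rho> in auto)
        have zp: "norm z ^ j \<le> (e0 / 4) ^ j" using z pos by (intro power_mono) auto
        have "norm (zcoeff (B i p q) j y) * norm z ^ j \<le> (M * (2 / e0) ^ j) * (e0 / 4) ^ j"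
          using order_trans[OF norm_ge_zero zb] by (intro mult_mono zb zp) auto
        also have "\<dots> = M * (2 / e0 * (e0 / 4)) ^ j" by (simp only: power_mult_distrib mult.assoc)
        also have "\<dots> = M * (1 / 2) ^ j" using pos0 by simp
        finally show ?thesis by (simp add: norm_mult norm_power)
      qed
      then have "summable (\<lambda>j. norm (zcoeff (B i p q) j y * z ^ j))"
        by (intro summable_comparison_test'[OF geo]) auto
      from Cauchy_product_sums[OF this abs_sum[OF z y]]
      have "(\<lambda>k. \<Sum>j\<le>k. (zcoeff (B i p q) j y * z ^ j) * (U (k - j) q y * z ^ (k - j)))
          sums (B i p q (z, y) * F q (z, y))"
        using sums_unique[OF zcoeff_sums[OF B open_ball y\<rho> z\<epsilon>]] sums_unique[OF F_sums[OF z y]] by simp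
      moreover have "(\<Sum>j\<le>k. (zcoeff (B i p q) j y * z ^ j) * (U (k - j) q y * z ^ (k - j)))
          = (\<Sum>j\<le>k. zcoeff (B i p q) j y * U (k - j) q y * z ^ k)" for k
      proof (rule sum.cong[OF refl])
        fix j assume "j \<in> {..k}"
        then have "z ^ k = z ^ j * z ^ (k - j)" by (simp flip: power_add)
        then show "(zcoeff (B i p q) j y * z ^ j) * (U (k - j) q y * z ^ (k - j))
            = zcoeff (B i p q) j y * U (k - j) q y * z ^ k" by simp
      qed
      ultimately show ?thesis by simp
    qed
    have "(\<lambda>k. system_coeff B U i p k y * z ^ k) sums (z * D + (\<Sum>q\<in>UNIV. B i p q (z, y) * F q (z, y)))"
    proof -
      have "(\<lambda>k. \<Sum>q\<in>UNIV. \<Sum>j\<le>k. zcoeff (B i p q) j y * U (k - j) q y * z ^ k)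
          sums (\<Sum>q\<in>UNIV. B i p q (z, y) * F q (z, y))"
        by (rule sums_sum) (rule 2)
      moreover have "system_coeff B U i p k y * z ^ k = (case k of 0 \<Rightarrow> 0 | Suc k' \<Rightarrow> axis_deriv i (U k' p) y) * z ^ k
          + (\<Sum>q\<in>UNIV. \<Sum>j\<le>k. zcoeff (B i p q) j y * U (k - j) q y * z ^ k)" for k
        unfolding system_coeff_def distrib_right sum_distrib_right
        by (rule arg_cong2[where f = "(+)", OF refl sum.swap])
      ultimately show ?thesis using sums_add[OF 1] by simp
    qed
    then have "(\<lambda>k. 0) sums (z * D + (\<Sum>q\<in>UNIV. B i p q (z, y) * F q (z, y)))"
      unfolding UE[OF y] by simp
    from sums_unique2[OF this sums_zero]
    show "z * axis_deriv i (\<lambda>y. F p (z, y)) y + (\<Sum>q\<in>UNIV. B i p q (z, y) * F q (z, y)) = 0"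
      unfolding D_def .
  qed (use pos \<delta> in auto)
qed

section \<open>Holomorphic functions on manifolds\<close>

abbreviation cinv :: "('m, 'e) chart \<Rightarrow> 'e \<Rightarrow> 'm" where
  "cinv c \<equiv> inv_into (fst c) (snd c)"

lemma manifold_chart:
  assumes "complex_manifold \<A>" "c \<in> \<A>"
  shows "open (fst c)" "open (snd c ` fst c)"
    "homeomorphism (fst c) (snd c ` fst c) (snd c) (cinv c)"
  using assms by (simp_all add: complex_manifold_def case_prod_unfold)

lemma manifold_transition:
  assumes "complex_manifold \<A>" "c \<in> \<A>" "d \<in> \<A>"
  shows "cholo_on (\<lambda>y. snd d (cinv c y)) (snd c ` (fst c \<inter> fst d))"
  using assms by (simp add: complex_manifold_def case_prod_unfold)

lemma manifold_cover:
  assumes "complex_manifold \<A>"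
  obtains c where "c \<in> \<A>" "p \<in> fst c"
proof -
  have "\<exists>c\<in>\<A>. p \<in> fst c" using assms by (simp add: complex_manifold_def case_prod_unfold)
  then show thesis using that by blast
qed

lemma cinv_chart:
  assumes "complex_manifold \<A>" "c \<in> \<A>" "p \<in> fst c"
  shows "cinv c (snd c p) = p"
  using homeomorphism_apply1[OF manifold_chart(3)[OF assms(1,2)] assms(3)] .

lemma chart_cinv:
  assumes "y \<in> snd c ` fst c"
  shows "snd c (cinv c y) = y" "cinv c y \<in> fst c"
  using assms by (auto simp: f_inv_into_f inv_into_into)

lemma open_chart_image:
  assumes M: "complex_manifold \<A>" "c \<in> \<A>" and W: "open W"
  shows "open (snd c ` (fst c \<inter> W))"
proof -
  note h = manifold_chart(3)[OF M]
  have "openin (top_of_set (snd c ` fst c)) (snd c ` (fst c \<inter> W))"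
    using homeomorphism_imp_open_map[OF h] W by (simp add: openin_open_Int)
  then show ?thesis using manifold_chart(2)[OF M] openin_open_eq by blast
qed

lemma eventually_cinv:
  assumes M: "complex_manifold \<A>" "c \<in> \<A>" "p \<in> fst c" and P: "eventually P (nhds p)"
  shows "\<forall>\<^sub>F y in nhds (snd c p). y \<in> snd c ` fst c \<and> P (cinv c y)"
proof -
  obtain W where W: "open W" "p \<in> W" "\<And>q. q \<in> W \<Longrightarrow> P q"
    using P unfolding eventually_nhds by blast
  have "\<forall>\<^sub>F y in nhds (snd c p). y \<in> snd c ` (fst c \<inter> W)"
    by (rule eventually_nhds_in_open[OF open_chart_image[OF M(1,2) W(1)]]) (use W M in auto)
  then show ?thesis
  proof eventually_elim
    case (elim y)
    then obtain q where "y = snd c q" "q \<in> fst c" "q \<in> W" by auto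
    then show ?case using W(3) cinv_chart[OF M(1,2)] by auto
  qed
qed

lemma eventually_chart:
  assumes M: "complex_manifold \<A>" "c \<in> \<A>" "p \<in> fst c" and Q: "eventually Q (nhds (snd c p))"
  shows "\<forall>\<^sub>F q in nhds p. q \<in> fst c \<and> Q (snd c q)"
proof -
  have "isCont (snd c) p"
    using homeomorphism_cont1[OF manifold_chart(3)[OF M(1,2)]] manifold_chart(1)[OF M(1,2)] M(3)
      continuous_on_eq_continuous_at by blast
  then have "filterlim (snd c) (nhds (snd c p)) (nhds p)"
    by (simp add: isCont_def tendsto_at_iff_tendsto_nhds)
  from eventually_compose_filterlim[OF Q this]
    eventually_nhds_in_open[OF manifold_chart(1)[OF M(1,2)] M(3)]
  show ?thesis by eventually_elim simp
qed

lemma mholoD: "mholo \<A> W f \<Longrightarrow> c \<in> \<A> \<Longrightarrow> cholo_on (\<lambda>y. f (cinv c y)) (snd c ` (fst c \<inter> W))"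
  unfolding mholo_def by (auto simp: case_prod_unfold)

lemma mholoI: "(\<And>c. c \<in> \<A> \<Longrightarrow> cholo_on (\<lambda>y. f (cinv c y)) (snd c ` (fst c \<inter> W))) \<Longrightarrow> mholo \<A> W f"
  unfolding mholo_def by (auto simp: case_prod_unfold)

lemma mholo_subset: "mholo \<A> W f \<Longrightarrow> W' \<subseteq> W \<Longrightarrow> mholo \<A> W' f"
  by (rule mholoI, rule cholo_on_subset[OF mholoD], assumption+) auto

text \<open>Transition maps are holomorphic, so a single chart containing \<open>W\<close>
  decides.\<close>

lemma mholo_chart:
  assumes M: "complex_manifold \<A>" and c: "c \<in> \<A>" and W: "open W" "W \<subseteq> fst c"
    and f: "cholo_on (\<lambda>y. f (cinv c y)) (snd c ` W)"
  shows "mholo \<A> W f"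
proof (rule mholoI)
  fix d assume d: "d \<in> \<A>"
  have mem: "cinv d y \<in> W" if "y \<in> snd d ` (fst d \<inter> W)" for y
    using that cinv_chart[OF M d] by auto
  have tr: "cholo_on (\<lambda>y. snd c (cinv d y)) (snd d ` (fst d \<inter> W))"
    by (rule cholo_on_subset[OF manifold_transition[OF M d c]]) (use W in blast)
  have "cholo_on (\<lambda>y. f (cinv c (snd c (cinv d y)))) (snd d ` (fst d \<inter> W))"
    by (rule cholo_on_compose[OF tr f]) (use mem in blast)
  then show "cholo_on (\<lambda>y. f (cinv d y)) (snd d ` (fst d \<inter> W))"
  proof (rule cholo_on_transform[OF _ open_chart_image[OF M d W(1)]])
    fix y assume "y \<in> snd d ` (fst d \<inter> W)"
    then show "f (cinv c (snd c (cinv d y))) = f (cinv d y)"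
      using cinv_chart[OF M c, of "cinv d y"] mem[of y] W(2) by auto
  qed
qed

lemma mholo_cong:
  assumes M: "complex_manifold \<A>" and W: "open W" and f: "mholo \<A> W f"
    and eq: "\<And>x. x \<in> W \<Longrightarrow> f x = g x"
  shows "mholo \<A> W g"
proof (rule mholoI)
  fix c assume c: "c \<in> \<A>"
  show "cholo_on (\<lambda>y. g (cinv c y)) (snd c ` (fst c \<inter> W))"
  proof (rule cholo_on_transform[OF mholoD[OF f c] open_chart_image[OF M c W]])
    fix y assume "y \<in> snd c ` (fst c \<inter> W)"
    then show "f (cinv c y) = g (cinv c y)" using cinv_chart[OF M c] eq by auto
  qed
qed

lemma mholo_const: "mholo \<A> W (\<lambda>_. a)"
  by (rule mholoI) (rule cholo_on_const)

lemma mholo_add: "mholo \<A> W f \<Longrightarrow> mholo \<A> W g \<Longrightarrow> mholo \<A> W (\<lambda>x. f x + g x)"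
  by (rule mholoI) (intro cholo_on_add mholoD)

lemma mholo_mult:
  fixes f g :: "'m \<Rightarrow> complex"
  shows "mholo \<A> W f \<Longrightarrow> mholo \<A> W g \<Longrightarrow> mholo \<A> W (\<lambda>x. f x * g x)"
  by (rule mholoI) (intro cholo_on_mult mholoD)

lemma mholo_sum: "(\<And>i. i \<in> I \<Longrightarrow> mholo \<A> W (f i)) \<Longrightarrow> mholo \<A> W (\<lambda>x. \<Sum>i\<in>I. f i x)"
  by (rule mholoI) (intro cholo_on_sum mholoD)

lemma mholo_prod:
  fixes f :: "'i \<Rightarrow> 'm \<Rightarrow> complex"
  shows "(\<And>i. i \<in> I \<Longrightarrow> mholo \<A> W (f i)) \<Longrightarrow> mholo \<A> W (\<lambda>x. \<Prod>i\<in>I. f i x)"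
  by (rule mholoI) (intro cholo_on_prod mholoD)

lemma mholo_inverse:
  fixes f :: "'m::t2_space \<Rightarrow> complex"
  assumes M: "complex_manifold \<A>" and f: "mholo \<A> W f" and nz: "\<And>x. x \<in> W \<Longrightarrow> f x \<noteq> 0"
  shows "mholo \<A> W (\<lambda>x. inverse (f x))"
proof (rule mholoI)
  fix c assume c: "c \<in> \<A>"
  show "cholo_on (\<lambda>y. inverse (f (cinv c y))) (snd c ` (fst c \<inter> W))"
    by (rule cholo_on_inverse[OF mholoD[OF f c]]) (use cinv_chart[OF M c] nz in auto)
qed

lemma mholo_vec_iff:
  fixes f :: "'m \<Rightarrow> 'b::complex_normed_vector ^ 'n"
  shows "mholo \<A> W f \<longleftrightarrow> (\<forall>i. mholo \<A> W (\<lambda>x. f x $ i))"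
proof
  show "\<forall>i. mholo \<A> W (\<lambda>x. f x $ i)" if "mholo \<A> W f"
    using mholoD[OF that] by (intro allI mholoI) (simp add: cholo_on_vec_iff)
  show "mholo \<A> W f" if "\<forall>i. mholo \<A> W (\<lambda>x. f x $ i)"
  proof (rule mholoI)
    show "cholo_on (\<lambda>y. f (cinv c y)) (snd c ` (fst c \<inter> W))" if "c \<in> \<A>" for c
      unfolding cholo_on_vec_iff
      by (rule allI) (rule mholoD[OF spec[OF \<open>\<forall>i. mholo \<A> W (\<lambda>x. f x $ i)\<close>] that])
  qed
qed

lemma mholo_matrix_vector_mult:
  fixes g :: "'m \<Rightarrow> complex ^ 'a ^ 'b"
  assumes "mholo \<A> W g" "mholo \<A> W f"
  shows "mholo \<A> W (\<lambda>x. g x *v f x)"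
  using assms unfolding mholo_vec_iff[of _ _ "\<lambda>x. g x *v f x"]
  by (auto simp: matrix_vector_mult_def mholo_vec_iff intro!: mholo_sum mholo_mult)

lemma mholo_continuous_on:
  assumes M: "complex_manifold \<A>" and f: "mholo \<A> W f" and W: "open W"
  shows "continuous_on W f"
proof (rule continuous_at_imp_continuous_on, rule ballI)
  fix p assume p: "p \<in> W"
  obtain c where c: "c \<in> \<A>" "p \<in> fst c" by (rule manifold_cover[OF M])
  have o: "open (fst c \<inter> W)" using manifold_chart(1)[OF M c(1)] W by auto
  have "continuous_on (fst c \<inter> W) (\<lambda>q. f (cinv c (snd c q)))"
  proof (rule continuous_on_compose2[OF cholo_on_imp_continuous_on[OF mholoD[OF f c(1)]]])
    show "continuous_on (fst c \<inter> W) (snd c)"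
      using homeomorphism_cont1[OF manifold_chart(3)[OF M c(1)]] by (rule continuous_on_subset) auto
  qed auto
  then have "continuous_on (fst c \<inter> W) f"
    by (rule continuous_on_eq) (use cinv_chart[OF M c(1)] in simp)
  then show "isCont f p" using o p c(2) continuous_on_eq_continuous_at by blast
qed

lemma holo_germ_chart:
  assumes M: "complex_manifold \<A>" "c \<in> \<A>" "p \<in> fst c" and f: "holo_germ \<A> p f"
  obtains V where "open V" "snd c p \<in> V" "V \<subseteq> snd c ` fst c" "cholo_on (\<lambda>y. f (cinv c y)) V"
proof -
  obtain W where W: "open W" "p \<in> W" "mholo \<A> W f" using f by (auto simp: holo_germ_def)
  show thesis
    by (rule that[OF open_chart_image[OF M(1,2) W(1)] _ _ mholoD[OF W(3) M(2)]]) (use W M in auto)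
qed

lemma holo_germI_chart:
  assumes M: "complex_manifold \<A>" "c \<in> \<A>" "p \<in> fst c" and V: "open V" "snd c p \<in> V"
    and f: "cholo_on (\<lambda>y. f (cinv c y)) V"
  shows "holo_germ \<A> p f"
proof -
  have "\<forall>\<^sub>F q in nhds p. q \<in> fst c \<and> snd c q \<in> V"
    by (rule eventually_chart[OF M eventually_nhds_in_open[OF V]])
  then obtain W where W: "open W" "p \<in> W" "\<And>q. q \<in> W \<Longrightarrow> q \<in> fst c \<and> snd c q \<in> V"
    unfolding eventually_nhds by blast
  have "mholo \<A> W f"
    by (rule mholo_chart[OF M(1,2) W(1) _ cholo_on_subset[OF f]]) (use W(3) in auto)
  with W show ?thesis by (auto simp: holo_germ_def)
qed

lemma holo_germ_eventually:
  assumes "holo_germ \<A> p f"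
  shows "\<forall>\<^sub>F q in nhds p. holo_germ \<A> q f"
  using assms unfolding holo_germ_def eventually_nhds by blast

lemma holo_germ_cong:
  assumes M: "complex_manifold \<A>" and f: "holo_germ \<A> p f" and eq: "\<forall>\<^sub>F q in nhds p. f q = g q"
  shows "holo_germ \<A> p g"
proof -
  obtain W where W: "open W" "p \<in> W" "mholo \<A> W f" using f by (auto simp: holo_germ_def)
  obtain W' where W': "open W'" "p \<in> W'" "\<And>q. q \<in> W' \<Longrightarrow> f q = g q"
    using eq unfolding eventually_nhds by blast
  have "mholo \<A> (W \<inter> W') g"
    by (rule mholo_cong[OF M open_Int[OF W(1) W'(1)] mholo_subset[OF W(3)]]) (use W'(3) in auto)
  with W W' show ?thesis unfolding holo_germ_def by (intro exI[of _ "W \<inter> W'"]) auto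
qed

text \<open>Both functions are restricted to the intersection of their domains; with
  \<open>g = f\<close> this also treats operations on one germ.\<close>

lemma holo_germ_binop:
  assumes "holo_germ \<A> p f" "holo_germ \<A> p g"
    and op: "\<And>W. mholo \<A> W f \<Longrightarrow> mholo \<A> W g \<Longrightarrow> mholo \<A> W h"
  shows "holo_germ \<A> p h"
proof -
  obtain W where W: "open W" "p \<in> W" "mholo \<A> W f" using assms(1) by (auto simp: holo_germ_def)
  obtain W' where W': "open W'" "p \<in> W'" "mholo \<A> W' g" using assms(2) by (auto simp: holo_germ_def)
  have "mholo \<A> (W \<inter> W') h" by (intro op mholo_subset[OF W(3)] mholo_subset[OF W'(3)]) auto
  with W W' show ?thesis unfolding holo_germ_def by (intro exI[of _ "W \<inter> W'"]) auto
qed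

lemma holo_germ_const: "holo_germ \<A> p (\<lambda>_. a)"
  unfolding holo_germ_def by (intro exI[of _ UNIV]) (simp add: mholo_const)

lemma holo_germ_add: "holo_germ \<A> p f \<Longrightarrow> holo_germ \<A> p g \<Longrightarrow> holo_germ \<A> p (\<lambda>x. f x + g x)"
  by (rule holo_germ_binop[of _ _ f g]) (auto intro: mholo_add)

lemma holo_germ_mult:
  fixes f g :: "'m::topological_space \<Rightarrow> complex"
  shows "holo_germ \<A> p f \<Longrightarrow> holo_germ \<A> p g \<Longrightarrow> holo_germ \<A> p (\<lambda>x. f x * g x)"
  by (rule holo_germ_binop[of _ _ f g]) (auto intro: mholo_mult)

lemma holo_germ_nth:
  fixes f :: "'m::topological_space \<Rightarrow> 'b::complex_normed_vector ^ 'n"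
  shows "holo_germ \<A> p f \<Longrightarrow> holo_germ \<A> p (\<lambda>x. f x $ i)"
  by (rule holo_germ_binop[of _ _ f f]) (auto simp: mholo_vec_iff[of _ _ f])

subsection \<open>The cylinder over a manifold\<close>

text \<open>Names the members of \<open>cyl \<A>\<close>, so that the product atlas becomes an image
  of \<open>\<A>\<close> and its charts can be handled one at a time.\<close>

definition cyl_chart :: "('m, 'e) chart \<Rightarrow> (complex \<times> 'm, complex \<times> 'e) chart" where
  "cyl_chart c = (UNIV \<times> fst c, \<lambda>(z, t). (z, snd c t))"

lemma cyl_eq: "cyl \<A> = cyl_chart ` \<A>"
  unfolding cyl_def cyl_chart_def by (auto simp: case_prod_unfold image_iff)

lemma cyl_chart_simps [simp]:
  "fst (cyl_chart c) = UNIV \<times> fst c" "snd (cyl_chart c) (z, t) = (z, snd c t)"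
  "snd (cyl_chart c) ` (P \<times> Q) = P \<times> snd c ` Q"
  by (auto simp: cyl_chart_def image_iff)

lemma cinv_cyl_chart:
  assumes "complex_manifold \<A>" "c \<in> \<A>" "y \<in> snd c ` fst c"
  shows "cinv (cyl_chart c) (z, y) = (z, cinv c y)"
proof (rule inv_into_f_eq)
  show "inj_on (snd (cyl_chart c)) (fst (cyl_chart c))"
    using cinv_chart[OF assms(1,2)] by (auto simp: inj_on_def) metis
qed (use chart_cinv[OF assms(3)] in auto)

lemma complex_manifold_cyl:
  fixes \<A> :: "('m::t2_space, 'e::complex_normed_vector) chart set"
  assumes M: "complex_manifold \<A>"
  shows "complex_manifold (cyl \<A>)"
proof -
  have cover: "\<exists>d\<in>cyl \<A>. p \<in> fst d" for p
  proof -
    obtain c where "c \<in> \<A>" "snd p \<in> fst c" by (rule manifold_cover[OF M])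
    then show ?thesis by (auto simp: cyl_eq intro!: bexI[of _ c] mem_Times_iff[THEN iffD2])
  qed
  have homeo: "homeomorphism (UNIV \<times> fst c) (UNIV \<times> snd c ` fst c) (snd (cyl_chart c)) (cinv (cyl_chart c))"
    if c: "c \<in> \<A>" for c
  proof -
    note h = manifold_chart(3)[OF M c]
    have "continuous_on (UNIV \<times> fst c) (\<lambda>x. (fst x, snd c (snd x)))"
      by (intro continuous_on_Pair continuous_on_fst continuous_on_id
          continuous_on_compose2[OF homeomorphism_cont1[OF h] continuous_on_snd[OF continuous_on_id]]) auto
    then have 1: "continuous_on (UNIV \<times> fst c) (snd (cyl_chart c))"
      by (simp add: cyl_chart_def case_prod_unfold)
    have "continuous_on (UNIV \<times> snd c ` fst c) (\<lambda>x. (fst x, cinv c (snd x)))"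
      by (intro continuous_on_Pair continuous_on_fst continuous_on_id
          continuous_on_compose2[OF homeomorphism_cont2[OF h] continuous_on_snd[OF continuous_on_id]]) auto
    then have 2: "continuous_on (UNIV \<times> snd c ` fst c) (cinv (cyl_chart c))"
    proof (rule continuous_on_eq)
      show "(fst x, cinv c (snd x)) = cinv (cyl_chart c) x" if "x \<in> UNIV \<times> snd c ` fst c" for x
        using cinv_cyl_chart[OF M c, of "snd x" "fst x"] that by (simp add: mem_Times_iff)
    qed
    have 3: "cinv (cyl_chart c) (snd (cyl_chart c) x) = x" if "x \<in> UNIV \<times> fst c" for x
      using that cinv_cyl_chart[OF M c] cinv_chart[OF M c] by (cases x) auto
    have 4: "snd (cyl_chart c) (cinv (cyl_chart c) y) = y \<and> cinv (cyl_chart c) y \<in> UNIV \<times> fst c"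
      if "y \<in> UNIV \<times> snd c ` fst c" for y
    proof (cases y)
      case (Pair z w)
      then have w: "w \<in> snd c ` fst c" using that by simp
      show ?thesis unfolding Pair cinv_cyl_chart[OF M c w] using chart_cinv[OF w] by simp
    qed
    show ?thesis
    proof (rule homeomorphismI[OF 1 2])
      show "cinv (cyl_chart c) ` (UNIV \<times> snd c ` fst c) \<subseteq> UNIV \<times> fst c"
        using 4 by (intro image_subsetI) (rule conjunct2)
    qed (use 3 4 in simp_all)
  qed
  have trans: "cholo_on (\<lambda>y. snd (cyl_chart d) (cinv (cyl_chart c) y))
      (snd (cyl_chart c) ` (fst (cyl_chart c) \<inter> fst (cyl_chart d)))"
    if c: "c \<in> \<A>" and d: "d \<in> \<A>" for c d
  proof -
    have set: "snd (cyl_chart c) ` (fst (cyl_chart c) \<inter> fst (cyl_chart d)) = UNIV \<times> snd c ` (fst c \<inter> fst d)"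
      by (simp add: Times_Int_Times)
    have 1: "open ((UNIV :: complex set) \<times> snd c ` (fst c \<inter> fst d))"
      by (intro open_Times open_UNIV open_chart_image[OF M c] manifold_chart(1)[OF M d])
    have 2: "cholo_on (\<lambda>y. (fst y, snd d (cinv c (snd y)))) ((UNIV :: complex set) \<times> snd c ` (fst c \<inter> fst d))"
      by (intro cholo_on_Pair cholo_on_fst cholo_on_compose[OF cholo_on_snd manifold_transition[OF M c d]]) auto
    show ?thesis
      unfolding set
    proof (rule cholo_on_transform[OF 2 1])
      fix y :: "complex \<times> 'e" assume "y \<in> UNIV \<times> snd c ` (fst c \<inter> fst d)"
      then have "snd y \<in> snd c ` fst c" by auto
      then show "(fst y, snd d (cinv c (snd y))) = snd (cyl_chart d) (cinv (cyl_chart c) y)"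
        using cinv_cyl_chart[OF M c, of "snd y" "fst y"] by simp
    qed
  qed
  show ?thesis
    unfolding complex_manifold_def
  proof (intro conjI allI ballI)
    show "\<exists>(U, \<phi>)\<in>cyl \<A>. p \<in> U" for p using cover[of p] by (simp add: case_prod_unfold)
    show "case x of (U, \<phi>) \<Rightarrow> open U \<and> open (\<phi> ` U) \<and> homeomorphism U (\<phi> ` U) \<phi> (inv_into U \<phi>)"
      if x: "x \<in> cyl \<A>" for x
    proof -
      obtain c where c: "x = cyl_chart c" "c \<in> \<A>" using x by (auto simp: cyl_eq)
      show ?thesis
        using homeo[OF c(2)] manifold_chart[OF M c(2)]
        by (simp add: case_prod_unfold c(1) open_Times)
    qed
    show "case x of (U, \<phi>) \<Rightarrow> \<forall>(V, \<psi>)\<in>cyl \<A>. cholo_on (\<lambda>y. \<psi> (inv_into U \<phi> y)) (\<phi> ` (U \<inter> V))"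
      if x: "x \<in> cyl \<A>" for x
      using x trans by (auto simp: case_prod_unfold cyl_eq simp del: cyl_chart_simps)
  qed
qed

lemma mholo_cyl_slice:
  fixes \<A> :: "('m::t2_space, 'e::complex_normed_vector) chart set"
  assumes M: "complex_manifold \<A>" and V: "open V" and f: "mholo (cyl \<A>) V f"
  shows "mholo \<A> {\<tau>. (z, \<tau>) \<in> V} (\<lambda>\<tau>. f (z, \<tau>))"
proof (rule mholoI)
  fix c assume c: "c \<in> \<A>"
  define S where "S = snd c ` (fst c \<inter> {\<tau>. (z, \<tau>) \<in> V})"
  have "continuous_on UNIV (\<lambda>\<tau>::'m. (z, \<tau>))" by (intro continuous_intros)
  from open_vimage[OF V this] have "open {\<tau>. (z, \<tau>) \<in> V}" by (simp add: vimage_def)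
  then have S: "open S" unfolding S_def by (rule open_chart_image[OF M c])
  have mem: "(z, y) \<in> snd (cyl_chart c) ` (fst (cyl_chart c) \<inter> V)" if y: "y \<in> S" for y
  proof -
    obtain \<tau> where "y = snd c \<tau>" "\<tau> \<in> fst c" "(z, \<tau>) \<in> V" using y by (auto simp: S_def)
    then show ?thesis by (intro image_eqI[of _ _ "(z, \<tau>)"]) auto
  qed
  have "cyl_chart c \<in> cyl \<A>" using c by (simp add: cyl_eq)
  note fc = mholoD[OF f this]
  have "cholo_on (\<lambda>y. (z, y)) S" by (intro cholo_on_Pair cholo_on_const cholo_on_ident)
  then have "cholo_on (\<lambda>y. f (cinv (cyl_chart c) (z, y))) S"
    by (rule cholo_on_compose[OF _ fc]) (rule mem)
  then show "cholo_on (\<lambda>y. f (z, cinv c y)) S"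
    by (rule cholo_on_transform[OF _ S]) (subst cinv_cyl_chart[OF M c], auto simp: S_def)
qed

lemma holo_germ_cyl_slice:
  fixes \<A> :: "('m::t2_space, 'e::complex_normed_vector) chart set"
  assumes M: "complex_manifold \<A>" and f: "holo_germ (cyl \<A>) (z, t) f"
  shows "holo_germ \<A> t (\<lambda>\<tau>. f (z, \<tau>))"
proof -
  obtain V where V: "open V" "(z, t) \<in> V" "mholo (cyl \<A>) V f" using f by (auto simp: holo_germ_def)
  have "continuous_on UNIV (\<lambda>\<tau>::'m. (z, \<tau>))" by (intro continuous_intros)
  from open_vimage[OF V(1) this] have "open {\<tau>. (z, \<tau>) \<in> V}" by (simp add: vimage_def)
  with V(2) mholo_cyl_slice[OF M V(1,3), of z] show ?thesis
    unfolding holo_germ_def by (intro exI[of _ "{\<tau>. (z, \<tau>) \<in> V}"]) simp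
qed

subsection \<open>Tangent vectors\<close>

lemma dirderiv_has_derivative:
  assumes M: "complex_manifold \<A>" "c \<in> \<A>" "p \<in> fst c" and f: "holo_germ \<A> p f"
  shows "((\<lambda>y. f (cinv c y)) has_derivative (\<lambda>v. dirderiv \<A> c p v f)) (at (snd c p))"
    and "clinear_on UNIV (\<lambda>v. dirderiv \<A> c p v f)"
proof -
  obtain V where V: "open V" "snd c p \<in> V" "cholo_on (\<lambda>y. f (cinv c y)) V"
    by (rule holo_germ_chart[OF M f])
  have "(\<lambda>v. dirderiv \<A> c p v f) = frechet_derivative (\<lambda>y. f (cinv c y)) (at (snd c p))"
    using f by (simp add: dirderiv_def fun_eq_iff)
  with cholo_on_frechet[OF V(3,2)]
  show "((\<lambda>y. f (cinv c y)) has_derivative (\<lambda>v. dirderiv \<A> c p v f)) (at (snd c p))"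
    and "clinear_on UNIV (\<lambda>v. dirderiv \<A> c p v f)" by simp_all
qed

lemma dirderiv_unique:
  fixes \<A> :: "('m::t2_space, 'e::complex_normed_vector) chart set"
  assumes "holo_germ \<A> p f" "((\<lambda>y. f (cinv c y)) has_derivative L) (at (snd c p))"
  shows "dirderiv \<A> c p v f = L v"
  using assms(1) frechet_derivative_at[OF assms(2)] by (simp add: dirderiv_def)

lemma dirderiv_not_germ: "\<not> holo_germ \<A> p f \<Longrightarrow> dirderiv \<A> c p v f = 0"
  by (simp add: dirderiv_def)

lemma dirderiv_const:
  fixes \<A> :: "('m::t2_space, 'e::complex_normed_vector) chart set"
  shows "dirderiv \<A> c p v (\<lambda>_. a) = 0"
  by (rule dirderiv_unique[OF holo_germ_const has_derivative_const])

lemma dirderiv_add: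
  assumes M: "complex_manifold \<A>" "c \<in> \<A>" "p \<in> fst c" and f: "holo_germ \<A> p f" and g: "holo_germ \<A> p g"
  shows "dirderiv \<A> c p v (\<lambda>x. f x + g x) = dirderiv \<A> c p v f + dirderiv \<A> c p v g"
  by (rule dirderiv_unique[OF holo_germ_add[OF f g]],
      rule has_derivative_add; rule dirderiv_has_derivative[OF M]; fact)

lemma dirderiv_mult:
  assumes M: "complex_manifold \<A>" "c \<in> \<A>" "p \<in> fst c" and f: "holo_germ \<A> p f" and g: "holo_germ \<A> p g"
  shows "dirderiv \<A> c p v (\<lambda>x. f x * g x) = f p * dirderiv \<A> c p v g + dirderiv \<A> c p v f * g p"
  using dirderiv_unique[OF holo_germ_mult[OF f g]
      has_derivative_mult[OF dirderiv_has_derivative(1)[OF M f] dirderiv_has_derivative(1)[OF M g]]]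
  by (simp add: cinv_chart[OF M])

lemma holo_germ_sum:
  assumes "finite I" "\<And>i. i \<in> I \<Longrightarrow> holo_germ \<A> p (f i)"
  shows "holo_germ \<A> p (\<lambda>x. \<Sum>i\<in>I. f i x)"
  using assms by (induction I rule: finite_induct) (simp_all add: holo_germ_const holo_germ_add)

lemma dirderiv_sum:
  assumes M: "complex_manifold \<A>" "c \<in> \<A>" "p \<in> fst c"
    and "finite I" "\<And>i. i \<in> I \<Longrightarrow> holo_germ \<A> p (f i)"
  shows "dirderiv \<A> c p v (\<lambda>x. \<Sum>i\<in>I. f i x) = (\<Sum>i\<in>I. dirderiv \<A> c p v (f i))"
  using assms(4,5)
  by (induction I rule: finite_induct) (simp_all add: dirderiv_const dirderiv_add[OF M] holo_germ_sum)

lemma dirderiv_cong: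
  assumes M: "complex_manifold \<A>" "c \<in> \<A>" "p \<in> fst c" and eq: "\<forall>\<^sub>F q in nhds p. f q = g q"
  shows "dirderiv \<A> c p v f = dirderiv \<A> c p v g"
proof (cases "holo_germ \<A> p f")
  case True
  have "\<forall>\<^sub>F y in nhds (snd c p). f (cinv c y) = g (cinv c y)"
    using eventually_cinv[OF M eq] by eventually_elim simp
  then obtain V where V: "open V" "snd c p \<in> V" "\<And>y. y \<in> V \<Longrightarrow> f (cinv c y) = g (cinv c y)"
    unfolding eventually_nhds by blast
  have "((\<lambda>y. g (cinv c y)) has_derivative (\<lambda>v. dirderiv \<A> c p v f)) (at (snd c p))"
    by (rule has_derivative_transform_within_open[OF dirderiv_has_derivative(1)[OF M True] V])
  then show ?thesis using dirderiv_unique[OF holo_germ_cong[OF M(1) True eq]] by simp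
next
  case False
  \<comment> \<open>Tangent vectors vanish on functions that are not holomorphic near
    \<open>p\<close>, and being holomorphic near \<open>p\<close> depends only on the values
    there.\<close>
  moreover have "\<not> holo_germ \<A> p g"
  proof
    assume g: "holo_germ \<A> p g"
    have "\<forall>\<^sub>F q in nhds p. g q = f q" using eq by eventually_elim simp
    from holo_germ_cong[OF M(1) g this] False show False by contradiction
  qed
  ultimately show ?thesis by (simp add: dirderiv_not_germ)
qed

text \<open>By the chain rule, \<open>w\<close> is the image of \<open>v\<close> under the
  derivative of the coordinate change.\<close>

lemma dirderiv_change_chart:
  assumes M: "complex_manifold \<A>" and c: "c \<in> \<A>" "p \<in> fst c" and d: "d \<in> \<A>" "p \<in> fst d"
  obtains w where "dirderiv \<A> d p v = dirderiv \<A> c p w"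
proof
  define L where "L = frechet_derivative (\<lambda>y. snd c (cinv d y)) (at (snd d p))"
  have p: "snd d p \<in> snd d ` (fst d \<inter> fst c)" using c d by blast
  have L: "((\<lambda>y. snd c (cinv d y)) has_derivative L) (at (snd d p))"
    unfolding L_def by (rule cholo_on_frechet[OF manifold_transition[OF M d(1) c(1)] p])
  show "dirderiv \<A> d p v = dirderiv \<A> c p (L v)"
  proof
    fix f
    show "dirderiv \<A> d p v f = dirderiv \<A> c p (L v) f"
    proof (cases "holo_germ \<A> p f")
      case True
      have "((\<lambda>y. f (cinv c (snd c (cinv d y)))) has_derivative (\<lambda>v. dirderiv \<A> c p (L v) f)) (at (snd d p))"
        by (rule has_derivative_compose[OF L])
          (use dirderiv_has_derivative(1)[OF M c True] in \<open>simp add: cinv_chart[OF M d]\<close>)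
      then have "((\<lambda>y. f (cinv d y)) has_derivative (\<lambda>v. dirderiv \<A> c p (L v) f)) (at (snd d p))"
      proof (rule has_derivative_transform_within_open[OF _ open_chart_image[OF M d(1) manifold_chart(1)[OF M c(1)]] p])
        fix y assume "y \<in> snd d ` (fst d \<inter> fst c)"
        then obtain q where "y = snd d q" "q \<in> fst d" "q \<in> fst c" by blast
        then show "f (cinv c (snd c (cinv d y))) = f (cinv d y)"
          by (simp add: cinv_chart[OF M c(1)] cinv_chart[OF M d(1)])
      qed
      from dirderiv_unique[OF True this] show ?thesis .
    qed (simp add: dirderiv_not_germ)
  qed
qed

lemma dirderiv_eq_sum_coord_field:
  fixes \<A> :: "('m::t2_space, complex ^ 'n) chart set"
  assumes M: "complex_manifold \<A>" "c \<in> \<A>" "p \<in> fst c"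
  shows "dirderiv \<A> c p w = (\<lambda>f. \<Sum>i\<in>UNIV. w $ i * coord_field \<A> c i p f)"
proof
  fix f
  show "dirderiv \<A> c p w f = (\<Sum>i\<in>UNIV. w $ i * coord_field \<A> c i p f)"
  proof (cases "holo_germ \<A> p f")
    case True
    have "dirderiv \<A> c p w f = dirderiv \<A> c p (\<Sum>i\<in>UNIV. scaleC (w $ i) (axis i 1)) f"
      using scaleC_vec_axis[of w] by simp
    also have "\<dots> = (\<Sum>i\<in>UNIV. scaleC (w $ i) (dirderiv \<A> c p (axis i 1) f))"
      by (rule clinear_on_sum[OF csubspace_UNIV dirderiv_has_derivative(2)[OF M True] UNIV_I])
    finally show ?thesis by (simp add: coord_field_def scaleC_complex_def)
  qed (simp add: dirderiv_not_germ coord_field_def)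
qed

text \<open>\<open>tangent_space\<close> collects directions from all charts. Since one fixed chart
  suffices, compatibility with the connections need only be checked on its coordinate
  fields.\<close>

lemma tangent_vector_coords:
  fixes \<A> :: "('m::t2_space, complex ^ 'n) chart set"
  assumes M: "complex_manifold \<A>" "c \<in> \<A>" "p \<in> fst c" and D: "D \<in> tangent_space \<A> p"
  obtains w :: "complex ^ 'n" where "D = (\<lambda>f. \<Sum>i\<in>UNIV. w $ i * coord_field \<A> c i p f)"
proof -
  obtain d v where d: "d \<in> \<A>" "p \<in> fst d" "D = dirderiv \<A> d p v"
    using D by (auto simp: tangent_space_def)
  obtain w where "dirderiv \<A> d p v = dirderiv \<A> c p w"
    by (rule dirderiv_change_chart[OF M d(1,2)])
  with d(3) dirderiv_eq_sum_coord_field[OF M] that show thesis by metis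
qed

lemma dirderiv_in_tangent_space:
  "c \<in> \<A> \<Longrightarrow> p \<in> fst c \<Longrightarrow> dirderiv \<A> c p v \<in> tangent_space \<A> p"
  unfolding tangent_space_def by blast

text \<open>Sums over a subset \<open>I\<close> are included because \<open>form_add\<close> is
  applied one summand at a time and requires every partial sum to be a tangent vector.\<close>

lemma coord_sum_in_tangent_space:
  fixes \<A> :: "('m::t2_space, complex ^ 'n) chart set"
  assumes M: "complex_manifold \<A>" "c \<in> \<A>" "p \<in> fst c"
  shows "(\<lambda>f. \<Sum>i\<in>I. w i * coord_field \<A> c i p f) \<in> tangent_space \<A> p"
proof -
  have "(\<lambda>f. \<Sum>i\<in>I. w i * coord_field \<A> c i p f) = dirderiv \<A> c p (\<chi> i. if i \<in> I then w i else 0)"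
    unfolding dirderiv_eq_sum_coord_field[OF M]
    by (intro ext sum.mono_neutral_cong_left) auto
  then show ?thesis using dirderiv_in_tangent_space[OF M(2,3)] by simp
qed

lemma coord_field_in_tangent_space:
  fixes \<A> :: "('m::t2_space, complex ^ 'n) chart set"
  assumes "c \<in> \<A>" "p \<in> fst c"
  shows "coord_field \<A> c i p \<in> tangent_space \<A> p"
  unfolding coord_field_def by (rule dirderiv_in_tangent_space[OF assms])

lemma holo_vector_field_coord_field:
  fixes \<A> :: "('m::t2_space, complex ^ 'n) chart set"
  assumes "c \<in> \<A>"
  shows "holo_vector_field \<A> (fst c) (coord_field \<A> c i)"
  unfolding holo_vector_field_def
proof (intro ballI bexI[of _ c] conjI exI[of _ "\<lambda>_. axis i 1"])
  show "mholo \<A> (fst c \<inter> fst c) (\<lambda>_. axis i 1 :: complex ^ 'n)" by (rule mholo_const)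
qed (use assms in \<open>simp_all add: coord_field_def\<close>)

lemma coord_field_eq_axis_deriv:
  fixes \<A> :: "('m::t2_space, complex ^ 'n) chart set"
  assumes M: "complex_manifold \<A>" "c \<in> \<A>" "p \<in> fst c" and f: "holo_germ \<A> p f"
  shows "coord_field \<A> c i p f = axis_deriv i (\<lambda>y. f (cinv c y)) (snd c p)"
proof -
  obtain V where V: "snd c p \<in> V" "cholo_on (\<lambda>y. f (cinv c y)) V"
    by (rule holo_germ_chart[OF M f])
  show ?thesis
    unfolding axis_deriv_eq_frechet[OF V(2,1)] using f by (simp add: coord_field_def dirderiv_def)
qed

section \<open>Convergence of formal isomorphisms\<close>

text \<open>Inside the disc of convergence the terms of the series are bounded. As there are
  finitely many series, the smallest radius and the sum of the constants serve all of them.\<close>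

lemma fps_coeff_bound:
  fixes f :: "'i::finite \<Rightarrow> complex fps"
  assumes "\<And>i. fps_conv_radius (f i) > 0"
  obtains r C where "r > 0" "\<And>i k. norm (fps_nth (f i) k) \<le> C * (1 / r) ^ k"
proof -
  have "\<exists>r C. r > 0 \<and> (\<forall>k. norm (fps_nth (f i) k) \<le> C * (1 / r) ^ k)" for i
  proof -
    obtain r where r: "0 < ereal r" "ereal r < fps_conv_radius (f i)"
      using ereal_dense2[OF assms[of i]] by auto
    have "summable (\<lambda>k. fps_nth (f i) k * of_real r ^ k)"
      using r by (intro summable_in_conv_radius) (simp add: fps_conv_radius_def)
    from summable_imp_Bseq[OF this]
    obtain C where C: "\<And>k. norm (fps_nth (f i) k * of_real r ^ k) \<le> C" by (auto simp: Bseq_def)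
    have "norm (fps_nth (f i) k) \<le> C * (1 / r) ^ k" for k
      using C[of k] r by (simp add: norm_mult norm_power power_one_over field_simps)
    then show ?thesis using r by auto
  qed
  then obtain r C where r: "\<And>i. r i > 0" and C: "\<And>i k. norm (fps_nth (f i) k) \<le> C i * (1 / r i) ^ k"
    by metis
  define R where "R = Min (range r)"
  have R: "R > 0" "\<And>i. R \<le> r i" using r by (auto simp: R_def)
  have C0: "C i \<ge> 0" for i using C[of i 0] by (simp add: order_trans[OF norm_ge_zero])
  show thesis
  proof (rule that[OF R(1)])
    fix i k
    have "norm (fps_nth (f i) k) \<le> C i * (1 / r i) ^ k" by (rule C)
    also have "\<dots> \<le> (\<Sum>i\<in>UNIV. C i) * (1 / R) ^ k"
      using R r[of i] C0 by (intro mult_mono power_mono member_le_sum sum_nonneg) (auto simp: frac_le)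
    finally show "norm (fps_nth (f i) k) \<le> (\<Sum>i\<in>UNIV. C i) * (1 / R) ^ k" .
  qed
qed

lemma zcoeff_diff:
  fixes f g :: "complex \<times> 'a::complex_normed_vector \<Rightarrow> complex"
  assumes V: "open V" "(0, y) \<in> V" and f: "cholo_on f V" and g: "cholo_on g V"
  shows "zcoeff (\<lambda>x. f x - g x) k y = zcoeff f k y - zcoeff g k y"
proof -
  obtain P Q where PQ: "open P" "open Q" "(0, y) \<in> P \<times> Q" "P \<times> Q \<subseteq> V"
    using open_prod_elim[OF V] by blast
  have "(\<lambda>z. h (z, y)) has_fps_expansion fps_expansion (\<lambda>z. h (z, y)) 0" if "cholo_on h V" for h :: "complex \<times> 'a \<Rightarrow> complex"
    using holomorphic_on_fst_line[OF cholo_on_subset[OF that PQ(4)] PQ(1,2)] PQ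
    by (intro has_fps_expansion_fps_expansion[of P]) auto
  from has_fps_expansion_diff[OF this[OF f] this[OF g]]
  show ?thesis unfolding zcoeff_def by (simp add: fps_expansion_eqI)
qed

lemma zcoeff_zero [simp]: "zcoeff (\<lambda>_. 0) k y = 0"
  using fps_expansion_eqI[OF has_fps_expansion_0] by (simp add: zcoeff_def)

text \<open>The operator \<open>X \<mapsto> A X - X A'\<close> as a matrix acting on the entries of \<open>X\<close>.\<close>

definition sylvester :: "complex ^ 'r ^ 'r \<Rightarrow> complex ^ 'r ^ 'r \<Rightarrow> 'r \<times> 'r \<Rightarrow> 'r \<times> 'r \<Rightarrow> complex" where
  "sylvester A A' p q = (if snd p = snd q then A $ fst p $ fst q else 0)
     - (if fst p = fst q then A' $ snd q $ snd p else 0)"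

text \<open>Stated for arbitrary functions \<open>a\<close>, \<open>a'\<close> and \<open>x\<close>,
  since it is applied to \<open>z\<close>-coefficients of the matrices as well as to their
  values.\<close>

lemma sum_sylvester:
  fixes a a' :: "'r::finite \<Rightarrow> 'r \<Rightarrow> 'a::comm_ring" and x :: "'r \<times> 'r \<Rightarrow> 'a"
  shows "(\<Sum>q\<in>UNIV. ((if b = snd q then a c (fst q) else 0) - (if c = fst q then a' (snd q) b else 0)) * x q)
    = (\<Sum>k\<in>UNIV. a c k * x (k, b)) - (\<Sum>k\<in>UNIV. x (c, k) * a' k b)"
proof -
  have "(\<Sum>q\<in>UNIV. ((if b = snd q then a c (fst q) else 0) - (if c = fst q then a' (snd q) b else 0)) * x q)
      = (\<Sum>k\<in>UNIV. \<Sum>l\<in>UNIV. (if b = l then a c k * x (k, l) else 0) - (if c = k then a' l b * x (k, l) else 0))"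
    unfolding UNIV_Times_UNIV[symmetric] sum.cartesian_product
    by (intro sum.cong refl) (auto simp: algebra_simps)
  also have "\<dots> = (\<Sum>k\<in>UNIV. \<Sum>l\<in>UNIV. if b = l then a c k * x (k, l) else 0)
      - (\<Sum>k\<in>UNIV. \<Sum>l\<in>UNIV. if c = k then a' l b * x (k, l) else 0)"
    by (simp only: sum_subtractf)
  also have "(\<Sum>k\<in>UNIV. \<Sum>l\<in>UNIV. if c = k then a' l b * x (k, l) else 0)
      = (\<Sum>l\<in>UNIV. \<Sum>k\<in>UNIV. if c = k then a' l b * x (k, l) else 0)"
    by (rule sum.swap)
  finally show ?thesis by (simp add: mult.commute)
qed

lemma cyl_germ_chart:
  assumes M: "complex_manifold \<A>" "c \<in> \<A>" "t \<in> fst c" and f: "holo_germ (cyl \<A>) (z, t) f"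
  obtains V where "open V" "(z, snd c t) \<in> V" "V \<subseteq> UNIV \<times> snd c ` fst c"
    "cholo_on (\<lambda>x. f (fst x, cinv c (snd x))) V"
proof -
  have c: "cyl_chart c \<in> cyl \<A>" "(z, t) \<in> fst (cyl_chart c)" using M by (auto simp: cyl_eq)
  obtain V where V: "open V" "snd (cyl_chart c) (z, t) \<in> V" "V \<subseteq> snd (cyl_chart c) ` fst (cyl_chart c)"
    "cholo_on (\<lambda>y. f (cinv (cyl_chart c) y)) V"
    by (rule holo_germ_chart[OF complex_manifold_cyl[OF M(1)] c f])
  have "cholo_on (\<lambda>x. f (fst x, cinv c (snd x))) V"
  proof (rule cholo_on_transform[OF V(4,1)])
    fix x assume "x \<in> V"
    then have "snd x \<in> snd c ` fst c" using V(3) by auto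
    from cinv_cyl_chart[OF M(1,2) this, of "fst x"]
    show "f (cinv (cyl_chart c) x) = f (fst x, cinv c (snd x))" by simp
  qed
  with V that show thesis by simp
qed

lemma cyl_germI_chart:
  assumes M: "complex_manifold \<A>" "c \<in> \<A>" "t \<in> fst c" and V: "open V" "(z, snd c t) \<in> V"
    and f: "cholo_on (\<lambda>x. f (fst x, cinv c (snd x))) V"
  shows "holo_germ (cyl \<A>) (z, t) f"
proof -
  have c: "cyl_chart c \<in> cyl \<A>" "(z, t) \<in> fst (cyl_chart c)" using M by (auto simp: cyl_eq)
  define V' where "V' = V \<inter> UNIV \<times> snd c ` fst c"
  have V': "open V'" using V(1) manifold_chart(2)[OF M(1,2)] by (auto simp: V'_def intro: open_Times)
  have fV': "cholo_on (\<lambda>y. f (cinv (cyl_chart c) y)) V'"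
  proof (rule cholo_on_transform[OF cholo_on_subset[OF f] V'])
    fix x assume "x \<in> V'"
    then have "snd x \<in> snd c ` fst c" by (auto simp: V'_def)
    from cinv_cyl_chart[OF M(1,2) this, of "fst x"]
    show "f (fst x, cinv c (snd x)) = f (cinv (cyl_chart c) x)" by simp
  qed (simp add: V'_def)
  show ?thesis
    by (rule holo_germI_chart[OF complex_manifold_cyl[OF M(1)] c V' _ fV']) (use V(2) M(3) in \<open>simp add: V'_def\<close>)
qed

lemma eventually_nhds_prodI:
  assumes "eventually P (nhds a)" "eventually Q (nhds b)"
  shows "\<forall>\<^sub>F x in nhds (a, b). P (fst x) \<and> Q (snd x)"
  using eventually_prodI[OF assms] by (simp add: nhds_prod)

lemma fps_nth_z_deriv:
  "fps_nth (z_deriv X T t $ a $ b) k = (case k of 0 \<Rightarrow> 0 | Suc k' \<Rightarrow> X t (\<lambda>\<tau>. fps_nth (T \<tau> $ a $ b) k'))"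
  by (simp add: z_deriv_def split: nat.split)

lemma cholo_on_if: "cholo_on f S \<Longrightarrow> cholo_on (\<lambda>x. if b then f x else 0) S"
  by (cases b) (simp_all add: cholo_on_const)

text \<open>The identity for \<open>T\<close> is linear in the entries of \<open>T\<close>, so it is
  a system for a vector indexed by pairs, with coefficients \<open>sylvester\<close>. The value at
  \<open>(0, t0)\<close> is recorded for the invertibility of \<open>F\<close>, the equation near
  this point for the compatibility with the connections.\<close>

theorem formal_isomorphism_converges:
  fixes \<A> :: "('m::t2_space, complex ^ 'n) chart set"
    and A A' :: "'n \<Rightarrow> complex \<times> 'm \<Rightarrow> complex ^ 'r ^ 'r"
    and T :: "'m \<Rightarrow> complex fps ^ 'r ^ 'r"
  assumes M: "complex_manifold \<A>" and c: "c \<in> \<A>" "t0 \<in> fst c"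
    and A: "\<And>i. holo_germ (cyl \<A>) (0, t0) (A i)" and A': "\<And>i. holo_germ (cyl \<A>) (0, t0) (A' i)"
    and T: "formal_matrix \<A> t0 T" and iso: "defines_formal_isomorphism \<A> c t0 A A' T"
    and conv: "\<And>a b. fps_conv_radius (T t0 $ a $ b) > 0"
  obtains F where "holo_germ (cyl \<A>) (0, t0) F" "formal_eq t0 (formalize F) T"
    "\<And>a b. F (0, t0) $ a $ b = fps_nth (T t0 $ a $ b) 0"
    "\<forall>\<^sub>F x in nhds (0, t0). snd x \<in> fst c \<and> (\<forall>i a b.
        fst x * coord_field \<A> c i (snd x) (\<lambda>\<tau>. F (fst x, \<tau>) $ a $ b)
          + (A i x ** F x) $ a $ b - (F x ** A' i x) $ a $ b = 0)"
proof -
  note Mc = M c(1)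
  define y0 where "y0 = snd c t0"
  define lift where "lift = (\<lambda>x::complex \<times> (complex ^ 'n). (fst x, cinv c (snd x)))"
  define u where "u = (\<lambda>k p y. fps_nth (T (cinv c y) $ fst p $ snd p) k)"
  define B where "B = (\<lambda>i p q x. sylvester (A i (lift x)) (A' i (lift x)) p q)"
  have "\<exists>V. open V \<and> (0, y0) \<in> V \<and> V \<subseteq> UNIV \<times> snd c ` fst c \<and>
      cholo_on (\<lambda>x. A i (lift x)) V \<and> cholo_on (\<lambda>x. A' i (lift x)) V" for i
  proof -
    obtain V where V: "open V" "(0, snd c t0) \<in> V" "V \<subseteq> UNIV \<times> snd c ` fst c"
      "cholo_on (\<lambda>x. A i (fst x, cinv c (snd x))) V"
      by (rule cyl_germ_chart[OF M c A])
    obtain V' where V': "open V'" "(0, snd c t0) \<in> V'" "V' \<subseteq> UNIV \<times> snd c ` fst c"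
      "cholo_on (\<lambda>x. A' i (fst x, cinv c (snd x))) V'"
      by (rule cyl_germ_chart[OF M c A'])
    show ?thesis
      using V V' cholo_on_subset[OF V(4), of "V \<inter> V'"] cholo_on_subset[OF V'(4), of "V \<inter> V'"]
      by (intro exI[of _ "V \<inter> V'"]) (auto simp: lift_def y0_def)
  qed
  then obtain VV where VV: "\<And>i. open (VV i)" "\<And>i. (0, y0) \<in> VV i" "\<And>i. VV i \<subseteq> UNIV \<times> snd c ` fst c"
    "\<And>i. cholo_on (\<lambda>x. A i (lift x)) (VV i)" "\<And>i. cholo_on (\<lambda>x. A' i (lift x)) (VV i)"
    by metis
  \<comment> \<open>There are finitely many coordinate directions, so one neighbourhood serves all
    connection matrices.\<close>
  define V where "V = (\<Inter>i. VV i)"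
  have V: "open V" "(0, y0) \<in> V" "V \<subseteq> UNIV \<times> snd c ` fst c"
  proof -
    show "open V" unfolding V_def by (intro open_INT ballI VV(1)) simp
    show "(0, y0) \<in> V" by (simp add: V_def VV(2))
    show "V \<subseteq> UNIV \<times> snd c ` fst c" using VV(3)[of undefined] unfolding V_def by blast
  qed
  have A_V: "cholo_on (\<lambda>x. A i (lift x) $ a $ b) V" for i a b
    using cholo_on_subset[OF VV(4)[of i], of V] by (auto simp: V_def cholo_on_vec_iff)
  have A'_V: "cholo_on (\<lambda>x. A' i (lift x) $ a $ b) V" for i a b
    using cholo_on_subset[OF VV(5)[of i], of V] by (auto simp: V_def cholo_on_vec_iff)
  have B_V: "cholo_on (B i p q) V" for i p q
    unfolding B_def sylvester_def
    by (intro cholo_on_diff cholo_on_if A_V A'_V)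
  have T_germ: "holo_germ \<A> t0 (\<lambda>t. fps_nth (T t $ a $ b) k)" for a b k
    using T by (simp add: formal_matrix_def)
  have u_holo: "\<exists>U. open U \<and> y0 \<in> U \<and> cholo_on (u k p) U" for k p
  proof -
    obtain U where "open U" "snd c t0 \<in> U" "cholo_on (\<lambda>y. fps_nth (T (cinv c y) $ fst p $ snd p) k) U"
      by (rule holo_germ_chart[OF M c T_germ])
    then show ?thesis by (auto simp: u_def y0_def)
  qed
  have zB: "zcoeff (B i (a, b) q) j y = (if b = snd q then zcoeff (\<lambda>x. A i (lift x) $ a $ fst q) j y else 0)
      - (if a = fst q then zcoeff (\<lambda>x. A' i (lift x) $ snd q $ b) j y else 0)" if "(0, y) \<in> V" for i a b q j y
  proof -
    have "zcoeff (B i (a, b) q) j y = zcoeff (\<lambda>x. if b = snd q then A i (lift x) $ a $ fst q else 0) j y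
        - zcoeff (\<lambda>x. if a = fst q then A' i (lift x) $ snd q $ b else 0) j y"
      unfolding B_def sylvester_def fst_conv snd_conv
      by (rule zcoeff_diff[OF V(1) that]) (intro cholo_on_if A_V A'_V)+
    then show ?thesis by (cases "b = snd q"; cases "a = fst q") simp_all
  qed
  have sys: "\<forall>\<^sub>F y in nhds y0. system_coeff B u i p k y = 0" for i p k
  proof -
    obtain a b where p: "p = (a, b)" by (cases p)
    have ev1: "\<forall>\<^sub>F t in nhds t0. fps_nth ((z_deriv (coord_field \<A> c i) T t + formalize (A i) t ** T t
        - T t ** formalize (A' i) t) $ a $ b) k = 0"
      using iso by (auto simp: defines_formal_isomorphism_def formal_eq_def elim!: allE[of _ i] allE[of _ a] allE[of _ b] allE[of _ k] eventually_mono)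
    \<comment> \<open>The derivative term of index \<open>k\<close> involves the coefficient
      \<open>k - 1\<close>. For \<open>k = 0\<close> there is no such term and the truncated
      difference does no harm.\<close>
    have ev2: "\<forall>\<^sub>F t in nhds t0. holo_germ \<A> t (\<lambda>t. fps_nth (T t $ a $ b) (k - 1))"
      by (rule holo_germ_eventually[OF T_germ])
    have "continuous_on UNIV (\<lambda>y::complex ^ 'n. (0::complex, y))" by (intro continuous_intros)
    from open_vimage[OF V(1) this] have "\<forall>\<^sub>F y in nhds y0. y \<in> {y. (0, y) \<in> V}"
      using V(2) by (intro eventually_nhds_in_open) (simp_all add: vimage_def)
    then show ?thesis
      using eventually_cinv[OF M c ev1, folded y0_def] eventually_cinv[OF M c ev2, folded y0_def]
    proof eventually_elim
      case (elim y)
      define t where "t = cinv c y"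
      have t: "t \<in> fst c" "snd c t = y" using elim(2) chart_cinv[of y c] by (auto simp: t_def)
      have yV: "(0, y) \<in> V" using elim(1) by simp
      have liftz: "lift (z, y) = (z, t)" for z by (simp add: lift_def t_def)
      have d: "fps_nth (z_deriv (coord_field \<A> c i) T t $ a $ b) k
          = (case k of 0 \<Rightarrow> 0 | Suc k' \<Rightarrow> axis_deriv i (u k' p) y)"
      proof (cases k)
        case (Suc k')
        then have "holo_germ \<A> t (\<lambda>t. fps_nth (T t $ a $ b) k')" using elim(3) by (simp add: t_def)
        from coord_field_eq_axis_deriv[OF M c(1) t(1) this, of i] show ?thesis
          unfolding fps_nth_z_deriv Suc by (simp add: t u_def p)
      qed (simp add: fps_nth_z_deriv)
      have m1: "fps_nth ((formalize (A i) t ** T t) $ a $ b) k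
          = (\<Sum>j\<le>k. \<Sum>l\<in>UNIV. zcoeff (\<lambda>x. A i (lift x) $ a $ l) j y * u (k - j) (l, b) y)"
        unfolding matrix_matrix_mult_def
        by (subst sum.swap)
          (simp add: formalize_def fps_sum_nth fps_mult_nth zcoeff_def liftz u_def atLeast0AtMost flip: t_def)
      have m2: "fps_nth ((T t ** formalize (A' i) t) $ a $ b) k
          = (\<Sum>j\<le>k. \<Sum>l\<in>UNIV. u (k - j) (a, l) y * zcoeff (\<lambda>x. A' i (lift x) $ l $ b) j y)"
      proof -
        \<comment> \<open>The scalar factors are exchanged so that the convolution index
          \<open>j\<close> belongs to \<open>A'\<close>, as in \<open>system_coeff\<close>.\<close>
        have comm: "fps_nth (f * g) k = (\<Sum>j\<le>k. fps_nth g (k - j) * fps_nth f j)" for f g :: "complex fps"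
          unfolding fps_mult_nth atLeast0AtMost by (simp add: mult.commute)
        have "fps_nth ((T t ** formalize (A' i) t) $ a $ b) k
            = (\<Sum>l\<in>UNIV. fps_nth (formalize (A' i) t $ l $ b * T t $ a $ l) k)"
          by (simp add: matrix_matrix_mult_def fps_sum_nth mult.commute)
        also have "\<dots> = (\<Sum>l\<in>UNIV. \<Sum>j\<le>k. u (k - j) (a, l) y * zcoeff (\<lambda>x. A' i (lift x) $ l $ b) j y)"
          unfolding comm by (simp add: formalize_def zcoeff_def liftz u_def flip: t_def)
        finally show ?thesis by (subst sum.swap)
      qed
      have "(\<Sum>q\<in>UNIV. zcoeff (B i p q) j y * u (k - j) q y)
          = (\<Sum>l\<in>UNIV. zcoeff (\<lambda>x. A i (lift x) $ a $ l) j y * u (k - j) (l, b) y)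
            - (\<Sum>l\<in>UNIV. u (k - j) (a, l) y * zcoeff (\<lambda>x. A' i (lift x) $ l $ b) j y)" for j
        unfolding p zB[OF yV] by (rule sum_sylvester)
      then have "system_coeff B u i p k y = fps_nth ((z_deriv (coord_field \<A> c i) T t
          + formalize (A i) t ** T t - T t ** formalize (A' i) t) $ a $ b) k"
        by (simp add: system_coeff_def d m1 m2 sum_subtractf)
      then show ?case using elim(2) by (simp add: t_def)
    qed
  qed
  obtain r C where r: "r > 0" and C': "\<And>p k. norm (fps_nth (T t0 $ fst p $ snd p) k) \<le> C * (1 / r) ^ k"
    by (rule fps_coeff_bound[where f = "\<lambda>p. T t0 $ fst p $ snd p", OF conv]) (rule that)
  have C: "norm (u k p y0) \<le> C * (1 / r) ^ k" for k p
    using C'[where p = p and k = k] by (simp add: u_def y0_def cinv_chart[OF M c])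
  obtain \<epsilon> \<delta> F where pos: "\<epsilon> > 0" "\<delta> > 0" and F: "\<And>p. cholo_on (F p) (ball 0 \<epsilon> \<times> ball y0 \<delta>)"
    and Fu: "\<And>k p. \<forall>\<^sub>F y in nhds y0. zcoeff (F p) k y = u k p y"
    and pde: "\<And>i p z y. z \<in> ball 0 \<epsilon> \<Longrightarrow> y \<in> ball y0 \<delta> \<Longrightarrow>
        z * axis_deriv i (\<lambda>y. F p (z, y)) y + (\<Sum>q\<in>UNIV. B i p q (z, y) * F q (z, y)) = 0"
    by (rule formal_solution_converges[OF V(1,2) B_V u_holo sys r C]) (rule that)
  define G where "G = (\<lambda>x. (\<chi> a b. F (a, b) (fst x, snd c (snd x))) :: complex ^ 'r ^ 'r)"
  \<comment> \<open>The ball of convergence is cut down to the image of the chart, where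
    \<open>cinv c\<close> is a genuine inverse.\<close>
  define Y where "Y = ball y0 \<delta> \<inter> snd c ` fst c"
  have Y: "open Y" "y0 \<in> Y" using manifold_chart(2)[OF Mc] pos c(2) by (auto simp: Y_def y0_def)
  have Gy: "G (z, cinv c y) $ a $ b = F (a, b) (z, y)" if "y \<in> Y" for z y a b
    using that chart_cinv[of y c] by (simp add: G_def Y_def)
  have F_Y: "cholo_on (F p) (ball 0 \<epsilon> \<times> Y)" for p
    by (rule cholo_on_subset[OF F]) (auto simp: Y_def)
  show thesis
  proof (rule that[of G])
    show "holo_germ (cyl \<A>) (0, t0) G"
    proof (rule cyl_germI_chart[OF M c])
      show "open (ball (0::complex) \<epsilon> \<times> Y)" by (intro open_Times open_ball Y)
      show "(0, snd c t0) \<in> ball 0 \<epsilon> \<times> Y" using Y pos by (simp add: y0_def)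
      show "cholo_on (\<lambda>x. G (fst x, cinv c (snd x))) (ball 0 \<epsilon> \<times> Y)"
        unfolding cholo_on_vec_iff
      proof (intro allI)
        show "cholo_on (\<lambda>x. G (fst x, cinv c (snd x)) $ a $ b) (ball 0 \<epsilon> \<times> Y)" for a b
          by (rule cholo_on_transform[OF F_Y[of "(a, b)"] open_Times[OF open_ball Y(1)]]) (auto simp: Gy)
      qed
    qed
    show "formal_eq t0 (formalize G) T"
      unfolding formal_eq_def
    proof (intro allI)
      fix a b k
      show "\<forall>\<^sub>F t in nhds t0. fps_nth (formalize G t $ a $ b) k = fps_nth (T t $ a $ b) k"
        using eventually_chart[OF M c Fu[of "(a, b)" k, unfolded y0_def]]
        by eventually_elim (simp add: formalize_def zcoeff_def G_def u_def cinv_chart[OF Mc])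
    qed
    show "G (0, t0) $ a $ b = fps_nth (T t0 $ a $ b) 0" for a b
    proof -
      have "zcoeff (F (a, b)) 0 y0 = u 0 (a, b) y0" by (rule eventually_nhds_x_imp_x[OF Fu])
      then show ?thesis by (simp add: zcoeff_def fps_expansion_def G_def u_def y0_def cinv_chart[OF M c])
    qed
    have "\<forall>\<^sub>F z in nhds 0. z \<in> ball (0::complex) \<epsilon>" by (rule eventually_nhds_in_open) (use pos in auto)
    from eventually_nhds_prodI[OF this eventually_chart[OF M c eventually_nhds_in_open[OF Y[unfolded y0_def]]]]
    show "\<forall>\<^sub>F x in nhds (0, t0). snd x \<in> fst c \<and> (\<forall>i a b.
        fst x * coord_field \<A> c i (snd x) (\<lambda>\<tau>. G (fst x, \<tau>) $ a $ b)
          + (A i x ** G x) $ a $ b - (G x ** A' i x) $ a $ b = 0)"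
    proof eventually_elim
      case (elim x)
      obtain z t where x: "x = (z, t)" by (cases x)
      have z: "z \<in> ball 0 \<epsilon>" and t: "t \<in> fst c" and y: "snd c t \<in> Y" using elim by (auto simp: x)
      have y\<delta>: "snd c t \<in> ball y0 \<delta>" using y by (simp add: Y_def)
      have GF: "G (z, t) $ a $ b = F (a, b) (z, snd c t)" for a b by (simp add: G_def)
      have "fst x * coord_field \<A> c i (snd x) (\<lambda>\<tau>. G (fst x, \<tau>) $ a $ b)
          + (A i x ** G x) $ a $ b - (G x ** A' i x) $ a $ b = 0" for i a b
      proof -
        have hol: "cholo_on (\<lambda>y. G (z, cinv c y) $ a $ b) Y"
        proof (rule cholo_on_transform[OF _ Y(1)])
          have "cholo_on (\<lambda>y. (z, y)) Y" by (intro cholo_on_Pair cholo_on_const cholo_on_ident)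
          then show "cholo_on (\<lambda>y. F (a, b) (z, y)) Y"
            by (rule cholo_on_compose[OF _ F_Y]) (use z in simp)
        qed (simp add: Gy)
        have "holo_germ \<A> t (\<lambda>\<tau>. G (z, \<tau>) $ a $ b)" by (rule holo_germI_chart[OF Mc t Y(1) y hol])
        from coord_field_eq_axis_deriv[OF Mc t this, of i]
        have "coord_field \<A> c i t (\<lambda>\<tau>. G (z, \<tau>) $ a $ b)
            = axis_deriv i (\<lambda>y. G (z, cinv c y) $ a $ b) (snd c t)" .
        also have "\<dots> = axis_deriv i (\<lambda>y. F (a, b) (z, y)) (snd c t)"
          by (rule axis_deriv_cong_ev, rule eventually_mono[OF eventually_nhds_in_open[OF Y(1) y]]) (rule Gy)
        finally have d: "coord_field \<A> c i t (\<lambda>\<tau>. G (z, \<tau>) $ a $ b)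
            = axis_deriv i (\<lambda>y. F (a, b) (z, y)) (snd c t)" .
        have lz: "lift (z, snd c t) = (z, t)" using t by (simp add: lift_def cinv_chart[OF Mc])
        have "(\<Sum>q\<in>UNIV. B i (a, b) q (z, snd c t) * F q (z, snd c t))
            = (\<Sum>l\<in>UNIV. A i (z, t) $ a $ l * F (l, b) (z, snd c t))
              - (\<Sum>l\<in>UNIV. F (a, l) (z, snd c t) * A' i (z, t) $ l $ b)"
          unfolding B_def sylvester_def lz fst_conv snd_conv by (rule sum_sylvester)
        also have "\<dots> = (A i x ** G x) $ a $ b - (G x ** A' i x) $ a $ b"
          by (simp add: x matrix_matrix_mult_def GF)
        finally show ?thesis using pde[OF z y\<delta>, of i "(a, b)"] d by (simp add: x add_diff_eq)
      qed
      then show ?case using t by (simp add: x)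
    qed
  qed
qed

section \<open>Invertible holomorphic matrices\<close>

lemma mholo_det:
  fixes N :: "'m \<Rightarrow> complex ^ 'r ^ 'r"
  assumes "\<And>i j. mholo \<A> W (\<lambda>x. N x $ i $ j)"
  shows "mholo \<A> W (\<lambda>x. det (N x))"
  unfolding det_def by (intro mholo_sum mholo_mult mholo_const mholo_prod assms)

text \<open>Cramer's rule, applied to each unit vector, gives the columns of the inverse. The
  explicit formula matters because its entries are built from determinants and thus inherit
  holomorphy.\<close>

lemma matrix_inverse_cramer:
  fixes N :: "'a::field ^ 'r ^ 'r"
  assumes "det N \<noteq> 0"
  defines "K \<equiv> (\<chi> k l. det (\<chi> i j. if j = k then axis l 1 $ i else N $ i $ j) * inverse (det N))"
  shows "N ** K = mat 1" and "K ** N = mat 1"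
proof -
  have "(N ** K) $ i $ l = mat 1 $ i $ l" for i l
  proof -
    have "N *v (\<chi> k. det (\<chi> i j. if j = k then axis l 1 $ i else N $ i $ j) / det N) = axis l 1"
      using cramer[OF assms(1), of _ "axis l 1"] by simp
    then have "(N *v (\<chi> k. K $ k $ l)) $ i = axis l 1 $ i"
      by (simp add: K_def divide_inverse)
    then show ?thesis by (simp add: matrix_matrix_mult_def matrix_vector_mult_def mat_def axis_def)
  qed
  then show "N ** K = mat 1" by (simp add: vec_eq_iff)
  then show "K ** N = mat 1" using matrix_left_right_inverse by blast
qed

text \<open>The determinant is continuous, so it stays nonzero near \<open>p\<close>, where Cramer's
  formula provides a holomorphic inverse.\<close>

lemma holo_GL_of_det:
  fixes \<A> :: "('m::t2_space, 'e::complex_normed_vector) chart set" and F :: "'m \<Rightarrow> complex ^ 'r ^ 'r"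
  assumes M: "complex_manifold \<A>" and F: "holo_germ \<A> p F" and nz: "det (F p) \<noteq> 0"
  shows "holo_GL \<A> p F"
proof -
  obtain W where W: "open W" "p \<in> W" "mholo \<A> W F" using F by (auto simp: holo_germ_def)
  have ent: "mholo \<A> W (\<lambda>x. F x $ i $ j)" for i j using W(3) by (simp add: mholo_vec_iff)
  have d: "mholo \<A> W (\<lambda>x. det (F x))" by (rule mholo_det[OF ent])
  define D where "D = (\<lambda>x. det (F x))"
  have "isCont D p"
    using mholo_continuous_on[OF M d W(1)] W continuous_on_eq_continuous_at unfolding D_def by blast
  then have lim: "filterlim D (nhds (D p)) (nhds p)"
    by (simp add: isCont_def tendsto_at_iff_tendsto_nhds)
  have "D p \<noteq> 0" using nz by (simp add: D_def)
  from tendsto_imp_eventually_ne[OF lim this]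
  have "\<forall>\<^sub>F x in nhds p. x \<in> W \<and> det (F x) \<noteq> 0"
    using eventually_nhds_in_open[OF W(1,2)] by eventually_elim (simp add: D_def)
  then obtain U where U: "open U" "p \<in> U" "\<And>x. x \<in> U \<Longrightarrow> x \<in> W \<and> det (F x) \<noteq> 0"
    unfolding eventually_nhds by blast
  then have UW: "U \<subseteq> W" by blast
  define G where "G = (\<lambda>x. \<chi> k l. det (\<chi> i j. if j = k then axis l 1 $ i else F x $ i $ j) * inverse (det (F x)))"
  have "mholo \<A> U (\<lambda>x. G x $ k $ l)" for k l
  proof -
    have "mholo \<A> U (\<lambda>x. if j = k then axis l 1 $ i else F x $ i $ j)" for i j
      by (cases "j = k") (simp_all add: mholo_const mholo_subset[OF ent UW])
    then have "mholo \<A> U (\<lambda>x. det (\<chi> i j. if j = k then axis l 1 $ i else F x $ i $ j))"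
      by (intro mholo_det) simp
    moreover have "mholo \<A> U (\<lambda>x. inverse (det (F x)))"
      by (rule mholo_inverse[OF M mholo_subset[OF d UW]]) (use U(3) in blast)
    ultimately show ?thesis unfolding G_def vec_lambda_beta by (rule mholo_mult)
  qed
  then have "mholo \<A> U G" by (simp add: mholo_vec_iff)
  then have G: "holo_germ \<A> p G" using U(1,2) unfolding holo_germ_def by blast
  have "\<forall>\<^sub>F x in nhds p. F x ** G x = mat 1 \<and> G x ** F x = mat 1"
    using eventually_nhds_in_open[OF U(1,2)]
  proof eventually_elim
    case (elim x)
    then have "det (F x) \<noteq> 0" using U(3) by blast
    from matrix_inverse_cramer[OF this] show ?case by (simp add: G_def)
  qed
  then show ?thesis unfolding holo_GL_def using F G by blast
qed

section \<open>Frames of vector bundles\<close>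

lemma scaleC_sum_right: "scaleC a (\<Sum>i\<in>I. x i) = (\<Sum>i\<in>I. scaleC a (x i))"
  by (induction I rule: infinite_finite_induct) (simp_all add: scaleC_add_right)

lemma scaleC_sum_left: "scaleC (\<Sum>i\<in>I. a i) x = (\<Sum>i\<in>I. scaleC (a i) x)"
  by (induction I rule: infinite_finite_induct) (simp_all add: scaleC_add_left)

lemma matrix_vector_mult_scaleC: "(N :: complex ^ 'a ^ 'b) *v scaleC a x = scaleC a (N *v x)"
  by (simp add: vec_eq_iff matrix_vector_mult_def scaleC_vec_def scaleC_complex_def sum_distrib_left mult_ac)

text \<open>\<open>co x\<close> is the coordinate isomorphism from the fibre over \<open>x\<close> with respect to the basis \<open>v\<close>.\<close>

definition holo_frame ::
  "('b::topological_space, 'e::complex_normed_vector) chart set \<Rightarrow>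
   ('b, 'v::complex_vector, 'r::finite) vector_bundle \<Rightarrow> 'b set \<Rightarrow> ('r \<Rightarrow> 'b \<Rightarrow> 'v) \<Rightarrow>
   ('b \<Rightarrow> 'v \<Rightarrow> complex ^ 'r) \<Rightarrow> bool" where
  "holo_frame \<B> H W v co \<longleftrightarrow>
     (\<forall>x\<in>W. (\<forall>j. v j x \<in> fibre H x) \<and> bij_betw (co x) (fibre H x) UNIV \<and> clinear_on (fibre H x) (co x) \<and>
        (\<forall>h\<in>fibre H x. (\<Sum>j\<in>UNIV. scaleC (co x h $ j) (v j x)) = h)) \<and>
     (\<forall>V s. open V \<and> V \<subseteq> W \<and> (\<forall>x\<in>V. s x \<in> fibre H x) \<longrightarrow>
        (holo_section \<B> H V s \<longleftrightarrow> mholo \<B> V (\<lambda>x. co x (s x))))"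

lemma holo_frameD:
  assumes "holo_frame \<B> H W v co" "x \<in> W"
  shows "v j x \<in> fibre H x" "bij_betw (co x) (fibre H x) UNIV" "clinear_on (fibre H x) (co x)"
    "h \<in> fibre H x \<Longrightarrow> (\<Sum>j\<in>UNIV. scaleC (co x h $ j) (v j x)) = h"
  using assms unfolding holo_frame_def by blast+

lemma holo_frame_section_iff:
  assumes "holo_frame \<B> H W v co" "open V" "V \<subseteq> W" "\<And>x. x \<in> V \<Longrightarrow> s x \<in> fibre H x"
  shows "holo_section \<B> H V s \<longleftrightarrow> mholo \<B> V (\<lambda>x. co x (s x))"
  using assms unfolding holo_frame_def by simp

lemma holo_frame_coords:
  assumes "holo_frame \<B> H W v co" "x \<in> W"
  shows "co x (\<Sum>j\<in>UNIV. scaleC (a $ j) (v j x)) = a"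
proof -
  obtain h where h: "h \<in> fibre H x" "co x h = a"
    using holo_frameD(2)[OF assms] unfolding bij_betw_def by (metis UNIV_I imageE)
  then show ?thesis using holo_frameD(4)[OF assms h(1)] by simp
qed

lemma vector_bundleD:
  assumes "holo_vector_bundle \<B> H"
  shows "csubspace (fibre H x)"
    and "(W, \<psi>) \<in> trivs H \<Longrightarrow> open W"
    and "(W, \<psi>) \<in> trivs H \<Longrightarrow> x \<in> W \<Longrightarrow> bij_betw (\<psi> x) (fibre H x) UNIV"
    and "(W, \<psi>) \<in> trivs H \<Longrightarrow> x \<in> W \<Longrightarrow> clinear_on (fibre H x) (\<psi> x)"
  using assms unfolding holo_vector_bundle_def by fast+

lemma vector_bundle_transition:
  assumes "holo_vector_bundle \<B> H" "(W, \<psi>) \<in> trivs H" "(W', \<psi>') \<in> trivs H"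
  obtains g where "mholo \<B> (W \<inter> W') g" "\<And>x h. x \<in> W \<inter> W' \<Longrightarrow> h \<in> fibre H x \<Longrightarrow> \<psi>' x h = g x *v \<psi> x h"
proof -
  have "\<exists>g. mholo \<B> (W \<inter> W') g \<and> (\<forall>x\<in>W \<inter> W'. \<forall>h\<in>fibre H x. \<psi>' x h = g x *v \<psi> x h)"
    using assms unfolding holo_vector_bundle_def by fast
  then obtain g where g: "mholo \<B> (W \<inter> W') g" "\<forall>x\<in>W \<inter> W'. \<forall>h\<in>fibre H x. \<psi>' x h = g x *v \<psi> x h"
    by (elim exE conjE)
  show thesis by (rule that[OF g(1)]) (use g(2) in blast)
qed

lemma holo_sectionD:
  assumes "holo_section \<B> H V s"
  shows "x \<in> V \<Longrightarrow> s x \<in> fibre H x" "(W, \<psi>) \<in> trivs H \<Longrightarrow> mholo \<B> (V \<inter> W) (\<lambda>x. \<psi> x (s x))"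
  using assms unfolding holo_section_def by auto

lemma holo_section_subset: "holo_section \<B> H V s \<Longrightarrow> V' \<subseteq> V \<Longrightarrow> holo_section \<B> H V' s"
  unfolding holo_section_def case_prod_unfold by (fast intro: mholo_subset)

text \<open>Any other trivialisation differs by a holomorphic transition matrix, so one is
  enough.\<close>

lemma holo_section_by_triv:
  fixes \<B> :: "('b::t2_space, 'e::complex_normed_vector) chart set"
  assumes M: "complex_manifold \<B>" and vb: "holo_vector_bundle \<B> H" and tr: "(W, \<psi>) \<in> trivs H"
    and V: "open V" "V \<subseteq> W" and s: "\<And>x. x \<in> V \<Longrightarrow> s x \<in> fibre H x" and h: "mholo \<B> V (\<lambda>x. \<psi> x (s x))"
  shows "holo_section \<B> H V s"
  unfolding holo_section_def
proof (intro conjI ballI)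
  fix y assume y: "y \<in> trivs H"
  obtain W' \<psi>' where y': "y = (W', \<psi>')" by (cases y)
  have tr': "(W', \<psi>') \<in> trivs H" using y y' by simp
  obtain g where g: "mholo \<B> (W \<inter> W') g" "\<And>x h. x \<in> W \<inter> W' \<Longrightarrow> h \<in> fibre H x \<Longrightarrow> \<psi>' x h = g x *v \<psi> x h"
    by (rule vector_bundle_transition[OF vb tr tr']) (rule that)
  have "mholo \<B> (V \<inter> W') (\<lambda>x. g x *v \<psi> x (s x))"
    by (rule mholo_matrix_vector_mult) (use V in \<open>auto intro: mholo_subset[OF g(1)] mholo_subset[OF h]\<close>)
  then have "mholo \<B> (V \<inter> W') (\<lambda>x. \<psi>' x (s x))"
    by (rule mholo_cong[OF M open_Int[OF V(1) vector_bundleD(2)[OF vb tr']]]) (use g(2) s V(2) in auto)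
  then show "case y of (W', \<psi>) \<Rightarrow> mholo \<B> (V \<inter> W') (\<lambda>x. \<psi> x (s x))" by (simp add: y')
qed (rule s)

lemma finite_common_nhd:
  fixes P :: "'i::finite \<Rightarrow> 'a::topological_space set \<Rightarrow> bool"
  assumes "\<And>i. \<exists>W. open W \<and> p \<in> W \<and> P i W"
    and mono: "\<And>i W W'. P i W \<Longrightarrow> W' \<subseteq> W \<Longrightarrow> P i W'"
  obtains W where "open W" "p \<in> W" "\<And>i. P i W"
proof -
  obtain f where f: "\<And>i. open (f i) \<and> p \<in> f i \<and> P i (f i)" using assms(1) by metis
  show thesis
  proof (rule that[of "\<Inter>i. f i"])
    show "open (\<Inter>i. f i)" using f by (intro open_INT) auto
    show "P i (\<Inter>i. f i)" for i by (rule mono[of i "f i"]) (use f in auto)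
  qed (use f in blast)
qed

text \<open>The local frame \<open>e\<close> of a trivialisation consists of holomorphic sections,
  so it is expressed through \<open>v\<close> with holomorphic coefficients. They form a right
  inverse of the matrix of \<open>v\<close> in the trivialisation; as both matrices are square,
  \<open>v\<close> is a basis of every nearby fibre.\<close>

lemma stalk_basis_frame:
  fixes \<B> :: "('b::t2_space, 'e::complex_normed_vector) chart set"
    and H :: "('b, 'v::complex_vector, 'r::finite) vector_bundle"
  assumes M: "complex_manifold \<B>" and vb: "holo_vector_bundle \<B> H" and sb: "stalk_basis \<B> H p v"
  obtains W co where "open W" "p \<in> W" "holo_frame \<B> H W v co"
proof -
  have "\<exists>y\<in>trivs H. p \<in> fst y"
    using vb by (simp add: holo_vector_bundle_def case_prod_unfold)
  then obtain W0 \<psi> where tr: "(W0, \<psi>) \<in> trivs H" and p: "p \<in> W0"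
    by (metis prod.collapse)
  note W0 = vector_bundleD(2)[OF vb tr]
  note \<psi>_bij = vector_bundleD(3)[OF vb tr]
  note \<psi>_lin = vector_bundleD(4)[OF vb tr]
  note sub = vector_bundleD(1)[OF vb]
  define e where "e = (\<lambda>i x. inv_into (fibre H x) (\<psi> x) (axis i 1))"
  have e: "e i x \<in> fibre H x" "\<psi> x (e i x) = axis i 1" if "x \<in> W0" for i x
  proof -
    have "axis i 1 \<in> \<psi> x ` fibre H x" using \<psi>_bij[OF that] by (simp add: bij_betw_def)
    then show "e i x \<in> fibre H x" "\<psi> x (e i x) = axis i 1"
      unfolding e_def by (rule inv_into_into, rule f_inv_into_f)
  qed
  have "holo_section \<B> H W0 (e i)" for i
  proof (rule holo_section_by_triv[OF M vb tr W0 subset_refl e(1)])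
    show "mholo \<B> W0 (\<lambda>x. \<psi> x (e i x))"
      by (rule mholo_cong[OF M W0 mholo_const[of _ _ "axis i 1"]]) (simp add: e(2))
  qed
  then have "section_germ \<B> H p (e i)" for i
    unfolding section_germ_def using W0 p by blast
  then have "\<exists>f. (\<forall>j. holo_germ \<B> p (f j)) \<and> (\<forall>\<^sub>F x in nhds p. e i x = (\<Sum>j\<in>UNIV. scaleC (f j x) (v j x)))" for i
    using sb unfolding stalk_basis_def by blast
  then have "\<forall>i. \<exists>f. (\<forall>j. holo_germ \<B> p (f j)) \<and> (\<forall>\<^sub>F x in nhds p. e i x = (\<Sum>j\<in>UNIV. scaleC (f j x) (v j x)))"
    by (rule allI)
  from choice[OF this] obtain f where f0: "\<forall>i. (\<forall>j. holo_germ \<B> p (f i j)) \<and>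
      (\<forall>\<^sub>F x in nhds p. e i x = (\<Sum>j\<in>UNIV. scaleC (f i j x) (v j x)))"
    by (elim exE)
  have f: "holo_germ \<B> p (f i j)" "\<forall>\<^sub>F x in nhds p. e i x = (\<Sum>j\<in>UNIV. scaleC (f i j x) (v j x))" for i j
    using spec[OF f0, of i] by simp_all
  obtain W1 where W1: "open W1" "p \<in> W1" "\<And>ij. case ij of (i, j) \<Rightarrow> mholo \<B> W1 (f i j)"
  proof (rule finite_common_nhd[where P = "\<lambda>ij W. case ij of (i, j) \<Rightarrow> mholo \<B> W (f i j)" and p = p])
    show "\<exists>W. open W \<and> p \<in> W \<and> (case ij of (i, j) \<Rightarrow> mholo \<B> W (f i j))" for ij
      using f(1) by (simp add: holo_germ_def case_prod_unfold)
    show "case ij of (i, j) \<Rightarrow> mholo \<B> W' (f i j)"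
      if "case ij of (i, j) \<Rightarrow> mholo \<B> W (f i j)" "W' \<subseteq> W" for ij W W'
      using mholo_subset[OF _ that(2)] that(1) by (simp add: case_prod_unfold)
  qed (rule that)
  obtain W2 where W2: "open W2" "p \<in> W2" "\<And>j. holo_section \<B> H W2 (v j)"
  proof (rule finite_common_nhd[where P = "\<lambda>j W. holo_section \<B> H W (v j)" and p = p])
    show "\<exists>W. open W \<and> p \<in> W \<and> holo_section \<B> H W (v j)" for j
      using sb by (simp add: stalk_basis_def section_germ_def)
    show "holo_section \<B> H W' (v j)" if "holo_section \<B> H W (v j)" "W' \<subseteq> W" for j W W'
      by (rule holo_section_subset[OF that])
  qed (rule that)
  have "\<forall>\<^sub>F x in nhds p. \<forall>i. e i x = (\<Sum>j\<in>UNIV. scaleC (f i j x) (v j x))"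
    by (rule eventually_all_finite) (rule f(2))
  then obtain W3 where W3: "open W3" "p \<in> W3"
    "\<And>x i. x \<in> W3 \<Longrightarrow> e i x = (\<Sum>j\<in>UNIV. scaleC (f i j x) (v j x))"
    unfolding eventually_nhds by blast
  define W where "W = W0 \<inter> W1 \<inter> W2 \<inter> W3"
  have W: "open W" "p \<in> W" using W0 p W1 W2 W3 by (auto simp: W_def)
  \<comment> \<open>The columns of \<open>N\<close> are the coordinates of \<open>e\<close> with
    respect to \<open>v\<close>, those of \<open>K\<close> the coordinates of \<open>v\<close> in
    the trivialisation.\<close>
  define N where "N = (\<lambda>x. (\<chi> j i. f i j x) :: complex ^ 'r ^ 'r)"
  define K where "K = (\<lambda>x. (\<chi> a j. \<psi> x (v j x) $ a) :: complex ^ 'r ^ 'r)"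
  define co where "co = (\<lambda>x h. N x *v \<psi> x h)"
  have v: "v j x \<in> fibre H x" if "x \<in> W" for j x
    using holo_sectionD(1)[OF W2(3)] that by (simp add: W_def)
  have \<psi>_sum: "\<psi> x (\<Sum>j\<in>UNIV. scaleC (a $ j) (v j x)) = K x *v a" if "x \<in> W" for x a
  proof -
    have "x \<in> W0" using that by (simp add: W_def)
    have "\<psi> x (\<Sum>j\<in>UNIV. scaleC (a $ j) (v j x)) = (\<Sum>j\<in>UNIV. scaleC (a $ j) (\<psi> x (v j x)))"
      by (rule clinear_on_sum[OF sub \<psi>_lin[OF \<open>x \<in> W0\<close>] v[OF that]])
    then show ?thesis
      by (simp add: vec_eq_iff K_def matrix_vector_mult_def scaleC_vec_def scaleC_complex_def mult.commute)
  qed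
  have KN: "K x ** N x = mat 1" if x: "x \<in> W" for x
  proof -
    have "K x *v (\<chi> j. f i j x) = axis i 1" for i
    proof -
      have "e i x = (\<Sum>j\<in>UNIV. scaleC ((\<chi> j. f i j x) $ j) (v j x))" using W3(3) x by (simp add: W_def)
      then show ?thesis using \<psi>_sum[OF x, of "\<chi> j. f i j x"] e(2)[of x i] x by (simp add: W_def)
    qed
    then have "(K x *v (\<chi> j. f i j x)) $ a = axis i 1 $ a" for i a by simp
    then show ?thesis
      by (simp add: vec_eq_iff matrix_matrix_mult_def matrix_vector_mult_def N_def mat_def axis_def)
  qed
  then have NK: "N x ** K x = mat 1" if "x \<in> W" for x
    using that matrix_left_right_inverse by blast
  have N_inv: "N x *v (K x *v a) = a" "K x *v (N x *v a) = a" if "x \<in> W" for x a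
    using NK[OF that] KN[OF that] by (simp_all add: matrix_vector_mul_assoc)
  have N_holo: "mholo \<B> V N" if "V \<subseteq> W" for V
  proof -
    have "mholo \<B> V (f i j)" for i j
      using W1(3)[of "(i, j)"] that by (auto simp: W_def elim!: mholo_subset)
    then show ?thesis by (simp add: mholo_vec_iff N_def)
  qed
  have K_holo: "mholo \<B> V K" if "V \<subseteq> W" for V
  proof -
    have "mholo \<B> V (\<lambda>x. \<psi> x (v j x))" for j
      by (rule mholo_subset[OF holo_sectionD(2)[OF W2(3) tr]]) (use that in \<open>auto simp: W_def\<close>)
    then have "mholo \<B> V (\<lambda>x. \<psi> x (v j x) $ a)" for a j by (simp add: mholo_vec_iff)
    then show ?thesis by (simp add: mholo_vec_iff K_def)
  qed
  have "holo_frame \<B> H W v co"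
    unfolding holo_frame_def
  proof (intro conjI ballI allI impI)
    fix x assume x: "x \<in> W"
    then have x0: "x \<in> W0" by (simp add: W_def)
    show "v j x \<in> fibre H x" for j by (rule v[OF x])
    have "bij_betw ((*v) (N x)) UNIV UNIV"
      by (rule bij_betw_byWitness[where f' = "(*v) (K x)"]) (use N_inv[OF x] in auto)
    from bij_betw_trans[OF \<psi>_bij[OF x0] this]
    show "bij_betw (co x) (fibre H x) UNIV" by (simp add: co_def comp_def)
    show "clinear_on (fibre H x) (co x)"
      using \<psi>_lin[OF x0]
      by (simp add: clinear_on_def co_def matrix_vector_right_distrib matrix_vector_mult_scaleC)
    fix h assume h: "h \<in> fibre H x"
    have "\<psi> x (\<Sum>j\<in>UNIV. scaleC (co x h $ j) (v j x)) = \<psi> x h"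
      by (simp add: \<psi>_sum[OF x] co_def N_inv[OF x])
    moreover have "(\<Sum>j\<in>UNIV. scaleC (co x h $ j) (v j x)) \<in> fibre H x"
      by (rule csubspace_sum[OF sub v[OF x]])
    ultimately show "(\<Sum>j\<in>UNIV. scaleC (co x h $ j) (v j x)) = h"
      using \<psi>_bij[OF x0] h unfolding bij_betw_def inj_on_def by blast
  next
    fix V s assume "open V \<and> V \<subseteq> W \<and> (\<forall>x\<in>V. s x \<in> fibre H x)"
    then have V: "open V" "V \<subseteq> W" and s: "\<And>x. x \<in> V \<Longrightarrow> s x \<in> fibre H x" by auto
    have VW0: "V \<subseteq> W0" using V by (auto simp: W_def)
    show "holo_section \<B> H V s \<longleftrightarrow> mholo \<B> V (\<lambda>x. co x (s x))"
    proof
      assume "holo_section \<B> H V s"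
      from holo_sectionD(2)[OF this tr] have "mholo \<B> V (\<lambda>x. \<psi> x (s x))"
        using VW0 by (simp add: Int_absorb2)
      then show "mholo \<B> V (\<lambda>x. co x (s x))"
        unfolding co_def by (rule mholo_matrix_vector_mult[OF N_holo[OF V(2)]])
    next
      assume "mholo \<B> V (\<lambda>x. co x (s x))"
      from mholo_matrix_vector_mult[OF K_holo[OF V(2)] this]
      have h: "mholo \<B> V (\<lambda>x. \<psi> x (s x))"
        by (rule mholo_cong[OF M V(1)]) (use V(2) in \<open>auto simp: co_def N_inv\<close>)
      show "holo_section \<B> H V s" by (rule holo_section_by_triv[OF M vb tr V(1) VW0]) (erule s, rule h)
    qed
  qed
  with W that show thesis by blast
qed

section \<open>Covariant derivatives in a frame\<close>

text \<open>The induction starts at a singleton, so that \<open>additive\<close> suffices. That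
  axiom is applied to partial sums, hence the assumption on every index set
  \<open>J\<close>.\<close>

lemma T_structure_sum:
  assumes T: "T_structure \<A> H nabla" and V: "open V"
    and s: "\<And>J. holo_section (cyl \<A>) H V (\<lambda>x. \<Sum>i\<in>J. s i x)" and ne: "finite I" "I \<noteq> {}"
    and zt: "(z, t) \<in> V" "z \<noteq> 0" and D: "D \<in> tangent_space \<A> t"
  shows "nabla (\<lambda>x. \<Sum>i\<in>I. s i x) (z, t) D = (\<Sum>i\<in>I. nabla (s i) (z, t) D)"
  using ne
proof (induction I rule: finite_ne_induct)
  case (insert i I)
  have "holo_section (cyl \<A>) H V (s i)" using s[of "{i}"] by simp
  from T_structure.additive[OF T V this s[of I] zt D] insert show ?case by simp
qed simp

lemma T_structure_coords:
  fixes \<A> :: "('m::t2_space, complex ^ 'n) chart set"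
  assumes T: "T_structure \<A> H nabla" and V: "open V" and s: "holo_section (cyl \<A>) H V s"
    and zt: "(z, t) \<in> V" "z \<noteq> 0" and c: "c \<in> \<A>" "t \<in> fst c" and ne: "finite I" "I \<noteq> {}"
  shows "nabla s (z, t) (\<lambda>f. \<Sum>i\<in>I. w i * coord_field \<A> c i t f)
    = (\<Sum>i\<in>I. scaleC (w i) (nabla s (z, t) (coord_field \<A> c i t)))"
  using ne
proof (induction I rule: finite_ne_induct)
  case (singleton i)
  then show ?case
    using T_structure.form_scale[OF T V s zt coord_field_in_tangent_space[OF c]] by simp
next
  case (insert i I)
  note M = T_structure.manifold[OF T]
  have 1: "(\<lambda>f. w i * coord_field \<A> c i t f) \<in> tangent_space \<A> t"
    using coord_sum_in_tangent_space[OF M c, where I = "{i}" and w = w] by simp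
  have "nabla s (z, t) (\<lambda>f. w i * coord_field \<A> c i t f + (\<Sum>i\<in>I. w i * coord_field \<A> c i t f))
      = nabla s (z, t) (\<lambda>f. w i * coord_field \<A> c i t f) + nabla s (z, t) (\<lambda>f. \<Sum>i\<in>I. w i * coord_field \<A> c i t f)"
    by (rule T_structure.form_add[OF T V s zt 1 coord_sum_in_tangent_space[OF M c]])
  also have "nabla s (z, t) (\<lambda>f. w i * coord_field \<A> c i t f) = scaleC (w i) (nabla s (z, t) (coord_field \<A> c i t))"
    by (rule T_structure.form_scale[OF T V s zt coord_field_in_tangent_space[OF c]])
  finally show ?case using insert by simp
qed

text \<open>The Leibniz rule for the expansion of \<open>s\<close> in the frame: on coordinate
  columns the connection acts as the coordinate derivative plus \<open>inverse z\<close> times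
  \<open>N\<close>, where \<open>N\<close> is the connection matrix at the single point
  \<open>(z, t)\<close>.\<close>

lemma cov_frame:
  fixes \<A> :: "('m::t2_space, complex ^ 'n) chart set"
  assumes T: "T_structure \<A> H nabla" and c: "c \<in> \<A>" and fr: "holo_frame (cyl \<A>) H W v co"
    and V: "open V" "V \<subseteq> W" "V \<subseteq> UNIV \<times> fst c" and s: "holo_section (cyl \<A>) H V s"
    and zt: "(z, t) \<in> V" "z \<noteq> 0"
    and conn: "\<And>j. cov nabla (coord_field \<A> c i) (v j) (z, t)
        = (\<Sum>k\<in>UNIV. scaleC (inverse z * N $ k $ j) (v k (z, t)))"
  shows "cov nabla (coord_field \<A> c i) s (z, t)
    = (\<Sum>k\<in>UNIV. scaleC (coord_field \<A> c i t (\<lambda>\<tau>. co (z, \<tau>) (s (z, \<tau>)) $ k)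
        + inverse z * (N *v co (z, t) (s (z, t))) $ k) (v k (z, t)))"
proof -
  note M = T_structure.manifold[OF T]
  note MC = complex_manifold_cyl[OF M]
  note vb = T_structure.vbundle[OF T]
  define f where "f = (\<lambda>j x. co x (s x) $ j)"
  have tc: "t \<in> fst c" using zt V by auto
  have sfib: "s x \<in> fibre H x" if "x \<in> V" for x by (rule holo_sectionD(1)[OF s that])
  have "mholo (cyl \<A>) V (\<lambda>x. co x (s x))"
    using holo_frame_section_iff[OF fr V(1,2) sfib] s by blast
  then have f: "mholo (cyl \<A>) V (f j)" for j by (simp add: f_def mholo_vec_iff)
  have v: "holo_section (cyl \<A>) H V (v j)" for j
  proof -
    have vfib: "v j x \<in> fibre H x" if "x \<in> V" for x
      using holo_frameD(1)[OF fr] that V(2) by blast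
    have "co x (v j x) = axis j 1" if "x \<in> V" for x
    proof -
      have "(\<Sum>k\<in>UNIV. scaleC (axis j 1 $ k) (v k x)) = (\<Sum>k\<in>UNIV. if k = j then v j x else 0)"
        by (intro sum.cong) (auto simp: axis_def)
      then show ?thesis using holo_frame_coords[OF fr, of x "axis j 1"] that V(2) by auto
    qed
    then have "mholo (cyl \<A>) V (\<lambda>x. co x (v j x))"
      by (intro mholo_cong[OF MC V(1) mholo_const[of _ _ "axis j 1"]]) simp
    then show ?thesis using holo_frame_section_iff[OF fr V(1,2) vfib] by blast
  qed
  have fv: "holo_section (cyl \<A>) H V (\<lambda>x. \<Sum>j\<in>J. scaleC (f j x) (v j x))" for J
  proof -
    have fib: "(\<Sum>j\<in>J. scaleC (f j x) (v j x)) \<in> fibre H x" if "x \<in> V" for x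
      by (rule csubspace_sum[OF vector_bundleD(1)[OF vb] holo_sectionD(1)[OF v that]])
    have "mholo (cyl \<A>) V (\<lambda>x. if k \<in> J then f k x else 0)" for k
      by (cases "k \<in> J") (simp_all add: f mholo_const)
    then have "mholo (cyl \<A>) V (\<lambda>x. \<chi> k. if k \<in> J then f k x else 0)" by (simp add: mholo_vec_iff)
    then have "mholo (cyl \<A>) V (\<lambda>x. co x (\<Sum>j\<in>J. scaleC (f j x) (v j x)))"
    proof (rule mholo_cong[OF MC V(1)])
      fix x assume "x \<in> V"
      then have "x \<in> W" using V(2) by blast
      have "(\<Sum>j\<in>J. scaleC (f j x) (v j x)) = (\<Sum>j\<in>UNIV. scaleC ((\<chi> k. if k \<in> J then f k x else 0) $ j) (v j x))"
        by (intro sum.mono_neutral_cong_left) auto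
      then show "(\<chi> k. if k \<in> J then f k x else 0) = co x (\<Sum>j\<in>J. scaleC (f j x) (v j x))"
        by (simp only: holo_frame_coords[OF fr \<open>x \<in> W\<close>])
    qed
    then show ?thesis using holo_frame_section_iff[OF fr V(1,2) fib] by blast
  qed
  have D: "coord_field \<A> c i t \<in> tangent_space \<A> t" by (rule coord_field_in_tangent_space[OF c tc])
  \<comment> \<open>The expansion agrees with \<open>s\<close> on \<open>V\<close> only, so
    \<open>locality\<close> is needed to exchange them.\<close>
  have "cov nabla (coord_field \<A> c i) s (z, t) = nabla (\<lambda>x. \<Sum>j\<in>UNIV. scaleC (f j x) (v j x)) (z, t) (coord_field \<A> c i t)"
    unfolding cov_def snd_conv
  proof (rule T_structure.locality[OF T V(1) s _ _ zt D])
    show "holo_section (cyl \<A>) H V (\<lambda>x. \<Sum>j\<in>UNIV. scaleC (f j x) (v j x))" by (rule fv)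
    show "s x = (\<Sum>j\<in>UNIV. scaleC (f j x) (v j x))" if "x \<in> V" for x
      using holo_frameD(4)[OF fr _ sfib[OF that]] that V(2) by (auto simp: f_def)
  qed
  also have "\<dots> = (\<Sum>j\<in>UNIV. nabla (\<lambda>x. scaleC (f j x) (v j x)) (z, t) (coord_field \<A> c i t))"
    by (rule T_structure_sum[OF T V(1) fv _ _ zt D]) auto
  also have "\<dots> = (\<Sum>j\<in>UNIV. scaleC (coord_field \<A> c i t (\<lambda>\<tau>. f j (z, \<tau>))) (v j (z, t))
      + (\<Sum>k\<in>UNIV. scaleC (inverse z * (N $ k $ j * f j (z, t))) (v k (z, t))))"
  proof (rule sum.cong[OF refl])
    fix j
    have "nabla (\<lambda>x. scaleC (f j x) (v j x)) (z, t) (coord_field \<A> c i t)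
        = cov nabla (coord_field \<A> c i) (\<lambda>x. scaleC (f j x) (v j x)) (z, t)"
      by (simp add: cov_def)
    also have "\<dots> = scaleC (coord_field \<A> c i t (\<lambda>\<tau>. f j (z, \<tau>))) (v j (z, t))
        + scaleC (f j (z, t)) (cov nabla (coord_field \<A> c i) (v j) (z, t))"
      by (rule T_structure.leibniz[OF T manifold_chart(1)[OF M c] holo_vector_field_coord_field[OF c] V(1,3) v f zt])
    also have "scaleC (f j (z, t)) (cov nabla (coord_field \<A> c i) (v j) (z, t))
        = (\<Sum>k\<in>UNIV. scaleC (inverse z * (N $ k $ j * f j (z, t))) (v k (z, t)))"
      by (simp add: conn scaleC_sum_right scaleC_scaleC mult_ac)
    finally show "nabla (\<lambda>x. scaleC (f j x) (v j x)) (z, t) (coord_field \<A> c i t)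
        = scaleC (coord_field \<A> c i t (\<lambda>\<tau>. f j (z, \<tau>))) (v j (z, t))
          + (\<Sum>k\<in>UNIV. scaleC (inverse z * (N $ k $ j * f j (z, t))) (v k (z, t)))" .
  qed
  also have "\<dots> = (\<Sum>k\<in>UNIV. scaleC (coord_field \<A> c i t (\<lambda>\<tau>. f k (z, \<tau>))) (v k (z, t)))
      + (\<Sum>k\<in>UNIV. \<Sum>j\<in>UNIV. scaleC (inverse z * (N $ k $ j * f j (z, t))) (v k (z, t)))"
    unfolding sum.distrib by (rule arg_cong2[where f = "(+)", OF refl sum.swap])
  also have "\<dots> = (\<Sum>k\<in>UNIV. scaleC (coord_field \<A> c i t (\<lambda>\<tau>. f k (z, \<tau>))
      + inverse z * (\<Sum>j\<in>UNIV. N $ k $ j * f j (z, t))) (v k (z, t)))"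
    by (simp add: scaleC_add_left sum.distrib sum_distrib_left scaleC_sum_left)
  finally show ?thesis by (simp add: f_def matrix_vector_mult_def)
qed

section \<open>The isomorphism of (T)-structures\<close>

lemma matrix_diff_distrib:
  fixes A B :: "'a::ring_1 ^ 'n ^ 'm" and C :: "'a ^ 'k ^ 'n" and D :: "'a ^ 'm ^ 'l"
  shows "(A - B) ** C = A ** C - B ** C" and "D ** (A - B) = D ** A - D ** B"
  by (simp_all add: matrix_matrix_mult_def vec_eq_iff left_diff_distrib right_diff_distrib sum_subtractf)

text \<open>Differentiating \<open>F G = 1\<close> gives \<open>dG = - G dF G\<close>. Inserting
  \<open>z dF = F A' - A F\<close> and cancelling with \<open>G F = 1\<close> leaves
  \<open>z dG = G A - A' G\<close>. Everything stays multiplied by \<open>z\<close>, so no division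
  is involved.\<close>

lemma inverse_gauge_equation:
  fixes F G A A' dF dG :: "complex ^ 'r ^ 'r"
  assumes FG: "F ** G = mat 1" and GF: "G ** F = mat 1"
    and pde: "\<And>a b. z * dF $ a $ b + (A ** F) $ a $ b - (F ** A') $ a $ b = 0"
    and prod: "\<And>a b. (dF ** G) $ a $ b + (F ** dG) $ a $ b = 0"
  shows "z * dG $ a $ b = (G ** A) $ a $ b - (A' ** G) $ a $ b"
proof -
  define zF zG where "zF = (\<chi> a b. z * dF $ a $ b)" and "zG = (\<chi> a b. z * dG $ a $ b)"
  have zF: "zF = F ** A' - A ** F"
    using pde by (simp add: vec_eq_iff zF_def add_diff_eq[symmetric] eq_neg_iff_add_eq_0[symmetric])
  have "zF ** G + F ** zG = 0"
  proof -
    have "(zF ** G + F ** zG) $ a $ b = z * ((dF ** G) $ a $ b + (F ** dG) $ a $ b)" for a b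
      by (simp add: zF_def zG_def matrix_matrix_mult_def sum_distrib_left distrib_left mult_ac)
    then show ?thesis by (simp add: vec_eq_iff prod)
  qed
  then have "F ** zG = - (zF ** G)" by (simp add: eq_neg_iff_add_eq_0 add.commute)
  also have "\<dots> = A ** (F ** G) - F ** (A' ** G)"
    by (simp add: zF matrix_diff_distrib matrix_mul_assoc)
  finally have "G ** (F ** zG) = G ** (A - F ** (A' ** G))" by (simp add: FG)
  then have "zG = G ** A - A' ** G"
    by (simp add: matrix_diff_distrib matrix_mul_assoc GF)
  then show ?thesis by (simp add: vec_eq_iff zG_def)
qed

lemma coord_field_sum_mult:
  fixes \<A> :: "('m::t2_space, complex ^ 'n) chart set"
  assumes M: "complex_manifold \<A>" "c \<in> \<A>" "t \<in> fst c"
    and g: "\<And>m. holo_germ \<A> t (g m)" and f: "\<And>m. holo_germ \<A> t (f m)"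
  shows "coord_field \<A> c i t (\<lambda>\<tau>. \<Sum>m\<in>(UNIV::'r::finite set). g m \<tau> * f m \<tau>)
    = (\<Sum>m\<in>UNIV. g m t * coord_field \<A> c i t (f m)) + (\<Sum>m\<in>UNIV. coord_field \<A> c i t (g m) * f m t)"
  unfolding coord_field_def
  by (subst dirderiv_sum[OF M]) (simp_all add: holo_germ_mult g f dirderiv_mult[OF M] sum.distrib)

lemma eventually_slice:
  assumes "open W" "(z, t) \<in> W"
  shows "\<forall>\<^sub>F \<tau> in nhds t. (z, \<tau>) \<in> W"
proof -
  obtain P Q where PQ: "open P" "open Q" "(z, t) \<in> P \<times> Q" "P \<times> Q \<subseteq> W"
    using open_prod_elim[OF assms] by blast
  have "\<forall>\<^sub>F \<tau> in nhds t. \<tau> \<in> Q" by (rule eventually_nhds_in_open[OF PQ(2)]) (use PQ(3) in simp)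
  then show ?thesis by eventually_elim (use PQ(3,4) in blast)
qed

lemma mholo_slice_germ:
  assumes "complex_manifold \<A>" "open W" "(z, t) \<in> W" "mholo (cyl \<A>) W f"
  shows "holo_germ \<A> t (\<lambda>\<tau>. f (z, \<tau>))"
  by (rule holo_germ_cyl_slice[OF assms(1)]) (use assms(2-4) in \<open>auto simp: holo_germ_def\<close>)

text \<open>The isomorphism sends the row \<open>v \<cdot> F\<close> to \<open>v'\<close>, so on coordinate columns it is multiplication
  by \<open>F\<^sup>-\<^sup>1\<close>.\<close>

lemma gauge_isomorphism:
  fixes \<A> :: "('m::t2_space, complex ^ 'n) chart set"
    and H :: "(complex \<times> 'm, 'v::complex_vector, 'r::finite) vector_bundle"
    and H' :: "(complex \<times> 'm, 'w::complex_vector, 'r) vector_bundle"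
  assumes T: "T_structure \<A> H nabla" and T': "T_structure \<A> H' nabla'" and c: "c \<in> \<A>"
    and W: "open W" "p \<in> W" "W \<subseteq> UNIV \<times> fst c"
    and fr: "holo_frame (cyl \<A>) H W v co" and fr': "holo_frame (cyl \<A>) H' W v' co'"
    and F: "mholo (cyl \<A>) W F" and G: "mholo (cyl \<A>) W G"
    and inv: "\<And>x. x \<in> W \<Longrightarrow> F x ** G x = mat 1" "\<And>x. x \<in> W \<Longrightarrow> G x ** F x = mat 1"
    and conn: "\<And>x i j. x \<in> W \<Longrightarrow> fst x \<noteq> 0 \<Longrightarrow> cov nabla (coord_field \<A> c i) (v j) x
        = (\<Sum>k\<in>UNIV. scaleC (inverse (fst x) * A i x $ k $ j) (v k x))"
    and conn': "\<And>x i j. x \<in> W \<Longrightarrow> fst x \<noteq> 0 \<Longrightarrow> cov nabla' (coord_field \<A> c i) (v' j) x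
        = (\<Sum>k\<in>UNIV. scaleC (inverse (fst x) * A' i x $ k $ j) (v' k x))"
    and pde: "\<And>x i a b. x \<in> W \<Longrightarrow> fst x * coord_field \<A> c i (snd x) (\<lambda>\<tau>. F (fst x, \<tau>) $ a $ b)
        + (A i x ** F x) $ a $ b - (F x ** A' i x) $ a $ b = 0"
  shows "T_germs_isomorphic \<A> H nabla H' nabla' p"
proof -
  note M = T_structure.manifold[OF T]
  note MC = complex_manifold_cyl[OF M]
  note sub = vector_bundleD(1)[OF T_structure.vbundle[OF T]]
  note sub' = vector_bundleD(1)[OF T_structure.vbundle[OF T']]
  define \<Phi> where "\<Phi> = (\<lambda>x h. \<Sum>k\<in>UNIV. scaleC ((G x *v co x h) $ k) (v' k x))"
  have v'fib: "v' k x \<in> fibre H' x" and vfib: "v k x \<in> fibre H x" if "x \<in> W" for k x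
    using holo_frameD(1)[OF fr' that] holo_frameD(1)[OF fr that] by auto
  have \<Phi>_fib: "\<Phi> x h \<in> fibre H' x" if "x \<in> W" for x h
    unfolding \<Phi>_def by (rule csubspace_sum[OF sub' v'fib[OF that]])
  have co'\<Phi>: "co' x (\<Phi> x h) = G x *v co x h" if "x \<in> W" for x h
    unfolding \<Phi>_def by (rule holo_frame_coords[OF fr' that])
  have FGv: "F x *v (G x *v a) = a" "G x *v (F x *v a) = a" if "x \<in> W" for x a
    using inv[OF that] by (simp_all add: matrix_vector_mul_assoc)
  have \<Phi>_lin: "clinear_on (fibre H x) (\<Phi> x)" if "x \<in> W" for x
    using holo_frameD(3)[OF fr that]
    by (simp add: clinear_on_def \<Phi>_def matrix_vector_right_distrib matrix_vector_mult_scaleC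
        scaleC_add_left sum.distrib scaleC_sum_right scaleC_scaleC)
      (simp add: scaleC_vec_def scaleC_complex_def)
  have \<Phi>_bij: "bij_betw (\<Phi> x) (fibre H x) (fibre H' x)" if x: "x \<in> W" for x
    unfolding bij_betw_def
  proof
    show "inj_on (\<Phi> x) (fibre H x)"
    proof (rule inj_onI)
      fix h h' assume h: "h \<in> fibre H x" "h' \<in> fibre H x" and "\<Phi> x h = \<Phi> x h'"
      then have "F x *v (G x *v co x h) = F x *v (G x *v co x h')" using co'\<Phi>[OF x] by metis
      then have eq: "co x h = co x h'" by (simp add: FGv[OF x])
      have "h = (\<Sum>k\<in>UNIV. scaleC (co x h $ k) (v k x))" by (rule holo_frameD(4)[OF fr x h(1), symmetric])
      also have "\<dots> = (\<Sum>k\<in>UNIV. scaleC (co x h' $ k) (v k x))" by (simp only: eq)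
      also have "\<dots> = h'" by (rule holo_frameD(4)[OF fr x h(2)])
      finally show "h = h'" .
    qed
    show "\<Phi> x ` fibre H x = fibre H' x"
    proof
      show "\<Phi> x ` fibre H x \<subseteq> fibre H' x" using \<Phi>_fib[OF x] by blast
      show "fibre H' x \<subseteq> \<Phi> x ` fibre H x"
      proof
        fix h' assume h': "h' \<in> fibre H' x"
        define h where "h = (\<Sum>k\<in>UNIV. scaleC ((F x *v co' x h') $ k) (v k x))"
        have "h \<in> fibre H x" unfolding h_def by (rule csubspace_sum[OF sub vfib[OF x]])
        moreover have "co x h = F x *v co' x h'" unfolding h_def by (rule holo_frame_coords[OF fr x])
        then have "\<Phi> x h = h'" using holo_frameD(4)[OF fr' x h'] by (simp add: \<Phi>_def FGv[OF x])
        ultimately show "h' \<in> \<Phi> x ` fibre H x" by blast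
      qed
    qed
  qed
  have sec: "holo_section (cyl \<A>) H V s \<longleftrightarrow> holo_section (cyl \<A>) H' V (\<lambda>x. \<Phi> x (s x))"
    if V: "open V" "V \<subseteq> W" and s: "\<And>x. x \<in> V \<Longrightarrow> s x \<in> fibre H x" for V s
  proof -
    have s': "\<Phi> x (s x) \<in> fibre H' x" if "x \<in> V" for x using \<Phi>_fib that V(2) by blast
    have "holo_section (cyl \<A>) H V s \<longleftrightarrow> mholo (cyl \<A>) V (\<lambda>x. co x (s x))"
      by (rule holo_frame_section_iff[OF fr V s])
    also have "\<dots> \<longleftrightarrow> mholo (cyl \<A>) V (\<lambda>x. co' x (\<Phi> x (s x)))"
    proof
      assume "mholo (cyl \<A>) V (\<lambda>x. co x (s x))"
      from mholo_matrix_vector_mult[OF mholo_subset[OF G V(2)] this]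
      show "mholo (cyl \<A>) V (\<lambda>x. co' x (\<Phi> x (s x)))"
        by (rule mholo_cong[OF MC V(1)]) (use co'\<Phi> V(2) in auto)
    next
      assume "mholo (cyl \<A>) V (\<lambda>x. co' x (\<Phi> x (s x)))"
      from mholo_matrix_vector_mult[OF mholo_subset[OF F V(2)] this]
      show "mholo (cyl \<A>) V (\<lambda>x. co x (s x))"
        by (rule mholo_cong[OF MC V(1)]) (use co'\<Phi> FGv V(2) in auto)
    qed
    also have "\<dots> \<longleftrightarrow> holo_section (cyl \<A>) H' V (\<lambda>x. \<Phi> x (s x))"
      by (rule holo_frame_section_iff[OF fr' V s', symmetric])
    finally show ?thesis .
  qed
  \<comment> \<open>Both sides are compared in the frame \<open>v'\<close>. For a coordinate column
    \<open>f\<close> the claim reads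
    \<open>G (\<partial>f + A f / z) = \<partial>(G f) + A' G f / z\<close>, which is the product
    rule combined with the equation for the derivative of \<open>G\<close>.\<close>
  have flat_coord: "\<Phi> (z, t) (nabla s (z, t) (coord_field \<A> c i t))
      = nabla' (\<lambda>x. \<Phi> x (s x)) (z, t) (coord_field \<A> c i t)"
    if V: "open V" "V \<subseteq> W" and s: "holo_section (cyl \<A>) H V s" and zt: "(z, t) \<in> V" "z \<noteq> 0" for V s z t i
  proof -
    define x where "x = (z, t)"
    have xW: "x \<in> W" and x: "fst x = z" "snd x = t" using zt V(2) by (auto simp: x_def)
    have tc: "t \<in> fst c" using xW W(3) by (auto simp: x_def)
    have VU: "V \<subseteq> UNIV \<times> fst c" using V W by blast
    have sfib: "s y \<in> fibre H y" if "y \<in> V" for y by (rule holo_sectionD(1)[OF s that])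
    have s': "holo_section (cyl \<A>) H' V (\<lambda>x. \<Phi> x (s x))" using sec[OF V sfib] s by blast
    define f where "f = (\<lambda>y. co y (s y))"
    have f: "mholo (cyl \<A>) V f"
      unfolding f_def using holo_frame_section_iff[OF fr V sfib] s by blast
    define a where "a = (\<lambda>m. coord_field \<A> c i t (\<lambda>\<tau>. f (z, \<tau>) $ m))"
    define dF where "dF = (\<chi> k m. coord_field \<A> c i t (\<lambda>\<tau>. F (z, \<tau>) $ k $ m))"
    define dG where "dG = (\<chi> k m. coord_field \<A> c i t (\<lambda>\<tau>. G (z, \<tau>) $ k $ m))"
    have fg: "holo_germ \<A> t (\<lambda>\<tau>. f (z, \<tau>) $ m)" for m
      by (rule holo_germ_nth[OF mholo_slice_germ[OF M V(1) zt(1) f]])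
    have Fg: "holo_germ \<A> t (\<lambda>\<tau>. F (z, \<tau>) $ k $ m)" for k m
      by (rule holo_germ_nth[OF holo_germ_nth[OF mholo_slice_germ[OF M W(1) xW[unfolded x_def] F]]])
    have Gg: "holo_germ \<A> t (\<lambda>\<tau>. G (z, \<tau>) $ k $ m)" for k m
      by (rule holo_germ_nth[OF holo_germ_nth[OF mholo_slice_germ[OF M W(1) xW[unfolded x_def] G]]])
    \<comment> \<open>The product of \<open>F\<close> and \<open>G\<close> is constant near the
      point, so its coordinate derivative vanishes.\<close>
    have prod: "(dF ** G x) $ k $ l + (F x ** dG) $ k $ l = 0" for k l
    proof -
      have "\<forall>\<^sub>F \<tau> in nhds t. (\<Sum>m\<in>UNIV. F (z, \<tau>) $ k $ m * G (z, \<tau>) $ m $ l) = mat 1 $ k $ l"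
        using eventually_slice[OF W(1) xW[unfolded x_def]]
      proof eventually_elim
        case (elim \<tau>)
        have "(F (z, \<tau>) ** G (z, \<tau>)) $ k $ l = mat 1 $ k $ l" by (simp only: inv(1)[OF elim])
        then show ?case by (simp add: matrix_matrix_mult_def)
      qed
      from dirderiv_cong[OF M c tc this]
      have "coord_field \<A> c i t (\<lambda>\<tau>. \<Sum>m\<in>UNIV. F (z, \<tau>) $ k $ m * G (z, \<tau>) $ m $ l) = 0"
        by (simp add: coord_field_def dirderiv_const)
      then show ?thesis
        unfolding coord_field_sum_mult[OF M c tc Fg Gg]
        by (simp add: matrix_matrix_mult_def dF_def dG_def x_def add.commute)
    qed
    have gauge: "z * dG $ k $ l = (G x ** A i x) $ k $ l - (A' i x ** G x) $ k $ l" for k l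
      by (rule inverse_gauge_equation[OF inv[OF xW] _ prod])
        (use pde[OF xW] in \<open>simp add: dF_def x\<close>)
    have nab: "nabla s x (coord_field \<A> c i t)
        = (\<Sum>k\<in>UNIV. scaleC ((\<chi> k. a k + inverse z * (A i x *v f x) $ k) $ k) (v k x))"
      using cov_frame[OF T c fr V VU s zt, of i "A i x"] conn[OF xW] zt(2)
      by (simp add: cov_def a_def f_def x_def)
    have nab': "nabla' (\<lambda>x. \<Phi> x (s x)) x (coord_field \<A> c i t)
        = (\<Sum>k\<in>UNIV. scaleC (coord_field \<A> c i t (\<lambda>\<tau>. co' (z, \<tau>) (\<Phi> (z, \<tau>) (s (z, \<tau>))) $ k)
            + inverse z * (A' i x *v (G x *v f x)) $ k) (v' k x))"
      using cov_frame[OF T' c fr' V VU s' zt, of i "A' i x"] conn'[OF xW] zt(2) co'\<Phi>[OF xW]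
      by (simp add: cov_def f_def x_def)
    have a': "coord_field \<A> c i t (\<lambda>\<tau>. co' (z, \<tau>) (\<Phi> (z, \<tau>) (s (z, \<tau>))) $ k)
        = (\<Sum>m\<in>UNIV. G x $ k $ m * a m) + (dG *v f x) $ k" for k
    proof -
      have "\<forall>\<^sub>F \<tau> in nhds t. co' (z, \<tau>) (\<Phi> (z, \<tau>) (s (z, \<tau>))) $ k = (\<Sum>m\<in>UNIV. G (z, \<tau>) $ k $ m * f (z, \<tau>) $ m)"
        using eventually_slice[OF V(1) zt(1)]
      proof eventually_elim
        case (elim \<tau>)
        then have "(z, \<tau>) \<in> W" using V(2) by blast
        then show ?case by (simp add: co'\<Phi> matrix_vector_mult_def f_def)
      qed
      from dirderiv_cong[OF M c tc this]
      have "coord_field \<A> c i t (\<lambda>\<tau>. co' (z, \<tau>) (\<Phi> (z, \<tau>) (s (z, \<tau>))) $ k)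
          = coord_field \<A> c i t (\<lambda>\<tau>. \<Sum>m\<in>UNIV. G (z, \<tau>) $ k $ m * f (z, \<tau>) $ m)"
        by (simp only: coord_field_def)
      also have "\<dots> = (\<Sum>m\<in>UNIV. G x $ k $ m * a m) + (dG *v f x) $ k"
        unfolding coord_field_sum_mult[OF M c tc Gg fg]
        by (simp add: a_def dG_def matrix_vector_mult_def x_def)
      finally show ?thesis .
    qed
    have coeff: "(G x *v (\<chi> k. a k + inverse z * (A i x *v f x) $ k)) $ k
        = (\<Sum>m\<in>UNIV. G x $ k $ m * a m) + (dG *v f x) $ k + inverse z * (A' i x *v (G x *v f x)) $ k" for k
    proof -
      \<comment> \<open>Division by \<open>z\<close> is possible here, because the connections are
        evaluated at \<open>z \<noteq> 0\<close>.\<close>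
      have gi: "dG $ k $ m = inverse z * ((G x ** A i x) $ k $ m - (A' i x ** G x) $ k $ m)" for m
        unfolding gauge[symmetric] using zt(2) by (simp flip: mult.assoc)
      have "(dG *v f x) $ k = (\<Sum>m\<in>UNIV. inverse z * ((G x ** A i x) $ k $ m - (A' i x ** G x) $ k $ m) * f x $ m)"
        unfolding matrix_vector_mult_def vec_lambda_beta gi ..
      also have "\<dots> = inverse z * (((G x ** A i x) *v f x) $ k - ((A' i x ** G x) *v f x) $ k)"
        by (simp add: matrix_vector_mult_def sum_distrib_left sum_subtractf algebra_simps)
      finally have dG: "(dG *v f x) $ k
          = inverse z * ((G x *v (A i x *v f x)) $ k - (A' i x *v (G x *v f x)) $ k)"
        by (simp add: matrix_vector_mul_assoc)
      have "(G x *v (\<chi> k. a k + inverse z * (A i x *v f x) $ k)) $ k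
          = (\<Sum>m\<in>UNIV. G x $ k $ m * a m) + inverse z * (G x *v (A i x *v f x)) $ k"
        unfolding matrix_vector_mult_def[of "G x"]
        by (simp add: distrib_left sum.distrib sum_distrib_left mult_ac)
      then show ?thesis by (simp add: dG right_diff_distrib)
    qed
    have "\<Phi> x (nabla s x (coord_field \<A> c i t))
        = (\<Sum>k\<in>UNIV. scaleC ((G x *v (\<chi> k. a k + inverse z * (A i x *v f x) $ k)) $ k) (v' k x))"
      unfolding nab \<Phi>_def holo_frame_coords[OF fr xW] ..
    also have "\<dots> = nabla' (\<lambda>x. \<Phi> x (s x)) x (coord_field \<A> c i t)"
      unfolding nab' a' coeff ..
    finally show ?thesis by (simp add: x_def)
  qed
  \<comment> \<open>Both sides are linear in \<open>D\<close>, so the coordinate fields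
    decide.\<close>
  have flat: "\<Phi> (z, t) (nabla s (z, t) D) = nabla' (\<lambda>x. \<Phi> x (s x)) (z, t) D"
    if V: "open V" "V \<subseteq> W" and s: "holo_section (cyl \<A>) H V s" and zt: "(z, t) \<in> V" "z \<noteq> 0"
      and D: "D \<in> tangent_space \<A> t" for V s z t D
  proof -
    have xW: "(z, t) \<in> W" using zt V by blast
    have tc: "t \<in> fst c" using xW W(3) by auto
    have s': "holo_section (cyl \<A>) H' V (\<lambda>x. \<Phi> x (s x))"
      using sec[OF V holo_sectionD(1)[OF s]] s by blast
    obtain w :: "complex ^ 'n" where w: "D = (\<lambda>f. \<Sum>i\<in>UNIV. w $ i * coord_field \<A> c i t f)"
      by (rule tangent_vector_coords[OF M c tc D])
    have "\<Phi> (z, t) (nabla s (z, t) D)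
        = \<Phi> (z, t) (\<Sum>i\<in>UNIV. scaleC (w $ i) (nabla s (z, t) (coord_field \<A> c i t)))"
      unfolding w by (subst T_structure_coords[OF T V(1) s zt c tc]) simp_all
    also have "\<dots> = (\<Sum>i\<in>UNIV. scaleC (w $ i) (\<Phi> (z, t) (nabla s (z, t) (coord_field \<A> c i t))))"
      by (rule clinear_on_sum[OF sub \<Phi>_lin[OF xW]])
        (rule T_structure.in_fibre[OF T V(1) s zt coord_field_in_tangent_space[OF c tc]])
    also have "\<dots> = (\<Sum>i\<in>UNIV. scaleC (w $ i) (nabla' (\<lambda>x. \<Phi> x (s x)) (z, t) (coord_field \<A> c i t)))"
      by (simp only: flat_coord[OF V s zt])
    also have "\<dots> = nabla' (\<lambda>x. \<Phi> x (s x)) (z, t) D"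
      unfolding w by (subst T_structure_coords[OF T' V(1) s' zt c tc]) simp_all
    finally show ?thesis .
  qed
  show ?thesis
    unfolding T_germs_isomorphic_def
  proof (intro exI[of _ W] exI[of _ \<Phi>] conjI ballI allI impI W(1,2))
    show "bij_betw (\<Phi> x) (fibre H x) (fibre H' x)" if "x \<in> W" for x by (rule \<Phi>_bij[OF that])
    show "clinear_on (fibre H x) (\<Phi> x)" if "x \<in> W" for x by (rule \<Phi>_lin[OF that])
    show "holo_section (cyl \<A>) H V s \<longleftrightarrow> holo_section (cyl \<A>) H' V (\<lambda>x. \<Phi> x (s x))"
      if "open V \<and> V \<subseteq> W \<and> (\<forall>x\<in>V. s x \<in> fibre H x)" for V s
      by (rule sec) (use that in auto)
    show "\<Phi> (z, t) (nabla s (z, t) D) = nabla' (\<lambda>x. \<Phi> x (s x)) (z, t) D"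
      if "open V \<and> V \<subseteq> W \<and> holo_section (cyl \<A>) H V s \<and> (z, t) \<in> V \<and> z \<noteq> 0"
        "D \<in> tangent_space \<A> t" for V s z t D
      by (rule flat[of V]) (use that in auto)
  qed
qed

lemma holo_frame_subset:
  assumes "holo_frame \<B> H W v co" "W' \<subseteq> W"
  shows "holo_frame \<B> H W' v co"
  unfolding holo_frame_def
proof (intro conjI ballI allI impI)
  fix x assume "x \<in> W'"
  then have x: "x \<in> W" using assms(2) by blast
  show "v j x \<in> fibre H x" "bij_betw (co x) (fibre H x) UNIV" "clinear_on (fibre H x) (co x)" for j
    by (rule holo_frameD[OF assms(1) x])+
  show "(\<Sum>j\<in>UNIV. scaleC (co x h $ j) (v j x)) = h" if "h \<in> fibre H x" for h
    by (rule holo_frameD(4)[OF assms(1) x that])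
next
  fix V s assume "open V \<and> V \<subseteq> W' \<and> (\<forall>x\<in>V. s x \<in> fibre H x)"
  then show "holo_section \<B> H V s \<longleftrightarrow> mholo \<B> V (\<lambda>x. co x (s x))"
    using assms(2) by (intro holo_frame_section_iff[OF assms(1)]) auto
qed

lemma connection_matricesD:
  assumes "connection_matrices \<A> nabla c t0 v A"
  shows "holo_germ (cyl \<A>) (0, t0) (A i)"
    and "\<forall>\<^sub>F x in nhds (0, t0). fst x \<noteq> 0 \<longrightarrow> (\<forall>i j. cov nabla (coord_field \<A> c i) (v j) x
        = (\<Sum>k\<in>UNIV. scaleC (inverse (fst x) * A i x $ k $ j) (v k x)))"
  using assms by (simp_all add: connection_matrices_def case_prod_unfold)

text \<open>Taking constant terms is a ring homomorphism, so it carries the inverse matrix to an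
  inverse.\<close>

lemma convergent_GL_det:
  assumes "convergent_GL P"
  shows "det (\<chi> a b. fps_nth (P $ a $ b) 0) \<noteq> 0"
proof -
  obtain Q where Q: "P ** Q = mat 1" using assms by (auto simp: convergent_GL_def)
  have "(\<chi> a b. fps_nth (P $ a $ b) 0) ** (\<chi> a b. fps_nth (Q $ a $ b) 0) = mat 1"
  proof -
    have "fps_nth ((P ** Q) $ a $ b) 0 = fps_nth (mat 1 $ a $ b) 0" for a b by (simp only: Q)
    then show ?thesis
      by (simp add: vec_eq_iff matrix_matrix_mult_def fps_sum_nth mat_def if_distrib cong: if_cong)
  qed
  then show ?thesis using invertible_det_nz invertible_right_inverse by blast
qed

theorem theorem5p6:
  fixes \<A> :: "('m::t2_space, complex ^ 'n::finite) chart set"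
    and H :: "(complex \<times> 'm, 'v::complex_vector, 'r::finite) vector_bundle"
    and H' :: "(complex \<times> 'm, 'w::complex_vector, 'r) vector_bundle"
    and nabla :: "('m, 'v) T_conn" and nabla' :: "('m, 'w) T_conn"
    and t\<^sub>0 :: 'm
    and c :: "('m, complex ^ 'n) chart"
    and v :: "'r \<Rightarrow> complex \<times> 'm \<Rightarrow> 'v" and v' :: "'r \<Rightarrow> complex \<times> 'm \<Rightarrow> 'w"
    and A A' :: "'n \<Rightarrow> complex \<times> 'm \<Rightarrow> complex ^ 'r ^ 'r"
    and T :: "'m \<Rightarrow> complex fps ^ 'r ^ 'r"
  assumes "T_structure \<A> H nabla" and "T_structure \<A> H' nabla'"
    and "stalk_basis (cyl \<A>) H (0, t\<^sub>0) v" and "stalk_basis (cyl \<A>) H' (0, t\<^sub>0) v'"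
    and "c \<in> \<A>" and "t\<^sub>0 \<in> fst c"
    and "connection_matrices \<A> nabla c t\<^sub>0 v A" and "connection_matrices \<A> nabla' c t\<^sub>0 v' A'"
    and "formal_GL \<A> t\<^sub>0 T"
    and "defines_formal_isomorphism \<A> c t\<^sub>0 A A' T"
    and "convergent_GL (T t\<^sub>0)"
  shows "(\<exists>F. holo_GL (cyl \<A>) (0, t\<^sub>0) F \<and> formal_eq t\<^sub>0 (formalize F) T) \<and>
         T_germs_isomorphic \<A> H nabla H' nabla' (0, t\<^sub>0)"
proof -
  note M = T_structure.manifold[OF assms(1)]
  note MC = complex_manifold_cyl[OF M]
  have fm: "formal_matrix \<A> t\<^sub>0 T" using assms(9) by (simp add: formal_GL_def)
  have conv: "fps_conv_radius (T t\<^sub>0 $ a $ b) > 0" for a b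
    using assms(11) by (simp add: convergent_GL_def)
  obtain F where F: "holo_germ (cyl \<A>) (0, t\<^sub>0) F" "formal_eq t\<^sub>0 (formalize F) T"
    and F0: "\<And>a b. F (0, t\<^sub>0) $ a $ b = fps_nth (T t\<^sub>0 $ a $ b) 0"
    and pde: "\<forall>\<^sub>F x in nhds (0, t\<^sub>0). snd x \<in> fst c \<and> (\<forall>i a b.
        fst x * coord_field \<A> c i (snd x) (\<lambda>\<tau>. F (fst x, \<tau>) $ a $ b)
          + (A i x ** F x) $ a $ b - (F x ** A' i x) $ a $ b = 0)"
    by (rule formal_isomorphism_converges[OF M assms(5,6) connection_matricesD(1)[OF assms(7)]
        connection_matricesD(1)[OF assms(8)] fm assms(10) conv]) (rule that)
  \<comment> \<open>Invertibility of the germ \<open>F\<close> is decided by its value at the base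
    point, which is the constant term of the invertible matrix \<open>T t\<^sub>0\<close>.\<close>
  have "F (0, t\<^sub>0) = (\<chi> a b. fps_nth (T t\<^sub>0 $ a $ b) 0)" by (simp add: vec_eq_iff F0)
  then have "det (F (0, t\<^sub>0)) \<noteq> 0" using convergent_GL_det[OF assms(11)] by simp
  from holo_GL_of_det[OF MC F(1) this]
  have GL: "holo_GL (cyl \<A>) (0, t\<^sub>0) F" .
  then obtain G where G: "holo_germ (cyl \<A>) (0, t\<^sub>0) G"
    and inv: "\<forall>\<^sub>F x in nhds (0, t\<^sub>0). F x ** G x = mat 1 \<and> G x ** F x = mat 1"
    by (auto simp: holo_GL_def)
  obtain WF where WF: "open WF" "(0, t\<^sub>0) \<in> WF" "mholo (cyl \<A>) WF F" using F(1) by (auto simp: holo_germ_def)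
  obtain WG where WG: "open WG" "(0, t\<^sub>0) \<in> WG" "mholo (cyl \<A>) WG G" using G by (auto simp: holo_germ_def)
  obtain W1 co where W1: "open W1" "(0, t\<^sub>0) \<in> W1" "holo_frame (cyl \<A>) H W1 v co"
    by (rule stalk_basis_frame[OF MC T_structure.vbundle[OF assms(1)] assms(3)])
  obtain W2 co' where W2: "open W2" "(0, t\<^sub>0) \<in> W2" "holo_frame (cyl \<A>) H' W2 v' co'"
    by (rule stalk_basis_frame[OF MC T_structure.vbundle[OF assms(2)] assms(4)])
  \<comment> \<open>All data are restricted to one neighbourhood \<open>W\<close>, since
    \<open>gauge_isomorphism\<close> works over a single open set.\<close>
  have "\<forall>\<^sub>F x in nhds (0, t\<^sub>0). x \<in> WF \<inter> WG \<inter> W1 \<inter> W2"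
    using WF WG W1 W2 by (intro eventually_nhds_in_open) auto
  from eventually_conj[OF this eventually_conj[OF inv eventually_conj[OF pde
        eventually_conj[OF connection_matricesD(2)[OF assms(7)] connection_matricesD(2)[OF assms(8)]]]]]
  obtain W where W: "open W" "(0, t\<^sub>0) \<in> W" and P: "\<forall>x\<in>W. x \<in> WF \<inter> WG \<inter> W1 \<inter> W2 \<and>
      (F x ** G x = mat 1 \<and> G x ** F x = mat 1) \<and>
      (snd x \<in> fst c \<and> (\<forall>i a b. fst x * coord_field \<A> c i (snd x) (\<lambda>\<tau>. F (fst x, \<tau>) $ a $ b)
          + (A i x ** F x) $ a $ b - (F x ** A' i x) $ a $ b = 0)) \<and>
      (fst x \<noteq> 0 \<longrightarrow> (\<forall>i j. cov nabla (coord_field \<A> c i) (v j) x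
        = (\<Sum>k\<in>UNIV. scaleC (inverse (fst x) * A i x $ k $ j) (v k x)))) \<and>
      (fst x \<noteq> 0 \<longrightarrow> (\<forall>i j. cov nabla' (coord_field \<A> c i) (v' j) x
        = (\<Sum>k\<in>UNIV. scaleC (inverse (fst x) * A' i x $ k $ j) (v' k x))))"
    unfolding eventually_nhds by (elim exE conjE)
  have sub: "W \<subseteq> WF" "W \<subseteq> WG" "W \<subseteq> W1" "W \<subseteq> W2" "W \<subseteq> UNIV \<times> fst c"
    using P by (auto simp: mem_Times_iff)
  have "T_germs_isomorphic \<A> H nabla H' nabla' (0, t\<^sub>0)"
    by (rule gauge_isomorphism[OF assms(1,2,5) W sub(5) holo_frame_subset[OF W1(3) sub(3)]
        holo_frame_subset[OF W2(3) sub(4)] mholo_subset[OF WF(3) sub(1)] mholo_subset[OF WG(3) sub(2)]])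
      (drule bspec[OF P], blast)+
  with GL F(2) show ?thesis by (intro conjI exI[of _ F])
qed

end
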